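(* Let $c\in(0,1/3)$ be given. Suppose $k:[1,\infty)\to(0,\infty)$ is an increasing and unbounded function satisfying $k(y)\le y^{c}$ for all $y\ge 1$. Let $\Sigma=\{\sigma(m)/m : m\ge 1\}$. Then: (a) If $\ell=a/b\in(\mathbb{Q}\cap(1,\infty))\setminus\Sigma$ with $a,b$ positive integers and $\gcd(a,b)=1$, then $$\#W(\ell;k;x)=O\left(ab^3x^{2/3+c+o(1)}\right)$$ for $1<\ell\le x^{c}$ and $x\ge 1$, where the implicit constants are absolute. (b) If $\ell=a/b\in\Sigma$ with $a,b$ positive integers and $\gcd(a,b)=1$, and there exists $\delta>0$ such that $k(y)\ge y^{\delta}$ for all $y\ge 1$, then $$\lim_{x\to\infty}\frac{\#W(\ell;k;x)}{x/\log x}=\sum_{\sigma(m)=\ell m}\frac1m,$$ where the sum is over all positive integers $m$ with $\sigma(m)=\ell m$.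
   Context: $\sigma(n)$ denotes the sum of all positive divisors of the positive integer $n$. For a real number $\ell\ge 1$, a function $k:[1,\infty)\to(0,\infty)$ and $x\ge 1$, $$W(\ell;k;x):=\{n\in\mathbb{N}: n\le x,\ |\sigma(n)-\ell n|<k(n)\}.$$ Here $o(1)$ in an exponent denotes a quantity depending only on $x$ that tends to $0$ as $x\to\infty$ (so, like the implied constant, it does not depend on $a$, $b$ or $k$). *)

theory Defs
  imports "HOL-Analysis.Analysis"
begin

(* At n = 0 the index set is infinite and the sum is 0; only n > 0 is used below. *)
definition divisor_sigma :: "nat \<Rightarrow> nat" where
  "divisor_sigma n = (\<Sum>d | d dvd n. d)"

definition abundancy_values :: "real set" where
  "abundancy_values = {real (divisor_sigma m) / real m | m. m \<ge> 1}"

definition within_perfect :: "real \<Rightarrow> (real \<Rightarrow> real) \<Rightarrow> real \<Rightarrow> nat set" where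
  "within_perfect l k x =
     {n. n \<ge> 1 \<and> real n \<le> x \<and> \<bar>real (divisor_sigma n) - l * real n\<bar> < k (real n)}"

(* A function from [1, infinity) to (0, infinity) is represented by a total function whose values
   off {1..} play no role.  "Increasing" is taken in the weak sense. *)
definition admissible_threshold :: "real \<Rightarrow> (real \<Rightarrow> real) \<Rightarrow> bool" where
  "admissible_threshold c k \<longleftrightarrow>
     (\<forall>y\<ge>1. 0 < k y) \<and> mono_on {1..} k \<and> \<not> bdd_above (k ` {1..}) \<and>
     (\<forall>y\<ge>1. k y \<le> y powr c)"

end

theory Submission
  imports Defs "HOL-Complex_Analysis.Complex_Analysis" "HOL-Number_Theory.Prime_Powers"
    "HOL-Real_Asymp.Real_Asymp"
begin

text \<open>Write \<open>j = b \<sigma>(n) - a n\<close>, so that \<open>|j| < b x\<^sup>c\<close> on \<open>W\<close>. If \<open>n = m k\<close> with \<open>m\<close> and \<open>k\<close> coprime, then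
  \<open>b \<sigma>(m) \<sigma>(k) = a m k + j\<close> confines \<open>k\<close> to one residue class modulo \<open>\<sigma>(m) / gcd(a m, \<sigma>(m))\<close>. Either
  \<open>n\<close> has such a divisor \<open>m\<close> between \<open>x\<close> to the powers 1/3 and 2/3, or an exact prime power divisor
  beyond the latter. The first case and that of proper prime powers contribute
  \<open>O(a b)\<close> times \<open>x\<close> to the power \<open>2/3 + c\<close>. In the remaining case \<open>n = p m\<close> with \<open>m\<close> small, where \<open>m\<close>
  and \<open>j\<close> determine \<open>p\<close> unless \<open>b \<sigma>(m) = a m\<close>; those exceptions have \<open>\<sigma>(n) - (a/b) n = \<sigma>(m)\<close>, do not occur in
  part (a), and give the main term of part (b) by the prime number theorem. That theorem is proved
  by Newman's contour method. The solutions of \<open>b \<sigma>(m) = a m\<close> number \<open>O(x / ln\<^sup>2 x)\<close>, because such an \<open>m\<close> is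
  determined by its quotient by any exact prime power divisor.\<close>

section \<open>Newman's Tauberian theorem for Dirichlet series\<close>

text \<open>The exponent 2/3 is a balance. Averaged over the defects, a unitary divisor
  \<open>m\<close> leaves about \<open>1 + a * x / m^2\<close> cofactors per defect; over
  \<open>z < m <= z^2\<close> this adds up to about \<open>z^2 + a * x / z\<close>, and for fixed
  \<open>a\<close> the two terms have equal order at \<open>z = x powr (1/3)\<close>. The divisors
  must be unitary because only then does \<open>sigma\<close> split as a product over
  \<open>n = m * k\<close>. The obstacle is the exceptional family \<open>n = p * m\<close> with
  \<open>m\<close> an exact solution: its defect does not depend on \<open>p\<close>, so every large
  prime gives an element of \<open>W\<close> once \<open>k\<close> exceeds \<open>sigma m\<close>.
  Summing the prime counts over \<open>m\<close> requires the series of \<open>1 / m\<close> over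
  the exact solutions to converge, and a count \<open>O(x / ln x)\<close> of them would not ensure
  that; hence the second logarithm. The same bound makes the exact solutions themselves, which also
  lie in \<open>W\<close>, negligible against \<open>x / ln x\<close>. On the analytic side Newman's
  method is applied not to primes directly but to the bounded coefficients
  \<open>(psi n - n) / n\<close>; convergence at \<open>s = 1\<close> together with the monotonicity
  of \<open>psi\<close> gives \<open>psi n ~ n\<close>.\<close>

lemma powr_mvt:
  fixes a b u :: real
  assumes "0 < a" "a < b"
  obtains \<xi> where "a < \<xi>" "\<xi> < b" "b powr u - a powr u = (b - a) * (u * \<xi> powr (u - 1))"
proof -
  have "\<exists>\<xi>>a. \<xi> < b \<and> b powr u - a powr u = (b - a) * (u * \<xi> powr (u - 1))"
    using assms by (intro MVT2) (auto intro!: derivative_eq_intros)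
  then show ?thesis using that by blast
qed

text \<open>Integral comparison in telescoping form: summed over \<open>n >= N\<close> the
  right-hand sides collapse to \<open>N powr (- x) / x\<close>.\<close>

lemma powr_tail_term_le:
  fixes n :: nat and x :: real
  assumes "n \<ge> 1" "x > 0"
  shows "real (Suc n) powr (- 1 - x) \<le> (real n powr (- x) - real (Suc n) powr (- x)) / x"
proof -
  obtain \<xi> where \<xi>: "real n < \<xi>" "\<xi> < real (Suc n)"
    "real (Suc n) powr (-x) - real n powr (-x) = (real (Suc n) - real n) * (-x * \<xi> powr (-x - 1))"
    using powr_mvt[of "real n" "real (Suc n)" "-x"] assms by auto
  have "real (Suc n) powr (- x - 1) \<le> \<xi> powr (-x-1)"
    using \<xi> assms by (intro powr_mono2') auto
  then have "x * real (Suc n) powr (- x - 1) \<le> x * \<xi> powr (- x - 1)"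
    using assms by (intro mult_left_mono) auto
  also have "\<dots> = real n powr (- x) - real (Suc n) powr (- x)" using \<xi>(3) by simp
  finally show ?thesis using assms by (simp add: field_simps minus_diff_commute[of 1])
qed

text \<open>Integral comparison again. For \<open>u >= 1\<close> the summand increases, so the last
  term escapes the integral and is added separately; for \<open>u < 1\<close> it decreases and the
  integral alone suffices.\<close>

lemma sum_powr_le:
  fixes u :: real
  assumes u: "u > 0"
  shows "N \<ge> 1 \<Longrightarrow> (\<Sum>n=1..N. real n powr (u - 1)) \<le> real N powr u / u + real N powr (u - 1)"
proof (cases "u \<ge> 1")
  case True
  assume "N \<ge> 1"
  then show ?thesis
  proof (induction N rule: dec_induct)
    case base
    then show ?case using u by simp
  next
    case (step n)
    obtain \<xi> where \<xi>: "real n < \<xi>" "\<xi> < real (Suc n)"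
      "real (Suc n) powr u - real n powr u = (real (Suc n) - real n) * (u * \<xi> powr (u - 1))"
      using powr_mvt[of "real n" "real (Suc n)" u] step by auto
    have "real n powr (u - 1) \<le> \<xi> powr (u-1)"
      using \<xi> True by (intro powr_mono2) auto
    then have "real n powr u / u + real n powr (u-1) \<le> real (Suc n) powr u / u"
      using \<xi>(3) u by (simp add: field_simps)
    then show ?case using step by simp
  qed
next
  case False
  assume "N \<ge> 1"
  then have "(\<Sum>n=1..N. real n powr (u - 1)) \<le> real N powr u / u"
  proof (induction N rule: dec_induct)
    case base
    then show ?case using u False by simp
  next
    case (step n)
    obtain \<xi> where \<xi>: "real n < \<xi>" "\<xi> < real (Suc n)"
      "real (Suc n) powr u - real n powr u = (real (Suc n) - real n) * (u * \<xi> powr (u - 1))"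
      using powr_mvt[of "real n" "real (Suc n)" u] step by auto
    have "real (Suc n) powr (u - 1) \<le> \<xi> powr (u-1)"
      using \<xi> False by (intro powr_mono2') auto
    then have "real n powr u / u + real (Suc n) powr (u-1) \<le> real (Suc n) powr u / u"
      using \<xi>(3) u by (simp add: field_simps)
    then show ?case using step by simp
  qed
  then show ?thesis by (smt (verit) powr_ge_zero)
qed

text \<open>The blow-up \<open>1 / Re z\<close> near the imaginary axis is tolerable because
  Newman's kernel carries a factor \<open>Re z\<close> on the circle, see
  \<open>newman_kernel_norm\<close>.\<close>

lemma dirichlet_tail_bound:
  fixes a :: "nat \<Rightarrow> complex"
  assumes bound: "\<And>n. norm (a n) \<le> A" and N: "N \<ge> 1" and x: "Re z > 0"
    and sums: "(\<lambda>n. a n * of_nat n powr (- (1 + z))) sums g"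
  shows "norm (g - (\<Sum>n=1..N. a n * of_nat n powr (- (1 + z)))) \<le> A * (real N powr (- Re z) / Re z)"
proof -
  define t where "t n = a n * of_nat n powr (- (1 + z))" for n
  define q where "q n = real (n + N) powr (- Re z)" for n
  have A: "A \<ge> 0" using bound[of 0] norm_ge_zero order_trans by blast
  have "(\<lambda>n. t (n + Suc N)) sums (g - (\<Sum>n<Suc N. t n))"
    using sums sums_split_initial_segment unfolding t_def by blast
  \<comment> \<open>The index 0 contributes nothing, because \<open>0 powr w = 0\<close>.\<close>
  moreover have "(\<Sum>n<Suc N. t n) = (\<Sum>n=1..N. t n)"
    unfolding lessThan_Suc_atMost by (intro sum.mono_neutral_right) (auto simp: t_def not_less_eq_eq)
  ultimately have s1: "(\<lambda>n. t (n + Suc N)) sums (g - (\<Sum>n=1..N. t n))" by simp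
  have "filterlim (\<lambda>n. real (n + N)) at_top sequentially"
    by real_asymp
  then have "q \<longlonglongrightarrow> 0"
    unfolding q_def using x by (intro tendsto_neg_powr) auto
  then have "(\<lambda>n. q n - q (Suc n)) sums (q 0 - 0)" by (rule telescope_sums')
  then have s2: "(\<lambda>n. A * ((q n - q (Suc n)) / Re z)) sums (A * (q 0 / Re z))"
    by (intro sums_mult sums_divide) simp
  have le: "norm (t (n + Suc N)) \<le> A * ((q n - q (Suc n)) / Re z)" for n
  proof -
    have "norm (t (n + Suc N)) \<le> A * real (Suc (n + N)) powr (- 1 - Re z)"
      unfolding t_def norm_mult using bound A
      by (intro mult_mono) (auto simp: norm_powr_real_powr simp del: of_nat_Suc)
    also have "\<dots> \<le> A * ((q n - q (Suc n)) / Re z)"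
      using powr_tail_term_le[of "n + N" "Re z"] N x A unfolding q_def by (intro mult_left_mono) auto
    finally show ?thesis .
  qed
  have "norm (\<Sum>n. t (n + Suc N)) \<le> (\<Sum>n. A * ((q n - q (Suc n)) / Re z))"
    using le s2 by (intro norm_suminf_le) (auto simp: sums_iff)
  then show ?thesis using s1 s2 by (auto simp: sums_iff t_def q_def)
qed

lemma dirichlet_head_bound:
  fixes a :: "nat \<Rightarrow> complex"
  assumes bound: "\<And>n. norm (a n) \<le> A" and N: "N \<ge> 1" and x: "Re z < 0"
  shows "norm (\<Sum>n=1..N. a n * of_nat n powr (- (1 + z)))
    \<le> A * (real N powr (- Re z) / (- Re z) + real N powr (- Re z - 1))"
proof -
  have A: "A \<ge> 0" using bound[of 0] norm_ge_zero order_trans by blast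
  have "norm (\<Sum>n=1..N. a n * of_nat n powr (- (1 + z))) \<le> (\<Sum>n=1..N. A * real n powr (- Re z - 1))"
    using bound A by (intro sum_norm_le) (auto simp: norm_mult norm_powr_real_powr minus_diff_commute[of 1] intro!: mult_mono)
  also have "\<dots> \<le> A * (real N powr (- Re z) / (- Re z) + real N powr (- Re z - 1))"
    unfolding sum_distrib_left[symmetric] using sum_powr_le[of "- Re z" N] x N A
    by (intro mult_left_mono) auto
  finally show ?thesis .
qed

text \<open>On the circle \<open>R^2 = z * cnj z\<close>, so the kernel collapses to
  \<open>2 * Re z / R^2\<close>. This is the purpose of the factor \<open>1 + z^2 / R^2\<close>: it
  keeps the residue of \<open>1 / z\<close> at 0 and vanishes at the two points where the circle
  meets the imaginary axis.\<close>

lemma newman_kernel_norm: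
  fixes z :: complex
  assumes "norm z = R" "R > 0"
  shows "norm ((1 + z\<^sup>2 / of_real R ^ 2) / z) = 2 * \<bar>Re z\<bar> / R\<^sup>2"
proof -
  have z0: "z \<noteq> 0" using assms by auto
  have "of_real R ^ 2 = z * cnj z" using assms complex_norm_square[of z] by simp
  then have "(1 + z\<^sup>2 / of_real R ^ 2) / z = (z + cnj z) / (z * cnj z)"
    using z0 by (simp add: field_simps power2_eq_square)
  also have "\<dots> = of_real (2 * Re z) / of_real (R\<^sup>2)"
    using complex_norm_square[of z] assms by (simp add: complex_add_cnj)
  finally show ?thesis by (simp add: norm_divide norm_power)
qed

lemma part_circlepath_inverse_integral:
  assumes "r > 0" "s < t"
  shows "((\<lambda>z. 1 / z) has_contour_integral (\<i> * of_real (t - s))) (part_circlepath 0 r s t)"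
proof -
  have "((\<lambda>x. \<i>) has_integral (t - s) *\<^sub>R \<i>) {s..t}"
    using has_integral_const_real[of \<i> s t] assms by simp
  moreover have "(\<lambda>x. 1 / (0 + of_real r * cis x) * of_real r * \<i> * cis x) = (\<lambda>x. \<i>)"
    using assms by (auto simp: field_simps)
  ultimately show ?thesis
    unfolding has_contour_integral_part_circlepath_iff[OF assms(2)]
    by (simp add: scaleR_conv_of_real mult.commute mult.assoc del: times_divide_eq_left times_divide_eq_right)
qed

text \<open>Cauchy's formula with the winding number replaced by a known integral of
  \<open>1 / z\<close>: after subtracting \<open>E 0 / z\<close> an entire function remains, whose
  integral over a closed path is 0.\<close>

lemma entire_divided_difference_closed:
  assumes "E holomorphic_on UNIV" "valid_path g" "pathfinish g = pathstart g"
    "0 \<notin> path_image g" "((\<lambda>z. 1 / z) has_contour_integral I) g"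
  shows "((\<lambda>z. E z / z) has_contour_integral (E 0 * I)) g"
proof -
  define D where "D z = (if z = 0 then deriv E 0 else (E z - E 0) / (z - 0))" for z
  have "D holomorphic_on UNIV" unfolding D_def
    by (rule pole_lemma) (use assms in auto)
  then have "(D has_contour_integral 0) g"
    by (rule Cauchy_theorem_convex_simple) (use assms in auto)
  then have "((\<lambda>z. D z + E 0 * (1 / z)) has_contour_integral (0 + E 0 * I)) g"
    by (intro has_contour_integral_add has_contour_integral_lmul assms)
  moreover have "D z + E 0 * (1 / z) = E z / z" if "z \<in> path_image g" for z
    using that assms by (auto simp: D_def field_simps)
  ultimately show ?thesis
    by (metis (no_types, lifting) add_0 has_contour_integral_eq)
qed

text \<open>A quantitative Riemann-Lebesgue lemma: \<open>N powr z / ln N\<close> is an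
  antiderivative of \<open>N powr z\<close>, and it has modulus \<open>1 / ln N\<close> on the
  imaginary axis.\<close>

lemma oscillating_segment_bound:
  fixes h :: "complex \<Rightarrow> complex" and R :: real
  assumes h: "h holomorphic_on V" "open V" "closed_segment (-\<i> * of_real R) (\<i> * of_real R) \<subseteq> V"
  obtains C where "\<And>N. N \<ge> 2 \<Longrightarrow>
    norm (contour_integral (linepath (-\<i> * of_real R) (\<i> * of_real R)) (\<lambda>z. h z * of_nat N powr z))
      \<le> C / ln (real N)"
proof -
  let ?a = "-\<i> * of_real R :: complex" and ?b = "\<i> * of_real R :: complex"
  let ?S = "closed_segment ?a ?b"
  have Re0: "Re z = 0" if "z \<in> ?S" for z
    using that by (auto simp: closed_segment_def)
  have dh: "deriv h holomorphic_on V" using h holomorphic_deriv by blast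
  have cont: "continuous_on ?S (deriv h)"
    using dh h(3) holomorphic_on_imp_continuous_on continuous_on_subset by blast
  then have "bounded (deriv h ` ?S)"
    by (intro compact_imp_bounded compact_continuous_image) auto
  then obtain B where B: "\<And>z. z \<in> ?S \<Longrightarrow> norm (deriv h z) \<le> B" and "B > 0"
    unfolding bounded_pos by auto
  define C where "C = norm (h ?b) + norm (h ?a) + B * norm (?b - ?a)"
  have "norm (contour_integral (linepath ?a ?b) (\<lambda>z. h z * of_nat N powr z)) \<le> C / ln (real N)"
    if N: "N \<ge> 2" for N
  proof -
    have ln: "ln (real N) > 0" using N by simp
    have LnN: "Ln (of_nat N) = of_real (ln (real N))"
      using N Ln_of_real[of "real N"] by simp
    define P where "P z = h z * of_nat N powr z / of_real (ln (real N))" for z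
    have nN: "norm ((of_nat N :: complex) powr z) = 1" if "z \<in> ?S" for z
      using Re0[OF that] N by (simp add: norm_powr_real_powr)
    have "(P has_field_derivative (h z * of_nat N powr z
        + deriv h z * of_nat N powr z / of_real (ln (real N)))) (at z within ?S)" if "z \<in> ?S" for z
    proof -
      have "(h has_field_derivative deriv h z) (at z)"
        using h that by (intro holomorphic_derivI[of h V]) auto
      then have "(P has_field_derivative (h z * of_nat N powr z
        + deriv h z * of_nat N powr z / of_real (ln (real N)))) (at z)"
        unfolding P_def using ln N LnN
        by (auto intro!: derivative_eq_intros simp: field_simps)
      then show ?thesis by (rule DERIV_subset) auto
    qed
    then have I1: "((\<lambda>z. h z * of_nat N powr z + deriv h z * of_nat N powr z / of_real (ln (real N)))
        has_contour_integral (P ?b - P ?a)) (linepath ?a ?b)"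
      using contour_integral_primitive[of ?S P _ "linepath ?a ?b"] by auto
    have "continuous_on ?S (\<lambda>z. deriv h z * of_nat N powr z / of_real (ln (real N)))"
      using cont ln N by (intro continuous_intros) auto
    then have "(\<lambda>z. deriv h z * of_nat N powr z / of_real (ln (real N))) contour_integrable_on linepath ?a ?b"
      by (rule contour_integrable_continuous_linepath)
    then obtain J where J: "((\<lambda>z. deriv h z * of_nat N powr z / of_real (ln (real N)))
      has_contour_integral J) (linepath ?a ?b)" unfolding contour_integrable_on_def by blast
    have normJ: "norm J \<le> (B / ln (real N)) * norm (?b - ?a)"
    proof (rule has_contour_integral_bound_linepath[OF J])
      show "0 \<le> B / ln (real N)" using ln \<open>B > 0\<close> by simp
      fix z assume "z \<in> ?S"
      then show "norm (deriv h z * of_nat N powr z / of_real (ln (real N))) \<le> B / ln (real N)"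
        using B[of z] nN[of z] ln by (simp add: norm_mult norm_divide divide_right_mono)
    qed
    have "((\<lambda>z. h z * of_nat N powr z) has_contour_integral (P ?b - P ?a - J)) (linepath ?a ?b)"
      using has_contour_integral_diff[OF I1 J] by simp
    then have "contour_integral (linepath ?a ?b) (\<lambda>z. h z * of_nat N powr z) = P ?b - P ?a - J"
      by (rule contour_integral_unique)
    also have "norm \<dots> \<le> norm (P ?b) + norm (P ?a) + norm J"
      by (smt (verit) norm_triangle_ineq4)
    also have "norm (P ?b) = norm (h ?b) / ln (real N)"
      unfolding P_def norm_divide norm_mult using nN[of ?b] ln by simp
    also have "norm (P ?a) = norm (h ?a) / ln (real N)"
      unfolding P_def norm_divide norm_mult using nN[of ?a] ln by simp
    finally show ?thesis using normJ unfolding C_def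
      by (simp add: add_divide_distrib)
  qed
  then show ?thesis using that by blast
qed

text \<open>An epsilon-neighbourhood of \<open>D\<close> is the Minkowski sum of \<open>D\<close>
  and a ball, hence convex. Convexity allows Cauchy's theorem in its simplest form on a
  neighbourhood of the half disc.\<close>

lemma convex_neighbourhood_compact:
  fixes D :: "complex set"
  assumes "compact D" "convex D" "open U" "D \<subseteq> U"
  obtains V where "open V" "convex V" "D \<subseteq> V" "V \<subseteq> U"
proof -
  obtain e where e: "e > 0" "(\<Union>x\<in>D. ball x e) \<subseteq> U"
    using compact_subset_open_imp_ball_epsilon_subset[OF assms(1,3,4)] by blast
  have "(\<Union>x\<in>D. ball x e) = (\<Union>x\<in>D. \<Union>y\<in>ball 0 e. {x + y})"
  proof (intro equalityI subsetI)
    fix z assume "z \<in> (\<Union>x\<in>D. ball x e)"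
    then obtain x where "x \<in> D" "dist x z < e" by auto
    then show "z \<in> (\<Union>x\<in>D. \<Union>y\<in>ball 0 e. {x + y})"
      by (intro UN_I[of x] UN_I[of "z - x"]) (auto simp: dist_norm norm_minus_commute)
  next
    fix z assume "z \<in> (\<Union>x\<in>D. \<Union>y\<in>ball 0 e. {x + y})"
    then obtain x y where "x \<in> D" "norm y < e" "z = x + y" by auto
    then show "z \<in> (\<Union>x\<in>D. ball x e)"
      by (intro UN_I[of x]) (auto simp: dist_norm)
  qed
  then have "convex (\<Union>x\<in>D. ball x e)"
    using convex_sums[OF assms(2) convex_ball[of 0 e]] by simp
  then show ?thesis using e that[of "\<Union>x\<in>D. ball x e"] by force
qed

text \<open>As \<open>G\<close> vanishes at 1, \<open>G (1 + z) / z\<close> has no pole at 0. Its contour is therefore closed by the segment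
  from \<open>\<i> R\<close> to \<open>- \<i> R\<close>, on which integration by parts gives decay, while the partial sum, being entire,
  is integrated over the left half circle.\<close>

lemma newman_finite_bound:
  fixes a :: "nat \<Rightarrow> complex"
  assumes bound: "\<And>n. norm (a n) \<le> A"
    and U: "open U" "{s. Re s \<ge> 1} \<subseteq> U" and G: "G holomorphic_on U" "G 1 = 0"
    and sums: "\<And>s. Re s > 1 \<Longrightarrow> (\<lambda>n. a n * of_nat n powr (- s)) sums G s"
    and R: "R > 0"
  obtains C where "\<And>N. N \<ge> 2 \<Longrightarrow>
    2 * pi * norm (\<Sum>n=1..N. a n / of_nat n) \<le> A * (4 * pi / R + 2 * pi / real N) + C / ln (real N)"
proof -
  have A: "A \<ge> 0" using bound[of 0] norm_ge_zero order_trans by blast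
  define g where "g z = G (1 + z)" for z
  define D where "D = cball 0 R \<inter> {z::complex. Re z \<ge> 0}"
  have Ug: "open ((\<lambda>z. 1 + z) -` U)" using U(1) by (intro open_vimage continuous_intros)
  have "compact D" unfolding D_def by (intro compact_Int_closed closed_halfspace_Re_ge) auto
  moreover have "convex D" unfolding D_def by (intro convex_Int convex_halfspace_Re_ge) auto
  moreover have "D \<subseteq> (\<lambda>z. 1 + z) -` U" using U(2) unfolding D_def by (auto intro!: subsetD[OF U(2)])
  ultimately obtain V where V: "open V" "convex V" "D \<subseteq> V" "V \<subseteq> (\<lambda>z. 1 + z) -` U"
    using convex_neighbourhood_compact[OF _ _ Ug] by metis
  have "(G \<circ> (\<lambda>z. 1 + z)) holomorphic_on V"
    using V(4) by (intro holomorphic_on_compose_gen[OF _ G(1)] holomorphic_intros) auto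
  then have "g holomorphic_on V"
    by (rule back_subst[of "\<lambda>f. f holomorphic_on V"]) (auto simp: g_def)
  have "0 \<in> V" using V(3) R unfolding D_def by auto
  define q where "q z = (if z = 0 then deriv g 0 else (g z - g 0) / (z - 0))" for z
  have "q holomorphic_on V"
    unfolding q_def using \<open>g holomorphic_on V\<close> \<open>0 \<in> V\<close> V(1)
    by (intro pole_lemma) (auto simp: interior_open)
  have "g 0 = 0" using G(2) by (simp add: g_def)
  define K where "K z = 1 + z\<^sup>2 / (of_real R)\<^sup>2" for z :: complex
  define h where "h z = q z * K z" for z
  have h: "h holomorphic_on V" unfolding h_def K_def
    using \<open>q holomorphic_on V\<close> R by (intro holomorphic_intros) auto
  let ?a = "- \<i> * of_real R :: complex" and ?b = "\<i> * of_real R :: complex"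
  have seg: "closed_segment ?a ?b \<subseteq> D"
  proof (rule closed_segment_subset)
    show "?a \<in> D" "?b \<in> D" using R by (auto simp: D_def norm_mult)
  qed fact
  obtain C where C: "\<And>N. N \<ge> 2 \<Longrightarrow>
    norm (contour_integral (linepath ?a ?b) (\<lambda>z. h z * of_nat N powr z)) \<le> C / ln (real N)"
    using oscillating_segment_bound[OF h V(1)] seg V(3) by (metis subset_trans)
  define \<gamma> where "\<gamma> = part_circlepath 0 R (- pi / 2) (pi / 2)"
  define \<gamma>' where "\<gamma>' = part_circlepath 0 R (pi / 2) (3 * pi / 2)"
  have e1: "exp (\<i> * of_real (pi / 2)) = \<i>" by (metis cis_conv_exp cis_pi_half)
  have e2: "exp (\<i> * of_real (- pi / 2)) = - \<i>"
    by (metis cis_conv_exp cis_minus_pi_half minus_divide_left)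
  have e3: "exp (\<i> * of_real (3 * pi / 2)) = - \<i>"
  proof -
    have "3 * pi / 2 = pi / 2 + pi" by simp
    then show ?thesis by (metis cis_conv_exp cis_pi_half cis_mult cis_pi mult.commute mult_minus1)
  qed
  have ends: "pathstart \<gamma> = ?a" "pathfinish \<gamma> = ?b" "pathstart \<gamma>' = ?b" "pathfinish \<gamma>' = ?a"
    unfolding \<gamma>_def \<gamma>'_def pathstart_part_circlepath pathfinish_part_circlepath e1 e2 e3 by auto
  have im: "norm z = R \<and> Re z \<ge> 0" if "z \<in> path_image \<gamma>" for z
  proof -
    obtain t where t: "-pi/2 \<le> t" "t \<le> pi/2" "z = of_real R * cis t"
      using \<open>z \<in> path_image \<gamma>\<close> unfolding \<gamma>_def by (subst (asm) path_image_part_circlepath) (auto simp: cis_conv_exp)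
    then show ?thesis using R cos_ge_zero[of t] by (auto simp: norm_mult)
  qed
  have im': "norm z = R \<and> Re z \<le> 0" if "z \<in> path_image \<gamma>'" for z
  proof -
    obtain t where t: "pi/2 \<le> t" "t \<le> 3*pi/2" "z = of_real R * cis t"
      using \<open>z \<in> path_image \<gamma>'\<close> unfolding \<gamma>'_def by (subst (asm) path_image_part_circlepath) (auto simp: cis_conv_exp)
    have "cos t = - cos (t - pi)" by simp
    then have "cos t \<le> 0" using cos_ge_zero[of "t - pi"] t by (auto simp: field_simps)
    then show ?thesis using R t by (auto simp: norm_mult mult_le_0_iff)
  qed
  have imD: "path_image \<gamma> \<subseteq> D" using im unfolding D_def by auto
  \<comment> \<open>The pointwise estimates divide by \<open>Re z\<close>, so the endpoints of the
    half circles must be left out; the integral bound used below tolerates a finite exceptional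
    set.\<close>
  have excp: "z \<in> {?a, ?b}" if "norm z = R" "Re z = 0" for z
  proof -
    have "\<bar>Im z\<bar> = R" using that by (simp add: cmod_def)
    then show ?thesis using that R by (auto simp: complex_eq_iff abs_if split: if_splits)
  qed
  have "2 * pi * norm (\<Sum>n=1..N. a n / of_nat n) \<le> A * (4 * pi / R + 2 * pi / real N) + C / ln (real N)"
    if N: "N \<ge> 2" for N
  proof -
    define S where "S z = (\<Sum>n=1..N. a n * of_nat n powr (- (1 + z)))" for z
    define E where "E z = S z * of_nat N powr z * K z" for z
    have N0: "(of_nat N :: complex) \<noteq> 0" using N by simp
    have holS: "S holomorphic_on W" for W unfolding S_def by (intro holomorphic_intros) auto
    have holE: "E holomorphic_on UNIV" unfolding E_def K_def using N0 R
      by (intro holomorphic_intros holS) auto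
    have E0: "E 0 = (\<Sum>n=1..N. a n / of_nat n)"
      unfolding E_def S_def K_def using N0 by (simp add: powr_minus divide_inverse)
    have "((\<lambda>z. 1 / z) has_contour_integral (\<i> * of_real (pi/2 - (-pi/2)) + \<i> * of_real (3*pi/2 - pi/2))) (\<gamma> +++ \<gamma>')"
      unfolding \<gamma>_def \<gamma>'_def using R
      by (intro has_contour_integral_join part_circlepath_inverse_integral) auto
    moreover have "\<i> * of_real (pi/2 - (-pi/2)) + \<i> * of_real (3*pi/2 - pi/2) = 2 * of_real pi * \<i>"
      by (simp add: field_simps)
    ultimately have inv: "((\<lambda>z. 1 / z) has_contour_integral (2 * of_real pi * \<i>)) (\<gamma> +++ \<gamma>')" by (simp only:)
    have vp: "valid_path \<gamma>" "valid_path \<gamma>'" by (auto simp: \<gamma>_def \<gamma>'_def)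
    have tot: "((\<lambda>z. E z / z) has_contour_integral (E 0 * (2 * of_real pi * \<i>))) (\<gamma> +++ \<gamma>')"
    proof (rule entire_divided_difference_closed[OF holE _ _ _ inv])
      show "0 \<notin> path_image (\<gamma> +++ \<gamma>')"
        using im im' R ends vp by (subst path_image_join) force+
    qed (use vp ends in auto)
    have conE: "continuous_on W (\<lambda>z. E z / z)" if "0 \<notin> W" for W
    proof (intro continuous_on_divide continuous_on_id)
      show "continuous_on W E"
        by (rule holomorphic_on_imp_continuous_on[OF holomorphic_on_subset[OF holE]]) simp
    qed (use that in auto)
    have i1: "(\<lambda>z. E z / z) contour_integrable_on \<gamma>"
      unfolding \<gamma>_def using im R by (intro contour_integrable_continuous_part_circlepath conE) (force simp: \<gamma>_def)
    have i2: "(\<lambda>z. E z / z) contour_integrable_on \<gamma>'"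
      unfolding \<gamma>'_def using im' R by (intro contour_integrable_continuous_part_circlepath conE) (force simp: \<gamma>'_def)
    obtain I1 I2 where I1: "((\<lambda>z. E z / z) has_contour_integral I1) \<gamma>"
      and I2: "((\<lambda>z. E z / z) has_contour_integral I2) \<gamma>'"
      using i1 i2 unfolding contour_integrable_on_def by blast
    have I12: "I1 + I2 = E 0 * (2 * of_real pi * \<i>)"
      using has_contour_integral_join[OF I1 I2 vp] tot has_contour_integral_unique by blast
    define f where "f z = h z * of_nat N powr z" for z
    have holf: "f holomorphic_on V" unfolding f_def using h N0 by (intro holomorphic_intros) auto
    then have conf: "continuous_on V f" by (rule holomorphic_on_imp_continuous_on)
    have "(f has_contour_integral 0) (\<gamma> +++ linepath ?b ?a)"
    proof (rule Cauchy_theorem_convex_simple[OF holf V(2)])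
      have "path_image (\<gamma> +++ linepath ?b ?a) \<subseteq> path_image \<gamma> \<union> closed_segment ?b ?a"
        using path_image_join_subset[of \<gamma> "linepath ?b ?a"] by simp
      then show "path_image (\<gamma> +++ linepath ?b ?a) \<subseteq> V"
        using seg imD V(3) by (auto simp: closed_segment_commute)
    qed (use vp ends in auto)
    moreover have fl: "f contour_integrable_on linepath ?a ?b"
      using seg V(3) by (intro contour_integrable_continuous_linepath continuous_on_subset[OF conf]) auto
    then have fl': "(f has_contour_integral (- contour_integral (linepath ?a ?b) f)) (linepath ?b ?a)"
      using has_contour_integral_reversepath[OF _ has_contour_integral_integral[OF fl]] by simp
    moreover have "f contour_integrable_on \<gamma>"
      unfolding \<gamma>_def using imD V(3)
      by (intro contour_integrable_continuous_part_circlepath continuous_on_subset[OF conf]) (auto simp: \<gamma>_def)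
    then obtain J where J: "(f has_contour_integral J) \<gamma>" unfolding contour_integrable_on_def by blast
    ultimately have "J + (- contour_integral (linepath ?a ?b) f) = 0"
      using has_contour_integral_join[OF J fl' vp(1)] ends by (metis has_contour_integral_unique valid_path_linepath)
    then have "J = contour_integral (linepath ?a ?b) f" by simp
    then have nJ: "norm J \<le> C / ln (real N)" using C[OF N] unfolding f_def by simp
    have nIJ: "norm (I1 - J) \<le> (2 * A / R\<^sup>2) * R * (pi / 2 - (- pi / 2))"
    proof (rule has_contour_integral_bound_part_circlepath_strong)
      show "((\<lambda>z. E z / z - f z) has_contour_integral (I1 - J)) (part_circlepath 0 R (- pi / 2) (pi / 2))"
        using has_contour_integral_diff[OF I1 J] unfolding \<gamma>_def .
      show "finite {?a, ?b}" by simp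
      fix z assume "z \<in> path_image (part_circlepath 0 R (- pi / 2) (pi / 2)) - {?a, ?b}"
      then have z: "norm z = R" "Re z > 0" using im[of z] excp[of z] by (force simp: \<gamma>_def)+
      then have z0: "z \<noteq> 0" by auto
      \<comment> \<open>Only the remainder \<open>g z - S z\<close> survives here. Its bound
        \<open>A * N powr (- Re z) / Re z\<close> meets the factors \<open>N powr Re z\<close> and
        \<open>2 * Re z / R^2\<close>, and all dependence on \<open>z\<close> and \<open>N\<close>
        cancels.\<close>
      have "E z / z - f z = (S z - g z) * of_nat N powr z * (K z / z)"
        unfolding E_def f_def h_def q_def using z0 \<open>g 0 = 0\<close> by (simp add: field_simps)
      also have "norm \<dots> = norm (g z - S z) * real N powr Re z * (2 * Re z / R\<^sup>2)"
        unfolding norm_mult K_def newman_kernel_norm[OF z(1) R] using z N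
        by (simp add: norm_powr_real_powr norm_minus_commute)
      also have "\<dots> \<le> (A * (real N powr (- Re z) / Re z)) * real N powr Re z * (2 * Re z / R\<^sup>2)"
        using dirichlet_tail_bound[where a = a and A = A and N = N and z = z and g = "g z"] bound sums[of "1 + z"] z N
        by (intro mult_right_mono) (auto simp: g_def S_def)
      also have "\<dots> = 2 * A / R\<^sup>2"
        using z N by (simp add: powr_minus field_simps)
      finally show "norm (E z / z - f z) \<le> 2 * A / R\<^sup>2" .
    qed (use R A in auto)
    have nI2: "norm I2 \<le> (A * (2 / R\<^sup>2 + 2 / (R * real N))) * R * (3 * pi / 2 - pi / 2)"
    proof (rule has_contour_integral_bound_part_circlepath_strong)
      show "((\<lambda>z. E z / z) has_contour_integral I2) (part_circlepath 0 R (pi / 2) (3 * pi / 2))"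
        using I2 unfolding \<gamma>'_def .
      show "finite {?a, ?b}" by simp
      fix z assume "z \<in> path_image (part_circlepath 0 R (pi / 2) (3 * pi / 2)) - {?a, ?b}"
      then have z: "norm z = R" "Re z < 0" using im'[of z] excp[of z] by (force simp: \<gamma>'_def)+
      have le: "- Re z \<le> R" using z abs_Re_le_cmod[of z] by auto
      have "norm (E z / z) = norm (S z) * real N powr Re z * (2 * (- Re z) / R\<^sup>2)"
      proof -
        have "E z / z = S z * of_nat N powr z * (K z / z)" by (simp add: E_def)
        then show ?thesis unfolding norm_mult K_def using newman_kernel_norm[OF z(1) R] z N
          by (simp only: norm_mult) (simp add: norm_powr_real_powr)
      qed
      also have "\<dots> \<le> A * (real N powr (- Re z) / (- Re z) + real N powr (- Re z - 1))
          * real N powr Re z * (2 * (- Re z) / R\<^sup>2)"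
        using dirichlet_head_bound[where a = a and A = A and N = N and z = z] bound z N
        by (intro mult_right_mono divide_nonneg_nonneg) (auto simp: S_def)
      also have "\<dots> = A * (2 / R\<^sup>2 + (- Re z) * (2 / (R\<^sup>2 * real N)))"
      proof -
        have p: "real N powr (- Re z) * real N powr Re z = 1" "real N powr (- Re z - 1) * real N powr Re z = 1 / real N"
          using N by (auto simp: powr_add[symmetric] powr_minus divide_inverse)
        have "(real N powr (- Re z) / (- Re z) + real N powr (- Re z - 1)) * real N powr Re z
          = 1 / (- Re z) + 1 / real N"
          unfolding distrib_right times_divide_eq_left p ..
        then have "A * (real N powr (- Re z) / (- Re z) + real N powr (- Re z - 1)) * real N powr Re z
          = A * (1 / (- Re z) + 1 / real N)" by (simp only: mult.assoc)
        then show ?thesis using z R N by (simp only:) (simp add: field_simps)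
      qed
      also have "\<dots> \<le> A * (2 / R\<^sup>2 + R * (2 / (R\<^sup>2 * real N)))"
        using A R N le by (intro mult_left_mono add_left_mono mult_right_mono) auto
      also have "\<dots> = A * (2 / R\<^sup>2 + 2 / (R * real N))" using R by (simp add: power2_eq_square)
      finally show "norm (E z / z) \<le> A * (2 / R\<^sup>2 + 2 / (R * real N))" .
    qed (use R A in auto)
    \<comment> \<open>Each half circle costs \<open>2 * pi * A / R\<close>; the left one costs a
      further \<open>2 * pi * A / N\<close>, from the extra last term in \<open>sum_powr_le\<close>.
      The segment contributes \<open>C / ln N\<close>.\<close>
    have "2 * pi * norm (E 0) = norm (I1 + I2)" unfolding I12 by (simp add: norm_mult)
    also have "\<dots> \<le> norm (I1 - J) + norm J + norm I2"
      by (smt (verit) norm_triangle_ineq norm_triangle_sub)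
    also have "\<dots> \<le> (2 * A / R\<^sup>2) * R * (pi / 2 - (- pi / 2)) + C / ln (real N)
      + (A * (2 / R\<^sup>2 + 2 / (R * real N))) * R * (3 * pi / 2 - pi / 2)"
      using nIJ nJ nI2 by linarith
    also have "\<dots> = A * (4 * pi / R + 2 * pi / real N) + C / ln (real N)"
      using R N by (simp add: field_simps power2_eq_square)
    finally show ?thesis unfolding E0 .
  qed
  then show ?thesis using that by blast
qed

text \<open>Lowering \<open>a 1\<close> by \<open>G 1\<close> lowers the series by the constant
  \<open>G 1\<close>, since \<open>1 powr (- s) = 1\<close>. So the limit function may be assumed to
  vanish at 1; then \<open>R\<close> is fixed large and \<open>N\<close> tends to infinity.\<close>

lemma newman_dirichlet:
  fixes a :: "nat \<Rightarrow> complex"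
  assumes bound: "\<And>n. norm (a n) \<le> A"
    and U: "open U" "{s. Re s \<ge> 1} \<subseteq> U" and G: "G holomorphic_on U"
    and sums: "\<And>s. Re s > 1 \<Longrightarrow> (\<lambda>n. a n * of_nat n powr (- s)) sums G s"
  shows "(\<lambda>N. \<Sum>n=1..N. a n / of_nat n) \<longlonglongrightarrow> G 1"
proof -
  define a' where "a' n = a n - (if n = 1 then G 1 else 0)" for n
  define A' where "A' = A + norm (G 1)"
  have A: "A \<ge> 0" using bound[of 0] norm_ge_zero order_trans by blast
  have b': "norm (a' n) \<le> A'" for n
    using bound[of n] norm_triangle_ineq4[of "a n" "G 1"] norm_ge_zero[of "G 1"] unfolding a'_def A'_def
    by (auto intro: order_trans)
  have sums': "(\<lambda>n. a' n * of_nat n powr (- s)) sums (G s - G 1)" if "Re s > 1" for s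
  proof -
    have "(\<lambda>n. if n = 1 then G 1 else 0) sums G 1" using sums_If_finite[of "\<lambda>n. n = 1" "\<lambda>_. G 1"] by simp
    from sums_diff[OF sums[OF that] this] show ?thesis
      by (rule sums_cong[THEN iffD1, rotated]) (auto simp: a'_def)
  qed
  have "(\<lambda>N. \<Sum>n=1..N. a' n / of_nat n) \<longlonglongrightarrow> 0"
  proof (rule LIMSEQ_I)
    fix e :: real assume e: "e > 0"
    have A': "A' \<ge> 0" using A by (simp add: A'_def)
    \<comment> \<open>This makes the limiting bound \<open>4 * pi * A' / R\<close> less than
      \<open>pi * e\<close>, half of what is allowed; \<open>A' + 1\<close> keeps \<open>R\<close>
      positive when \<open>A' = 0\<close>.\<close>
    define R where "R = 4 * (A' + 1) / e"
    have R: "R > 0" using e A' by (simp add: R_def)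
    have hG: "(\<lambda>s. G s - G 1) holomorphic_on U" using G by (intro holomorphic_intros)
    obtain C where C: "\<And>N. N \<ge> 2 \<Longrightarrow>
      2 * pi * norm (\<Sum>n=1..N. a' n / of_nat n) \<le> A' * (4 * pi / R + 2 * pi / real N) + C / ln (real N)"
      using newman_finite_bound[OF b' U hG diff_self sums' R] by blast
    have "A' * (4 * pi / R) < 2 * pi * e"
      using e A' unfolding R_def by (simp add: field_simps add_pos_nonneg)
    moreover have "((\<lambda>N. A' * (4 * pi / R + 2 * pi / real N) + C / ln (real N)) \<longlongrightarrow> A' * (4 * pi / R)) sequentially"
      by real_asymp
    ultimately have "eventually (\<lambda>N. A' * (4 * pi / R + 2 * pi / real N) + C / ln (real N) < 2 * pi * e) sequentially"
      by (simp add: order_tendstoD(2))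
    then obtain N0 where N0: "\<And>N. N \<ge> N0 \<Longrightarrow> A' * (4 * pi / R + 2 * pi / real N) + C / ln (real N) < 2 * pi * e"
      unfolding eventually_sequentially by blast
    show "\<exists>no. \<forall>n\<ge>no. norm ((\<Sum>n=1..n. a' n / of_nat n) - 0) < e"
    proof (intro exI allI impI)
      fix N assume "N \<ge> max N0 2"
      then have "2 * pi * norm (\<Sum>n=1..N. a' n / of_nat n) < 2 * pi * e"
        using order.strict_trans1[OF C N0, of N] by simp
      then show "norm ((\<Sum>n=1..N. a' n / of_nat n) - 0) < e"
        by (subst (asm) mult_less_cancel_left_pos) auto
    qed
  qed
  then have "(\<lambda>N. (\<Sum>n=1..N. a' n / of_nat n) + G 1) \<longlonglongrightarrow> 0 + G 1"
    by (intro tendsto_add) auto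
  moreover have "eventually (\<lambda>N. (\<Sum>n=1..N. a' n / of_nat n) + G 1 = (\<Sum>n=1..N. a n / of_nat n)) sequentially"
  proof (rule eventually_sequentiallyI[of 1])
    fix N :: nat assume "N \<ge> 1"
    have "(\<Sum>n=1..N. a' n / of_nat n) = (\<Sum>n=1..N. a n / of_nat n) - (\<Sum>n=1..N. if n = 1 then G 1 else 0)"
      unfolding sum_subtractf[symmetric] by (intro sum.cong) (auto simp: a'_def)
    then show "(\<Sum>n=1..N. a' n / of_nat n) + G 1 = (\<Sum>n=1..N. a n / of_nat n)"
      using \<open>N \<ge> 1\<close> by (simp add: sum.delta)
  qed
  ultimately show ?thesis by (simp add: tendsto_cong)
qed

section \<open>The zeta function on and to the right of the line Re s = 1\<close>

text \<open>This is \<open>z\<close> times the error in replacing \<open>n powr (- z - 1)\<close> by the integral of \<open>u powr (- z - 1)\<close> over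
  the interval from \<open>n\<close> to \<open>n + 1\<close>. Since \<open>0 powr w = 0\<close>, the term with index 0 is 1.\<close>

definition zeta_term :: "nat \<Rightarrow> complex \<Rightarrow> complex" where
  "zeta_term n z = z * of_nat n powr (- z - 1) - of_nat n powr (- z) + of_nat (Suc n) powr (- z)"

text \<open>The continuation of \<open>(s - 1) \<zeta>(s)\<close> to the half plane \<open>Re s > 0\<close>.\<close>

definition zeta_pole_free :: "complex \<Rightarrow> complex" where
  "zeta_pole_free s = (\<Sum>n. zeta_term n (s - 1))"

text \<open>\<open>zeta_term n z\<close> is the first-order Taylor remainder of
  \<open>u powr (- z)\<close> expanded at \<open>n\<close> and evaluated at \<open>n + 1\<close>.
  The second derivative supplies two extra powers of \<open>n\<close>, which carries convergence one
  unit to the left.\<close>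

lemma norm_zeta_term_le:
  assumes "n \<ge> 1" "Re z > - 1"
  shows "norm (zeta_term n z) \<le> norm z * norm (z + 1) * real n powr (- Re z - 2)"
proof -
  define f where "f i u = (if i = 0 then u powr (- z) else if i = 1 then (- z) * u powr (- z - 1)
    else z * (z + 1) * u powr (- z - 2))" for i :: nat and u :: complex
  define S where "S = closed_segment (of_nat n :: complex) (of_nat (Suc n))"
  have S: "\<exists>t. t \<ge> real n \<and> x = of_real t" if "x \<in> S" for x
  proof -
    from \<open>x \<in> S\<close> obtain u where u: "0 \<le> u" "u \<le> 1" "x = (1 - u) *\<^sub>R of_nat n + u *\<^sub>R of_nat (Suc n)"
      unfolding S_def in_segment by blast
    have "x = of_real (real n + u)" using u(3) by (simp add: scaleR_conv_of_real algebra_simps)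
    then show ?thesis using u(1) by (intro exI[of _ "real n + u"]) auto
  qed
  have "norm (f 0 (of_nat (Suc n)) - (\<Sum>i\<le>1. f i (of_nat n) * (of_nat (Suc n) - of_nat n) ^ i / fact i))
    \<le> (norm z * norm (z + 1) * real n powr (- Re z - 2)) * norm (of_nat (Suc n) - of_nat n :: complex) ^ Suc 1 / fact 1"
  proof (rule complex_Taylor)
    show "convex S" "of_nat n \<in> S" "of_nat (Suc n) \<in> S" by (auto simp: S_def)
    fix x assume "x \<in> S"
    then obtain t where t: "t \<ge> real n" "x = of_real t" using S by blast
    then have t1: "t \<ge> 1" using assms by auto
    have "t powr (- Re z - 2) \<le> real n powr (- Re z - 2)"
      using t assms by (intro powr_mono2') auto
    then show "norm (f (Suc 1) x) \<le> norm z * norm (z + 1) * real n powr (- Re z - 2)"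
      using t1 t(2) by (simp add: f_def norm_mult norm_powr_real_powr mult_left_mono)
    fix i :: nat assume "i \<le> 1"
    then consider "i = 0" | "i = 1" by linarith
    then show "(f i has_field_derivative f (Suc i) x) (at x within S)"
    proof cases
      case 1
      then show ?thesis using t t1 unfolding f_def
        by (auto intro!: derivative_eq_intros simp: complex_nonpos_Reals_iff)
    next
      case 2
      have "((\<lambda>u. (- z) * u powr (- z - 1)) has_field_derivative (z * (z + 1) * x powr (- z - 2))) (at x within S)"
        using t t1 by (auto intro!: derivative_eq_intros simp: complex_nonpos_Reals_iff algebra_simps)
      then show ?thesis using 2 unfolding f_def by simp
    qed
  qed
  then show ?thesis by (simp add: f_def zeta_term_def algebra_simps)
qed

lemma zeta_term_holomorphic: "(zeta_term n) holomorphic_on A"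
proof (cases "n = 0")
  case True
  then show ?thesis unfolding zeta_term_def by (auto intro!: holomorphic_intros)
next
  case False
  then have "(of_nat n :: complex) \<noteq> 0" "(of_nat (Suc n) :: complex) \<noteq> 0" by (auto simp del: of_nat_Suc)
  then show ?thesis unfolding zeta_term_def by (intro holomorphic_intros) auto
qed

text \<open>Needed twice: with weight 1 and \<open>\<alpha> = 0\<close> it continues zeta, and with
  weights \<open>psi n\<close> and \<open>\<alpha> = 1\<close> it compares the series of
  \<open>psi\<close> with that of \<open>mangoldt\<close>.\<close>

lemma weighted_zeta_term_series:
  fixes w :: "nat \<Rightarrow> complex"
  assumes w: "\<And>n. n \<ge> 1 \<Longrightarrow> norm (w n) \<le> C * real n powr \<alpha>" and \<alpha>: "\<alpha> \<ge> 0" and C: "C \<ge> 0"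
  obtains g where "g holomorphic_on {z. Re z > \<alpha> - 1}"
    "\<And>z. Re z > \<alpha> - 1 \<Longrightarrow> (\<lambda>n. w n * zeta_term n z) sums g z"
proof -
  let ?S = "{z. Re z > \<alpha> - 1}"
  have op: "open ?S" by (rule open_halfspace_Re_gt)
  have "\<exists>g g'. \<forall>x\<in>?S. ((\<lambda>n. w n * zeta_term n x) sums g x) \<and> ((\<lambda>n. w n * deriv (zeta_term n) x) sums g' x)
    \<and> (g has_field_derivative g' x) (at x)"
  proof (rule series_and_derivative_comparison_local[OF op])
    fix n x
    have "(zeta_term n has_field_derivative deriv (zeta_term n) x) (at x)"
      by (rule holomorphic_derivI[of _ UNIV]) (auto intro: zeta_term_holomorphic)
    then show "((\<lambda>z. w n * zeta_term n z) has_field_derivative w n * deriv (zeta_term n) x) (at x)"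
      by (rule DERIV_cmult)
  next
    fix x assume "x \<in> ?S"
    define \<sigma> where "\<sigma> = (Re x + (\<alpha> - 1)) / 2"
    have \<sigma>: "\<alpha> - 1 < \<sigma>" "\<sigma> < Re x" using \<open>x \<in> ?S\<close> by (auto simp: \<sigma>_def field_simps)
    define B where "B = norm x + (Re x - \<sigma>)"
    define h where "h n = C * (B * (B + 1)) * real n powr (\<alpha> - \<sigma> - 2)" for n
    have "summable (\<lambda>n. real n powr (\<alpha> - \<sigma> - 2))" using \<sigma> by (subst summable_real_powr_iff) auto
    then have "summable h" unfolding h_def by (intro summable_mult)
    moreover have "\<forall>\<^sub>F n in sequentially. \<forall>y\<in>ball x (Re x - \<sigma>) \<inter> ?S. norm (w n * zeta_term n y) \<le> h n"
    proof (rule eventually_sequentiallyI[of 1], intro ballI)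
      fix n y assume n: "n \<ge> (1::nat)" and y: "y \<in> ball x (Re x - \<sigma>) \<inter> ?S"
      have ny: "norm y \<le> B" using y norm_triangle_sub[of y x] by (auto simp: B_def dist_norm norm_minus_commute)
      then have ny1: "norm (y + 1) \<le> B + 1" using norm_triangle_ineq[of y 1] by simp
      have "\<bar>Re (x - y)\<bar> < Re x - \<sigma>" using y abs_Re_le_cmod[of "x - y"] by (auto simp: dist_norm)
      then have Rey: "Re y > \<sigma>" by auto
      have "norm (w n * zeta_term n y) \<le> (C * real n powr \<alpha>) * (norm y * norm (y + 1) * real n powr (- Re y - 2))"
        unfolding norm_mult using w[of n] norm_zeta_term_le[of n y] n Rey \<sigma> \<alpha> C by (intro mult_mono) auto
      also have "\<dots> \<le> (C * real n powr \<alpha>) * (B * (B + 1) * real n powr (- \<sigma> - 2))"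
      proof -
        have B: "B \<ge> 0" using ny norm_ge_zero order_trans by blast
        have "norm y * norm (y + 1) \<le> B * (B + 1)" using ny ny1 B by (intro mult_mono) auto
        moreover have "real n powr (- Re y - 2) \<le> real n powr (- \<sigma> - 2)"
          using Rey n by (intro powr_mono) auto
        ultimately show ?thesis using C B by (intro mult_left_mono mult_mono[of "norm y * norm (y + 1)"]) auto
      qed
      also have "\<dots> = C * (B * (B + 1)) * (real n powr \<alpha> * real n powr (- \<sigma> - 2))" by (simp only: mult_ac)
      also have "\<dots> = h n" unfolding h_def powr_add[symmetric] by (simp add: algebra_simps)
      finally show "norm (w n * zeta_term n y) \<le> h n" .
    qed
    ultimately show "\<exists>d h. 0 < d \<and> summable h \<and>
        (\<forall>\<^sub>F n in sequentially. \<forall>y\<in>ball x d \<inter> ?S. norm (w n * zeta_term n y) \<le> h n)"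
      using \<sigma> by (intro exI[of _ "Re x - \<sigma>"] exI[of _ h]) auto
  qed
  then obtain g g' where g: "\<And>x. x \<in> ?S \<Longrightarrow> ((\<lambda>n. w n * zeta_term n x) sums g x)"
    "\<And>x. x \<in> ?S \<Longrightarrow> (g has_field_derivative g' x) (at x)" by blast
  have "g holomorphic_on ?S" using g(2) by (subst holomorphic_on_open[OF op]) auto
  then show ?thesis using that g(1) by blast
qed

lemma zeta_pole_free_sums: "Re s > 0 \<Longrightarrow> (\<lambda>n. zeta_term n (s - 1)) sums zeta_pole_free s"
  and zeta_pole_free_holomorphic: "zeta_pole_free holomorphic_on {s. Re s > 0}"
proof -
  obtain g where g: "g holomorphic_on {z. Re z > 0 - 1}" "\<And>z. Re z > 0 - 1 \<Longrightarrow> (\<lambda>n. 1 * zeta_term n z) sums g z"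
    by (rule weighted_zeta_term_series[of "\<lambda>_. 1" 1 0]) auto
  have sums: "(\<lambda>n. zeta_term n (s - 1)) sums g (s - 1)" if "Re s > 0" for s
    using g(2)[of "s - 1"] that by simp
  then have eq: "zeta_pole_free s = g (s - 1)" if "Re s > 0" for s
    using that by (simp add: zeta_pole_free_def sums_iff)
  show "Re s > 0 \<Longrightarrow> (\<lambda>n. zeta_term n (s - 1)) sums zeta_pole_free s" using sums eq by simp
  have "(g \<circ> (\<lambda>s. s - 1)) holomorphic_on {s. Re s > 0}"
    by (intro holomorphic_on_compose_gen[OF _ g(1)] holomorphic_intros) auto
  then show "zeta_pole_free holomorphic_on {s. Re s > 0}"
    using holomorphic_cong[of "{s. Re s > 0}" "{s. Re s > 0}" zeta_pole_free "g \<circ> (\<lambda>s. s - 1)"] eq by simp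
qed

text \<open>At \<open>z = 0\<close> every term cancels except that of index 0, where
  \<open>0 powr 0 = 0\<close> leaves 1. The value is the residue of zeta at its pole.\<close>

lemma zeta_pole_free_1: "zeta_pole_free 1 = 1"
proof -
  have "(\<lambda>n. zeta_term n (1 - 1)) = (\<lambda>n. if n = 0 then 1 else 0)"
    by (auto simp: zeta_term_def simp del: of_nat_Suc)
  moreover have "(\<lambda>n. if n = 0 then 1 else 0 :: complex) sums 1"
    using sums_If_finite[of "\<lambda>n. n = 0" "\<lambda>_. 1::complex"] by simp
  ultimately show ?thesis unfolding zeta_pole_free_def by (auto simp: sums_iff)
qed

lemma of_nat_powr_neg_tendsto_0:
  assumes "Re z > 0"
  shows "(\<lambda>n. (of_nat n :: complex) powr (- z)) \<longlonglongrightarrow> 0"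
proof (rule tendsto_norm_zero_cancel)
  have "(\<lambda>n. real n powr (- Re z)) \<longlonglongrightarrow> 0"
    using assms by (intro tendsto_neg_powr filterlim_real_sequentially) auto
  then show "(\<lambda>n. norm ((of_nat n :: complex) powr (- z))) \<longlonglongrightarrow> 0"
    by (simp add: norm_powr_real_powr)
qed

lemma zeta_series_sums:
  assumes s: "Re s > 1"
  shows "(\<lambda>n. of_nat n powr (- s)) sums (zeta_pole_free s / (s - 1))"
proof -
  have s1: "s - 1 \<noteq> 0" using s by auto
  \<comment> \<open>The differences of powers telescope; the lower boundary term is
    \<open>0 powr _ = 0\<close>.\<close>
  have "(\<Sum>n<N. zeta_term n (s - 1)) = (s - 1) * (\<Sum>n<N. of_nat n powr (- s)) + of_nat N powr (- (s - 1))" for N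
    by (induction N) (auto simp: zeta_term_def algebra_simps)
  then have eq: "(\<Sum>n<N. of_nat n powr (- s)) = ((\<Sum>n<N. zeta_term n (s - 1)) - of_nat N powr (- (s - 1))) / (s - 1)" for N
    using s1 by (simp add: field_simps)
  have "(\<lambda>N. ((\<Sum>n<N. zeta_term n (s - 1)) - of_nat N powr (- (s - 1))) / (s - 1)) \<longlonglongrightarrow> (zeta_pole_free s - 0) / (s - 1)"
    using s zeta_pole_free_sums[of s] of_nat_powr_neg_tendsto_0[of "s - 1"] s1
    by (intro tendsto_intros) (auto simp: sums_def)
  then show ?thesis unfolding sums_def eq by simp
qed

section \<open>The Dirichlet series of the von Mangoldt function\<close>

lemma dirichlet_series_deriv:
  fixes a :: "nat \<Rightarrow> complex"
  assumes "\<And>x. x > 1 \<Longrightarrow> summable (\<lambda>n. norm (a n) * real n powr (- x))"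
  obtains g g' where
    "\<And>s. Re s > 1 \<Longrightarrow> (\<lambda>n. a n * of_nat n powr (- s)) sums g s"
    "\<And>s. Re s > 1 \<Longrightarrow> (\<lambda>n. - (of_real (ln (real n)) * (a n * of_nat n powr (- s)))) sums g' s"
    "\<And>s. Re s > 1 \<Longrightarrow> (g has_field_derivative g' s) (at s)"
proof -
  let ?S = "{z. Re z > 1}"
  have op: "open ?S" by (rule open_halfspace_Re_gt)
  have "\<exists>g g'. \<forall>x\<in>?S. ((\<lambda>n. a n * of_nat n powr (- x)) sums g x) \<and>
      ((\<lambda>n. - (of_real (ln (real n)) * (a n * of_nat n powr (- x)))) sums g' x)
    \<and> (g has_field_derivative g' x) (at x)"
  proof (rule series_and_derivative_comparison_local[OF op])
    fix n x
    show "((\<lambda>s. a n * of_nat n powr (- s)) has_field_derivative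
      - (of_real (ln (real n)) * (a n * of_nat n powr (- x)))) (at x)"
    proof (cases "n = 0")
      case False
      then have "Ln (of_nat n) = of_real (ln (real n))" using Ln_of_real[of "real n"] by simp
      moreover have "((\<lambda>s. of_nat n powr (- s)) has_field_derivative
          (Ln (of_nat n) * of_nat n powr (- x)) * (- 1)) (at x)"
        by (rule DERIV_chain2[OF has_field_derivative_powr_right])
          (use False in \<open>auto intro!: derivative_eq_intros\<close>)
      from DERIV_cmult[OF this, of "a n"] show ?thesis
        unfolding calculation by (simp add: algebra_simps)
    qed auto
  next
    fix x assume "x \<in> ?S"
    define \<sigma> where "\<sigma> = (Re x + 1) / 2"
    have \<sigma>: "1 < \<sigma>" "\<sigma> < Re x" using \<open>x \<in> ?S\<close> by (auto simp: \<sigma>_def field_simps)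
    define h where "h n = norm (a n) * real n powr (- \<sigma>)" for n
    have "summable h" unfolding h_def using assms \<sigma> by blast
    moreover have "\<forall>\<^sub>F n in sequentially. \<forall>y\<in>ball x (Re x - \<sigma>) \<inter> ?S. norm (a n * of_nat n powr (- y)) \<le> h n"
    proof (rule eventually_sequentiallyI[of 1], intro ballI)
      fix n y assume n: "n \<ge> (1::nat)" and y: "y \<in> ball x (Re x - \<sigma>) \<inter> ?S"
      have "\<bar>Re (x - y)\<bar> < Re x - \<sigma>" using y abs_Re_le_cmod[of "x - y"] by (auto simp: dist_norm)
      then have Rey: "Re y > \<sigma>" by auto
      then show "norm (a n * of_nat n powr (- y)) \<le> h n"
        using n by (auto simp: norm_mult norm_powr_real_powr h_def intro!: mult_left_mono powr_mono)
    qed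
    ultimately show "\<exists>d h. 0 < d \<and> summable h \<and>
        (\<forall>\<^sub>F n in sequentially. \<forall>y\<in>ball x d \<inter> ?S. norm (a n * of_nat n powr (- y)) \<le> h n)"
      using \<sigma> by (intro exI[of _ "Re x - \<sigma>"] exI[of _ h]) auto
  qed
  then obtain g g' where "\<forall>x\<in>?S. ((\<lambda>n. a n * of_nat n powr (- x)) sums g x) \<and>
      ((\<lambda>n. - (of_real (ln (real n)) * (a n * of_nat n powr (- x)))) sums g' x)
    \<and> (g has_field_derivative g' x) (at x)" by blast
  then show ?thesis using that[of g g'] by simp
qed

lemma summable_ln_powr:
  assumes "x > 1"
  shows "summable (\<lambda>n. ln (real n) * real n powr (- x))"
proof (rule summable_comparison_test_ev)
  define y where "y = (x - 1) / 2"
  have y: "y > 0" using assms by (simp add: y_def)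
  show "summable (\<lambda>n. (1 / y) * real n powr (- 1 - y))"
    using y by (intro summable_mult, subst summable_real_powr_iff) auto
  show "\<forall>\<^sub>F n in sequentially. norm (ln (real n) * real n powr (- x)) \<le> (1 / y) * real n powr (- 1 - y)"
  proof (rule eventually_sequentiallyI[of 1])
    fix n :: nat assume n: "n \<ge> 1"
    have "ln (real n) * real n powr (- x) \<le> (real n powr y / y) * real n powr (- x)"
      using n y ln_powr_bound[of "real n" y] by (intro mult_right_mono) auto
    also have "\<dots> = (1 / y) * real n powr (y - x)" using n by (simp add: powr_add[symmetric] powr_diff powr_minus divide_inverse)
    also have "y - x = - 1 - y" by (simp add: y_def field_simps)
    finally show "norm (ln (real n) * real n powr (- x)) \<le> (1 / y) * real n powr (- 1 - y)" using n by simp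
  qed
qed

lemma summable_mangoldt_powr:
  assumes "x > 1"
  shows "summable (\<lambda>n. mangoldt n * real n powr (- x))"
proof (rule summable_comparison_test_ev[OF _ summable_ln_powr[OF assms]])
  show "\<forall>\<^sub>F n in sequentially. norm (mangoldt n * real n powr (- x)) \<le> ln (real n) * real n powr (- x)"
    using mangoldt_le by (intro eventually_sequentiallyI[of 1]) (auto simp: abs_mult intro!: mult_right_mono)
qed

text \<open>To the right of the line this is the negative logarithmic derivative of zeta; see
  \<open>mangoldt_series_eq\<close>.\<close>

definition mangoldt_series :: "complex \<Rightarrow> complex" where
  "mangoldt_series s = (\<Sum>n. mangoldt n * of_nat n powr (- s))"

lemma mangoldt_series_sums:
  assumes "Re s > 1"
  shows "(\<lambda>n. mangoldt n * of_nat n powr (- s)) sums mangoldt_series s"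
proof -
  have "summable (\<lambda>n. norm (mangoldt n * of_nat n powr (- s) :: complex))"
    using summable_mangoldt_powr[OF assms] by (simp add: norm_mult norm_powr_real_powr)
  then show ?thesis unfolding mangoldt_series_def by (rule summable_sums[OF summable_norm_cancel])
qed

lemma has_sum_positive_nat_iff:
  assumes "f 0 = 0"
  shows "(f has_sum S) {1..} \<longleftrightarrow> (f has_sum S) (UNIV :: nat set)"
  using assms by (intro has_sum_cong_neutral) (auto simp: not_less_eq_eq)

text \<open>The convolution identity that \<open>ln n\<close> is the sum of
  \<open>mangoldt d\<close> over \<open>d dvd n\<close>, turned into a product of series: absolute
  convergence permits regrouping the pairs \<open>(m, d)\<close> by the product
  \<open>m * d\<close>.\<close>

lemma ln_series_has_sum:
  assumes s: "Re s > 1"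
  shows "((\<lambda>n. of_real (ln (real n)) * of_nat n powr (- s)) has_sum
    (zeta_pole_free s / (s - 1) * mangoldt_series s)) {1..}"
proof -
  let ?z = "\<lambda>n. (of_nat n :: complex) powr (- s)" and ?l = "\<lambda>n. mangoldt n * (of_nat n :: complex) powr (- s)"
  have nz: "summable (\<lambda>n. norm (?z n))"
    using s by (simp add: norm_powr_real_powr) (subst summable_real_powr_iff, simp)
  have nl: "summable (\<lambda>n. norm (?l n))"
    using summable_mangoldt_powr[OF s] by (simp add: norm_mult norm_powr_real_powr)
  have hz: "(?z has_sum (zeta_pole_free s / (s - 1))) {1..}"
    using norm_summable_imp_has_sum[OF nz zeta_series_sums[OF s]]
      has_sum_positive_nat_iff[of ?z] by simp
  have hl: "(?l has_sum mangoldt_series s) {1..}"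
    using norm_summable_imp_has_sum[OF nl mangoldt_series_sums[OF s]]
      has_sum_positive_nat_iff[of ?l] by simp
  have az: "(\<lambda>m. norm (?z m)) summable_on {1..}"
    using norm_summable_imp_summable_on[of "\<lambda>n. norm (?z n)"] nz
    by (intro summable_on_subset_banach[of _ UNIV "{1..}"]) simp_all
  have al: "(\<lambda>d. norm (?l d)) summable_on {1..}"
    using norm_summable_imp_summable_on[of "\<lambda>n. norm (?l n)"] nl
    by (intro summable_on_subset_banach[of _ UNIV "{1..}"]) simp_all
  have "(\<lambda>x. norm (case x of (m, d) \<Rightarrow> ?z m * ?l d)) summable_on {1..} \<times> {1..}"
    unfolding Infinite_Sum.abs_summable_on_Sigma_iff
    using summable_on_cmult_right[OF al] summable_on_cmult_left[OF az]
    by (simp add: norm_mult infsum_cmult_right' infsum_nonneg mangoldt_nonneg abs_mult)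
  then have "(\<lambda>(m, d). ?z m * ?l d) summable_on {1..} \<times> {1..}"
    by (rule abs_summable_summable)
  then have "((\<lambda>(m, d). ?z m * ?l d) has_sum (zeta_pole_free s / (s - 1) * mangoldt_series s)) ({1..} \<times> {1..})"
  proof (rule has_sum_SigmaI[where g = "\<lambda>m. ?z m * mangoldt_series s", rotated 2])
    show "((\<lambda>m. ?z m * mangoldt_series s) has_sum (zeta_pole_free s / (s - 1) * mangoldt_series s)) {1..}"
      by (rule has_sum_cmult_left[OF hz])
    show "((\<lambda>d. case (m, d) of (m, d) \<Rightarrow> ?z m * ?l d) has_sum (?z m * mangoldt_series s)) {1..}" for m
      unfolding prod.case by (rule has_sum_cmult_right[OF hl])
  qed
  moreover have "((\<lambda>(m, d). ?z m * ?l d) has_sum S) ({1..} \<times> {1..}) \<longleftrightarrow>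
    ((\<lambda>(n, d). mangoldt d * ?z n) has_sum S) (Sigma {1..} (\<lambda>n. {d. d dvd n}))" for S
  proof (rule has_sum_reindex_bij_witness[where j = "\<lambda>(m, d). (m * d, d)" and i = "\<lambda>(n, d). (n div d, d)"])
    fix x :: "nat \<times> nat" assume x: "x \<in> {1..} \<times> {1..}"
    then show "(case case x of (m, d) \<Rightarrow> (m * d, d) of (n, d) \<Rightarrow> (n div d, d)) = x"
      "(case x of (m, d) \<Rightarrow> (m * d, d)) \<in> Sigma {1..} (\<lambda>n. {d. d dvd n})" by auto
    show "(case case x of (m, d) \<Rightarrow> (m * d, d) of (n, d) \<Rightarrow> mangoldt d * ?z n) =
      (case x of (m, d) \<Rightarrow> ?z m * ?l d)"
      by (cases x) (simp add: powr_times_real)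
  next
    fix y :: "nat \<times> nat" assume y: "y \<in> Sigma {1..} (\<lambda>n. {d. d dvd n})"
    then show "(case case y of (n, d) \<Rightarrow> (n div d, d) of (m, d) \<Rightarrow> (m * d, d)) = y" by auto
    obtain n d where nd: "y = (n, d)" "n > 0" "d dvd n" using y by (cases y) auto
    then show "(case y of (n, d) \<Rightarrow> (n div d, d)) \<in> {1..} \<times> {1..}"
      by (auto simp: Suc_le_eq dvd_imp_le dvd_pos_nat div_greater_zero_iff)
  qed simp
  ultimately have "((\<lambda>(n, d). mangoldt d * ?z n) has_sum (zeta_pole_free s / (s - 1) * mangoldt_series s))
    (Sigma {1..} (\<lambda>n. {d. d dvd n}))" by blast
  then show ?thesis
  proof (rule has_sum_SigmaD)
    fix n :: nat assume n: "n \<in> {1..}"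
    then have "(\<Sum>d | d dvd n. mangoldt d * ?z n) = of_real (ln (real n)) * ?z n"
      unfolding sum_distrib_right[symmetric] by (subst mangoldt_sum) auto
    then show "((\<lambda>d. case (n, d) of (n, d) \<Rightarrow> mangoldt d * ?z n) has_sum of_real (ln (real n)) * ?z n) {d. d dvd n}"
      using n by (intro has_sum_finiteI) auto
  qed
qed

text \<open>Both sides come from differentiating \<open>(s - 1) * zeta s\<close>. The form avoids
  division by \<open>zeta_pole_free\<close>, because the identity itself serves to prove that this
  function has no zeros.\<close>

lemma zeta_mangoldt_identity:
  assumes s: "Re s > 1"
  shows "zeta_pole_free s * (1 / (s - 1) - mangoldt_series s) = deriv zeta_pole_free s"
proof -
  obtain g g' where g: "\<And>s. Re s > 1 \<Longrightarrow> (\<lambda>n. 1 * of_nat n powr (- s)) sums g s"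
    "\<And>s. Re s > 1 \<Longrightarrow> (\<lambda>n. - (of_real (ln (real n)) * (1 * of_nat n powr (- s)))) sums g' s"
    "\<And>s. Re s > 1 \<Longrightarrow> (g has_field_derivative g' s) (at s)"
    using dirichlet_series_deriv[of "\<lambda>_. 1"] by (auto simp: summable_real_powr_iff)
  have s1: "s \<noteq> 1" using s by auto
  have "(\<lambda>n. - (of_real (ln (real n)) * of_nat n powr (- s))) sums g' s" using g(2)[OF s] by simp
  moreover have "((\<lambda>n. of_real (ln (real n)) * of_nat n powr (- s)) has_sum
    (zeta_pole_free s / (s - 1) * mangoldt_series s)) UNIV"
    using ln_series_has_sum[OF s]
      has_sum_positive_nat_iff[of "\<lambda>n. of_real (ln (real n)) * of_nat n powr (- s)"] by simp
  then have "(\<lambda>n. - (of_real (ln (real n)) * of_nat n powr (- s))) sums (- (zeta_pole_free s / (s - 1) * mangoldt_series s))"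
    by (intro sums_minus has_sum_imp_sums)
  ultimately have g': "g' s = - (zeta_pole_free s / (s - 1) * mangoldt_series s)"
    by (rule sums_unique2)
  have hZ: "(zeta_pole_free has_field_derivative deriv zeta_pole_free s) (at s)"
    using s by (intro holomorphic_derivI[OF zeta_pole_free_holomorphic open_halfspace_Re_gt]) auto
  have "zeta_pole_free w = (w - 1) * g w" if "Re w > 1" for w
  proof -
    have "g w = zeta_pole_free w / (w - 1)"
      using g(1)[OF that] zeta_series_sums[OF that] sums_unique2 by force
    then show ?thesis using that by auto
  qed
  moreover have "((\<lambda>w. (w - 1) * g w) has_field_derivative (g s + (s - 1) * g' s)) (at s)"
    using g(3)[OF s] by (auto intro!: derivative_eq_intros)
  ultimately have "(zeta_pole_free has_field_derivative (g s + (s - 1) * g' s)) (at s)"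
    using s eventually_nhds_in_open[OF open_halfspace_Re_gt[of 1], of s]
    by (subst DERIV_cong_ev[OF refl _ refl]) (auto elim!: eventually_mono)
  then have "deriv zeta_pole_free s = g s + (s - 1) * g' s" using hZ DERIV_unique by blast
  also have "g s = zeta_pole_free s / (s - 1)"
    using g(1)[OF s] zeta_series_sums[OF s] sums_unique2 by force
  also have "(s - 1) * g' s = - (zeta_pole_free s * mangoldt_series s)"
    unfolding g' using s1 by simp
  finally show ?thesis by (simp add: algebra_simps)
qed

section \<open>Nonvanishing on the closed half plane Re s >= 1\<close>

lemma isCont_holomorphic:
  fixes f :: "complex \<Rightarrow> complex"
  assumes "f holomorphic_on S" "open S" "s \<in> S"
  shows "isCont f s"
  using holomorphic_on_imp_continuous_on[OF assms(1)] continuous_on_eq_continuous_at[OF assms(2)] assms(3)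
  by blast

text \<open>The number \<open>n\<close> is the order of vanishing at \<open>s0\<close>: factoring
  \<open>f\<close> as \<open>(s - s0) ^ n * g\<close> with \<open>g\<close> nonzero gives the
  logarithmic derivative a principal part \<open>n / (s - s0)\<close>. The point \<open>z1\<close>
  rules out \<open>f\<close> being identically 0.\<close>

lemma logarithmic_derivative_limit:
  fixes f :: "complex \<Rightarrow> complex"
  assumes f: "f holomorphic_on S" "open S" "connected S" and s0: "s0 \<in> S" and z1: "z1 \<in> S" "f z1 \<noteq> 0"
  obtains n :: nat where "((\<lambda>s. (s - s0) * (deriv f s / f s)) \<longlongrightarrow> of_nat n) (at s0)"
    "f s0 = 0 \<longleftrightarrow> n > 0" "\<forall>\<^sub>F s in at s0. f s \<noteq> 0"
proof (cases "f s0 = 0")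
  case False
  have "isCont f s0" by (rule isCont_holomorphic[OF f(1,2) s0])
  then have tf: "(f \<longlongrightarrow> f s0) (at s0)" by (simp add: isCont_def)
  then have ev: "\<forall>\<^sub>F s in at s0. f s \<noteq> 0" using False tendsto_imp_eventually_ne by blast
  have "isCont (deriv f) s0"
    by (rule isCont_holomorphic[OF holomorphic_deriv[OF f(1,2)] f(2) s0])
  then have "(deriv f \<longlongrightarrow> deriv f s0) (at s0)" by (simp add: isCont_def)
  then have "((\<lambda>s. (s - s0) * (deriv f s / f s)) \<longlongrightarrow> (s0 - s0) * (deriv f s0 / f s0)) (at s0)"
    using tf False by (intro tendsto_intros) auto
  then show ?thesis using that[of 0] ev False by simp
next
  case True
  have "\<not> f constant_on S" using s0 z1 True unfolding constant_on_def by metis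
  then obtain g r n where gr: "0 < n" "0 < r" "ball s0 r \<subseteq> S" "g holomorphic_on ball s0 r"
    "\<And>w. w \<in> ball s0 r \<Longrightarrow> f w = (w - s0) ^ n * g w" "\<And>w. w \<in> ball s0 r \<Longrightarrow> g w \<noteq> 0"
    by (rule holomorphic_factor_zero_nonconstant[OF f s0 True]) (rule that)
  have evb: "\<forall>\<^sub>F s in at s0. s \<in> ball s0 r \<and> s \<noteq> s0"
    using gr(2) eventually_at_ball'[of r s0 UNIV] by (auto elim!: eventually_mono)
  have eq: "(s - s0) * (deriv f s / f s) = of_nat n + (s - s0) * (deriv g s / g s)"
    if s: "s \<in> ball s0 r" "s \<noteq> s0" for s
  proof -
    have "(g has_field_derivative deriv g s) (at s)"
      using holomorphic_derivI[OF gr(4) open_ball s(1)] .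
    then have "((\<lambda>w. (w - s0) ^ n * g w) has_field_derivative
        (of_nat n * (s - s0) ^ (n - 1) * g s + (s - s0) ^ n * deriv g s)) (at s)"
      by (auto intro!: derivative_eq_intros)
    moreover have ev: "\<forall>\<^sub>F w in nhds s. (w - s0) ^ n * g w = f w"
      using eventually_nhds_in_open[OF open_ball s(1)] gr(5) by (auto elim!: eventually_mono)
    ultimately have "(f has_field_derivative
        (of_nat n * (s - s0) ^ (n - 1) * g s + (s - s0) ^ n * deriv g s)) (at s)"
      by (intro iffD1[OF DERIV_cong_ev[OF refl ev refl]])
    then have d: "deriv f s = of_nat n * (s - s0) ^ (n - 1) * g s + (s - s0) ^ n * deriv g s"
      by (rule DERIV_imp_deriv)
    have p: "(s - s0) ^ n = (s - s0) * (s - s0) ^ (n - 1)" using gr(1) by (cases n) auto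
    have nz: "s - s0 \<noteq> 0" "g s \<noteq> 0" "(s - s0) ^ (n - 1) \<noteq> 0" using s gr(6) by auto
    show ?thesis unfolding d gr(5)[OF s(1)] p using nz by (simp add: field_simps)
  qed
  have s0b: "s0 \<in> ball s0 r" using gr(2) by simp
  have "isCont g s0" "isCont (deriv g) s0"
    using isCont_holomorphic[OF gr(4) open_ball s0b]
      isCont_holomorphic[OF holomorphic_deriv[OF gr(4) open_ball] open_ball s0b] .
  then have "((\<lambda>s. of_nat n + (s - s0) * (deriv g s / g s)) \<longlongrightarrow> of_nat n + (s0 - s0) * (deriv g s0 / g s0)) (at s0)"
    using gr(6)[OF s0b] by (intro tendsto_intros) (auto simp: isCont_def)
  then have lim: "((\<lambda>s. of_nat n + (s - s0) * (deriv g s / g s)) \<longlongrightarrow> of_nat n) (at s0)" by simp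
  have "((\<lambda>s. (s - s0) * (deriv f s / f s)) \<longlongrightarrow> of_nat n) (at s0)"
  proof (rule Lim_transform_eventually[OF lim])
    show "\<forall>\<^sub>F s in at s0. of_nat n + (s - s0) * (deriv g s / g s) = (s - s0) * (deriv f s / f s)"
      using evb by (rule eventually_mono) (elim conjE, rule eq[symmetric])
  qed
  moreover have "\<forall>\<^sub>F s in at s0. f s \<noteq> 0"
    using evb by eventually_elim (use gr(5,6) in auto)
  ultimately show ?thesis using that gr(1) True by blast
qed

lemma mangoldt_series_continuous:
  assumes "Re s > 1"
  shows "isCont mangoldt_series s"
proof -
  have sm: "summable (\<lambda>n. norm (mangoldt n :: complex) * real n powr (- x))" if "x > 1" for x
    using summable_mangoldt_powr[OF that] by simp
  obtain g g' where g: "\<And>s. Re s > 1 \<Longrightarrow> (\<lambda>n. mangoldt n * of_nat n powr (- s)) sums g s"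
    "\<And>s. Re s > 1 \<Longrightarrow> (g has_field_derivative g' s) (at s)"
    using dirichlet_series_deriv[OF sm] by metis
  have "\<forall>\<^sub>F w in nhds s. g w = mangoldt_series w"
    using eventually_nhds_in_open[OF open_halfspace_Re_gt[of 1], of s] assms
    by (auto elim!: eventually_mono intro: sums_unique2[OF g(1) mangoldt_series_sums])
  moreover have "isCont g s" using g(2)[OF assms] DERIV_isCont by blast
  ultimately show ?thesis using isCont_cong by blast
qed

lemma zeta_half_plane: "open {s. Re s > 0}" "connected {s. Re s > 0}"
  by (auto simp: open_halfspace_Re_gt intro!: convex_connected convex_halfspace_Re_gt)

lemma zeta_log_derivative_limit:
  assumes "Re s0 > 0"
  obtains n :: nat where "((\<lambda>s. (s - s0) * (deriv zeta_pole_free s / zeta_pole_free s)) \<longlongrightarrow> of_nat n) (at s0)"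
    "zeta_pole_free s0 = 0 \<longleftrightarrow> n > 0" "\<forall>\<^sub>F s in at s0. zeta_pole_free s \<noteq> 0"
  using logarithmic_derivative_limit[OF zeta_pole_free_holomorphic zeta_half_plane, of s0 1] assms
  by (auto simp: zeta_pole_free_1)

text \<open>No Euler product is involved. At a zero the logarithmic derivative would have a simple
  pole, yet \<open>zeta_mangoldt_identity\<close> equates it nearby with a function continuous at
  that point.\<close>

lemma zeta_nonzero_Re_gt_1:
  assumes s0: "Re s0 > 1"
  shows "zeta_pole_free s0 \<noteq> 0"
proof
  assume z: "zeta_pole_free s0 = 0"
  obtain n :: nat where n: "((\<lambda>s. (s - s0) * (deriv zeta_pole_free s / zeta_pole_free s)) \<longlongrightarrow> of_nat n) (at s0)"
    "n > 0" "\<forall>\<^sub>F s in at s0. zeta_pole_free s \<noteq> 0"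
    using zeta_log_derivative_limit[of s0] s0 z by auto
  have "s0 \<noteq> 1" using s0 by auto
  have "((\<lambda>s. (s - s0) * (1 / (s - 1) - mangoldt_series s)) \<longlongrightarrow> (s0 - s0) * (1 / (s0 - 1) - mangoldt_series s0)) (at s0)"
    using mangoldt_series_continuous[OF s0] \<open>s0 \<noteq> 1\<close> by (intro tendsto_intros) (auto simp: isCont_def)
  moreover have "\<forall>\<^sub>F s in at s0. Re s > 1"
    using eventually_at_in_open'[OF open_halfspace_Re_gt[of 1], of s0] s0 by simp
  with n(3) have "\<forall>\<^sub>F s in at s0. (s - s0) * (1 / (s - 1) - mangoldt_series s)
      = (s - s0) * (deriv zeta_pole_free s / zeta_pole_free s)"
    by eventually_elim (simp add: zeta_mangoldt_identity[symmetric])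
  ultimately have "((\<lambda>s. (s - s0) * (deriv zeta_pole_free s / zeta_pole_free s)) \<longlongrightarrow> 0) (at s0)"
    using Lim_transform_eventually by fastforce
  then have "of_nat n = (0 :: complex)" using n(1) tendsto_unique[OF at_neq_bot] by blast
  then show False using n(2) by simp
qed

lemma mangoldt_series_eq:
  assumes "Re s > 1"
  shows "mangoldt_series s = 1 / (s - 1) - deriv zeta_pole_free s / zeta_pole_free s"
  using zeta_mangoldt_identity[OF assms] zeta_nonzero_Re_gt_1[OF assms] by (simp add: field_simps)

lemma Re_of_nat_powr:
  assumes "n > 0"
  shows "Re (of_nat n powr (- (of_real \<sigma> + \<i> * of_real t))) = real n powr (- \<sigma>) * cos (t * ln (real n))"
proof -
  have "Ln (of_nat n) = of_real (ln (real n))" using assms Ln_of_real[of "real n"] by simp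
  then show ?thesis using assms by (simp add: powr_def Re_exp algebra_simps)
qed

text \<open>Termwise positivity from \<open>3 + 4 cos t + cos (2 t) = 2 (1 + cos t)^2\<close> and
  the nonnegativity of \<open>mangoldt\<close>.\<close>

lemma three_four_one:
  assumes "\<sigma> > 1"
  shows "3 * Re (mangoldt_series (of_real \<sigma>)) + 4 * Re (mangoldt_series (of_real \<sigma> + \<i> * of_real t))
    + Re (mangoldt_series (of_real \<sigma> + \<i> * of_real (2 * t))) \<ge> 0"
proof -
  define f where "f t n = mangoldt n * Re (of_nat n powr (- (of_real \<sigma> + \<i> * of_real t)))" for t and n :: nat
  have s: "f t sums Re (mangoldt_series (of_real \<sigma> + \<i> * of_real t))" for t
  proof -
    have "(\<lambda>n. Re (mangoldt n * of_nat n powr (- (of_real \<sigma> + \<i> * of_real t))))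
      sums Re (mangoldt_series (of_real \<sigma> + \<i> * of_real t))"
      using assms by (intro sums_Re mangoldt_series_sums) simp
    then show ?thesis unfolding f_def by simp
  qed
  have A: "(\<lambda>n. 3 * f 0 n + 4 * f t n + f (2 * t) n) sums
    (3 * Re (mangoldt_series (of_real \<sigma> + \<i> * of_real 0)) + 4 * Re (mangoldt_series (of_real \<sigma> + \<i> * of_real t))
    + Re (mangoldt_series (of_real \<sigma> + \<i> * of_real (2 * t))))"
    by (intro sums_add sums_mult s)
  have B: "0 \<le> 3 * f 0 n + 4 * f t n + f (2 * t) n" for n
  proof (cases "n = 0")
    case False
    define c where "c = cos (t * ln (real n))"
    have c2: "cos (2 * t * ln (real n)) = 2 * c\<^sup>2 - 1"
      unfolding c_def using cos_double_cos[of "t * ln (real n)"] by (simp add: mult.assoc)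
    have eq: "f u n = mangoldt n * real n powr (- \<sigma>) * cos (u * ln (real n))" for u
      using False unfolding f_def by (subst Re_of_nat_powr) auto
    have "3 * f 0 n + 4 * f t n + f (2 * t) n = mangoldt n * real n powr (- \<sigma>) * (2 * (1 + c)\<^sup>2)"
      unfolding eq c2 c_def[symmetric] by (simp add: algebra_simps power2_eq_square)
    then show ?thesis by (simp add: mangoldt_nonneg)
  qed (simp add: f_def)
  have "0 \<le> 3 * Re (mangoldt_series (of_real \<sigma> + \<i> * of_real 0)) + 4 * Re (mangoldt_series (of_real \<sigma> + \<i> * of_real t))
    + Re (mangoldt_series (of_real \<sigma> + \<i> * of_real (2 * t)))"
    by (rule sums_le[OF B sums_zero A])
  then show ?thesis by simp
qed

text \<open>Scaling by \<open>\<epsilon>\<close> extracts the coefficient of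
  \<open>1 / (s - s0)\<close>: it is 1 for the pole of zeta at 1, minus the multiplicity
  \<open>n\<close> of a zero of \<open>zeta_pole_free\<close>.\<close>

lemma mangoldt_series_boundary_limit:
  assumes "Re s0 = 1"
  obtains n :: nat where
    "((\<lambda>\<epsilon>. \<epsilon> * Re (mangoldt_series (s0 + of_real \<epsilon>))) \<longlongrightarrow> (if s0 = 1 then 1 else 0) - real n) (at_right 0)"
    "zeta_pole_free s0 = 0 \<longleftrightarrow> n > 0"
proof -
  obtain n :: nat where n: "((\<lambda>s. (s - s0) * (deriv zeta_pole_free s / zeta_pole_free s)) \<longlongrightarrow> of_nat n) (at s0)"
    "zeta_pole_free s0 = 0 \<longleftrightarrow> n > 0" "\<forall>\<^sub>F s in at s0. zeta_pole_free s \<noteq> 0"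
    using zeta_log_derivative_limit[of s0] assms by auto
  have pole: "((\<lambda>s. (s - s0) / (s - 1)) \<longlongrightarrow> (if s0 = 1 then 1 else 0)) (at s0)"
  proof (cases "s0 = 1")
    case True
    have "\<forall>\<^sub>F s in at s0. 1 = (s - s0) / (s - 1)"
      unfolding True by (auto simp: eventually_at intro!: exI[of _ 1])
    then show ?thesis using True by (auto intro: Lim_transform_eventually[OF tendsto_const])
  next
    case False
    have "((\<lambda>s. (s - s0) / (s - 1)) \<longlongrightarrow> (s0 - s0) / (s0 - 1)) (at s0)"
      using False by (intro tendsto_intros) auto
    then show ?thesis using False by simp
  qed
  define D where "D s = (s - s0) / (s - 1) - (s - s0) * (deriv zeta_pole_free s / zeta_pole_free s)" for s
  have lim: "(D \<longlongrightarrow> (if s0 = 1 then 1 else 0) - of_nat n) (at s0)"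
    unfolding D_def by (rule tendsto_diff[OF pole n(1)])
  have fl: "filterlim (\<lambda>\<epsilon>. s0 + of_real \<epsilon>) (at s0) (at_right (0::real))"
    unfolding filterlim_at
  proof
    show "\<forall>\<^sub>F \<epsilon> in at_right (0::real). s0 + of_real \<epsilon> \<in> UNIV \<and> s0 + of_real \<epsilon> \<noteq> s0"
      by (auto simp: eventually_at_right_less[of 0, THEN eventually_mono] eventually_at_filter)
    have "((\<lambda>\<epsilon>. s0 + of_real \<epsilon>) \<longlongrightarrow> s0 + of_real 0) (at_right (0::real))"
      by (intro tendsto_intros)
    then show "((\<lambda>\<epsilon>. s0 + of_real \<epsilon>) \<longlongrightarrow> s0) (at_right (0::real))" by simp
  qed
  from tendsto_Re[OF filterlim_compose[OF lim fl]]
  have "((\<lambda>\<epsilon>. Re (D (s0 + of_real \<epsilon>))) \<longlongrightarrow> Re ((if s0 = 1 then 1 else 0) - of_nat n)) (at_right 0)" .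
  moreover have "\<forall>\<^sub>F \<epsilon> in at_right (0::real). Re (D (s0 + of_real \<epsilon>)) = \<epsilon> * Re (mangoldt_series (s0 + of_real \<epsilon>))"
    using eventually_at_right_less[of 0]
  proof eventually_elim
    fix \<epsilon> :: real assume "0 < \<epsilon>"
    then have "D (s0 + of_real \<epsilon>) = of_real \<epsilon> * mangoldt_series (s0 + of_real \<epsilon>)"
      using assms by (simp add: D_def mangoldt_series_eq right_diff_distrib)
    then show "Re (D (s0 + of_real \<epsilon>)) = \<epsilon> * Re (mangoldt_series (s0 + of_real \<epsilon>))" by simp
  qed
  ultimately have "((\<lambda>\<epsilon>. \<epsilon> * Re (mangoldt_series (s0 + of_real \<epsilon>))) \<longlongrightarrow>
      Re ((if s0 = 1 then 1 else 0) - of_nat n)) (at_right 0)"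
    by (rule Lim_transform_eventually)
  moreover have "Re ((if s0 = 1 then 1 else 0) - of_nat n) = (if s0 = 1 then 1 else 0) - real n" by simp
  ultimately show ?thesis using that n(2) by metis
qed

text \<open>In the limit \<open>three_four_one\<close> reads
  \<open>3 * (1 - n0) - 4 * n1 - n2 >= 0\<close>, with \<open>n0\<close>, \<open>n1\<close>,
  \<open>n2\<close> the multiplicities at 1, \<open>1 + i t\<close> and \<open>1 + 2 i t\<close>. As
  4 > 3, this forces \<open>n1 = 0\<close>.\<close>

lemma zeta_pole_free_nonzero:
  assumes "Re s \<ge> 1"
  shows "zeta_pole_free s \<noteq> 0"
proof (cases "Re s > 1")
  case False
  define t where "t = Im s"
  have s: "s = 1 + \<i> * of_real t" using False assms by (simp add: complex_eq_iff t_def)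
  show ?thesis
  proof (cases "t = 0")
    case True
    then show ?thesis using s zeta_pole_free_1 by simp
  next
    case t: False
    have ne: "1 + \<i> * of_real t \<noteq> 1" "1 + \<i> * of_real (2 * t) \<noteq> 1" using t by auto
    obtain n0 :: nat where n0: "((\<lambda>\<epsilon>. \<epsilon> * Re (mangoldt_series (1 + of_real \<epsilon>))) \<longlongrightarrow> 1 - real n0) (at_right 0)"
      "zeta_pole_free 1 = 0 \<longleftrightarrow> n0 > 0" using mangoldt_series_boundary_limit[of 1] by auto
    obtain n1 :: nat where n1: "((\<lambda>\<epsilon>. \<epsilon> * Re (mangoldt_series (1 + \<i> * of_real t + of_real \<epsilon>))) \<longlongrightarrow> 0 - real n1) (at_right 0)"
      "zeta_pole_free s = 0 \<longleftrightarrow> n1 > 0"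
      using mangoldt_series_boundary_limit[of "1 + \<i> * of_real t"] ne unfolding s by auto
    obtain n2 :: nat where n2: "((\<lambda>\<epsilon>. \<epsilon> * Re (mangoldt_series (1 + \<i> * of_real (2 * t) + of_real \<epsilon>))) \<longlongrightarrow> 0 - real n2) (at_right 0)"
      using mangoldt_series_boundary_limit[of "1 + \<i> * of_real (2 * t)"] ne by auto
    define V where "V \<epsilon> = 3 * (\<epsilon> * Re (mangoldt_series (1 + of_real \<epsilon>)))
        + 4 * (\<epsilon> * Re (mangoldt_series (1 + \<i> * of_real t + of_real \<epsilon>)))
        + \<epsilon> * Re (mangoldt_series (1 + \<i> * of_real (2 * t) + of_real \<epsilon>))" for \<epsilon> :: real
    have "(V \<longlongrightarrow> 3 * (1 - real n0) + 4 * (0 - real n1) + (0 - real n2)) (at_right 0)"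
      unfolding V_def by (intro tendsto_add tendsto_mult tendsto_const n0 n1 n2)
    moreover have "\<forall>\<^sub>F \<epsilon> in at_right (0::real). 0 \<le> V \<epsilon>"
      using eventually_at_right_less[of 0]
    proof eventually_elim
      fix \<epsilon> :: real assume e: "0 < \<epsilon>"
      have "0 \<le> \<epsilon> * (3 * Re (mangoldt_series (of_real (1 + \<epsilon>))) + 4 * Re (mangoldt_series (of_real (1 + \<epsilon>) + \<i> * of_real t))
        + Re (mangoldt_series (of_real (1 + \<epsilon>) + \<i> * of_real (2 * t))))"
        using e by (intro mult_nonneg_nonneg three_four_one) auto
      then show "0 \<le> V \<epsilon>" by (simp add: V_def algebra_simps)
    qed
    ultimately have "0 \<le> 3 * (1 - real n0) + 4 * (0 - real n1) + (0 - real n2)"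
      by (intro tendsto_lowerbound) auto
    moreover have "real n0 \<ge> 0" "real n2 \<ge> 0" by auto
    ultimately have "real n1 < 1" by (simp add: algebra_simps)
    then have "n1 = 0" by simp
    then show ?thesis using n1(2) by simp
  qed
qed (simp add: zeta_nonzero_Re_gt_1)

section \<open>The prime number theorem\<close>

definition chebyshev_psi :: "nat \<Rightarrow> real" where
  "chebyshev_psi n = (\<Sum>d=1..n. mangoldt d)"

lemma chebyshev_psi_Suc: "chebyshev_psi (Suc n) = chebyshev_psi n + mangoldt (Suc n)"
  by (simp add: chebyshev_psi_def)

lemma chebyshev_psi_0 [simp]: "chebyshev_psi 0 = 0"
  by (simp add: chebyshev_psi_def)

lemma chebyshev_psi_mono: "m \<le> n \<Longrightarrow> chebyshev_psi m \<le> chebyshev_psi n"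
  unfolding chebyshev_psi_def by (intro sum_mono2) (auto simp: mangoldt_nonneg)

lemma chebyshev_psi_nonneg: "chebyshev_psi n \<ge> 0"
  unfolding chebyshev_psi_def by (intro sum_nonneg) (auto simp: mangoldt_nonneg)

section \<open>Chebyshev's upper bound\<close>

lemma card_multiples:
  fixes d m :: nat
  assumes "d > 0"
  shows "card {k \<in> {1..m}. d dvd k} = m div d"
proof -
  have "bij_betw (\<lambda>j. d * j) {1..m div d} {k \<in> {1..m}. d dvd k}"
  proof (rule bij_betwI')
    fix x y assume "x \<in> {1..m div d}" "y \<in> {1..m div d}"
    then show "(d * x = d * y) = (x = y)" using assms by simp
  next
    fix x assume x: "x \<in> {1..m div d}"
    then have "d * x \<le> m" using assms by (simp add: less_eq_div_iff_mult_less_eq mult.commute)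
    then show "d * x \<in> {k \<in> {1..m}. d dvd k}" using x assms by auto
  next
    fix k assume "k \<in> {k \<in> {1..m}. d dvd k}"
    then obtain j where j: "k = d * j" "1 \<le> k" "k \<le> m" by auto
    then have "j \<in> {1..m div d}" using assms by (auto simp: less_eq_div_iff_mult_less_eq mult.commute intro: Suc_leI Nat.gr0I)
    then show "\<exists>x\<in>{1..m div d}. k = d * x" using j by blast
  qed
  then show ?thesis by (metis bij_betw_same_card card_atLeastAtMost diff_Suc_1)
qed

text \<open>Legendre's formula: expand each \<open>ln k\<close> over the divisors of
  \<open>k\<close>, then count the multiples of each \<open>d\<close> up to
  \<open>m\<close>.\<close>

lemma ln_fact_mangoldt: "ln (fact m) = (\<Sum>d=1..m. mangoldt d * real (m div d))"
proof -
  have "ln (fact m :: real) = (\<Sum>k=1..m. ln (real k))"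
    unfolding fact_prod of_nat_prod by (rule ln_prod) auto
  also have "\<dots> = (\<Sum>k=1..m. \<Sum>d | d \<in> {1..m} \<and> d dvd k. mangoldt d)"
  proof (rule sum.cong[OF refl])
    fix k assume k: "k \<in> {1..m}"
    then have "{d. d dvd k} = {d. d \<in> {1..m} \<and> d dvd k}"
      by (auto dest: dvd_imp_le intro: Suc_leI Nat.gr0I)
    then show "ln (real k) = (\<Sum>d | d \<in> {1..m} \<and> d dvd k. mangoldt d)"
      using mangoldt_sum[of k, where ?'a = real] k by simp
  qed
  also have "\<dots> = (\<Sum>d=1..m. \<Sum>k | k \<in> {1..m} \<and> d dvd k. mangoldt d)"
    by (rule sum.swap_restrict) auto
  also have "\<dots> = (\<Sum>d=1..m. mangoldt d * real (m div d))"
    using card_multiples by (intro sum.cong) auto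
  finally show ?thesis .
qed

text \<open>The weight \<open>2 * n div d - 2 * (n div d)\<close> is never negative and is at least
  1 for \<open>n < d <= 2 * n\<close>. The weighted sum over all \<open>d\<close> is the logarithm
  of the central binomial coefficient, which is at most \<open>2 ^ (2 * n)\<close>.\<close>

lemma chebyshev_psi_double: "chebyshev_psi (2 * n) - chebyshev_psi n \<le> 2 * real n * ln 2"
proof -
  have "chebyshev_psi (2 * n) - chebyshev_psi n = (\<Sum>d\<in>{1..2*n} - {1..n}. mangoldt d)"
    unfolding chebyshev_psi_def by (intro sum_diff[symmetric]) auto
  also have "\<dots> \<le> (\<Sum>d\<in>{1..2*n} - {1..n}. mangoldt d * (real (2 * n div d) - 2 * real (n div d)))"
  proof (rule sum_mono)
    fix d assume d: "d \<in> {1..2*n} - {1..n}"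
    then have "n div d = 0" "2 * n div d \<ge> 1" by (auto simp: less_eq_div_iff_mult_less_eq Suc_le_eq div_greater_zero_iff)
    then have "real (2 * n div d) - 2 * real (n div d) \<ge> 1" by simp
    then show "mangoldt d \<le> mangoldt d * (real (2 * n div d) - 2 * real (n div d))"
      using mult_left_mono[of 1 _ "mangoldt d :: real"] mangoldt_nonneg[of d] by simp
  qed
  also have "\<dots> \<le> (\<Sum>d=1..2*n. mangoldt d * (real (2 * n div d) - 2 * real (n div d)))"
  proof (rule sum_mono2)
    fix d assume "d \<in> {1..2*n} - ({1..2*n} - {1..n})"
    have "2 * (n div d) \<le> 2 * n div d"
      by (cases "d = 0") (auto simp: less_eq_div_iff_mult_less_eq mult.assoc)
    then have "2 * real (n div d) \<le> real (2 * n div d)"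
      by (metis of_nat_mono of_nat_mult of_nat_numeral)
    then show "0 \<le> mangoldt d * (real (2 * n div d) - 2 * real (n div d))"
      by (intro mult_nonneg_nonneg) (auto simp: mangoldt_nonneg)
  qed auto
  also have "\<dots> = (\<Sum>d=1..2*n. mangoldt d * real (2 * n div d)) - 2 * (\<Sum>d=1..2*n. mangoldt d * real (n div d))"
    by (simp add: sum_distrib_left sum_subtractf algebra_simps)
  also have "(\<Sum>d=1..2*n. mangoldt d * real (n div d)) = (\<Sum>d=1..n. mangoldt d * real (n div d))"
    by (intro sum.mono_neutral_right) auto
  also have "(\<Sum>d=1..2*n. mangoldt d * real (2 * n div d)) - 2 * (\<Sum>d=1..n. mangoldt d * real (n div d))
    = ln (fact (2 * n)) - 2 * ln (fact n)" by (simp add: ln_fact_mangoldt)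
  also have "\<dots> = ln (real ((2 * n) choose n))"
    by (simp add: binomial_fact ln_div ln_mult mult_2[symmetric])
  also have "\<dots> \<le> ln (2 ^ (2 * n))"
  proof -
    have "((2 * n) choose n) \<le> 2 ^ (2 * n)" by (rule binomial_le_pow2)
    then have "real ((2 * n) choose n) \<le> 2 ^ (2 * n)"
      by (metis of_nat_mono of_nat_numeral of_nat_power)
    moreover have "(2 * n) choose n > 0" by (simp add: zero_less_binomial)
    ultimately show ?thesis by (subst ln_le_cancel_iff) auto
  qed
  also have "\<dots> = 2 * real n * ln 2" by (simp add: ln_realpow)
  finally show ?thesis .
qed

lemma chebyshev_psi_le: "chebyshev_psi n \<le> 3 * real n"
proof -
  \<comment> \<open>The factor 4 leaves room for rounding up at odd \<open>n = 2 * m + 1\<close>,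
    where \<open>6 * m + 6 <= 4 * n\<close> is needed and holds for \<open>m >= 1\<close>. Finally
    \<open>4 * ln 2 <= 25 / 9 < 3\<close>.\<close>
  have "chebyshev_psi n \<le> 4 * ln 2 * real n"
  proof (induction n rule: less_induct)
    case (less n)
    consider "n = 0" | "n = 1" | m where "n = 2 * m" "m \<ge> 1" | m where "n = 2 * m + 1" "m \<ge> 1"
      by (cases "even n") (auto elim!: evenE oddE, (metis One_nat_def less_one not_less mult_0_right)+)
    then show ?case
    proof cases
      case 3
      have "chebyshev_psi n \<le> chebyshev_psi m + 2 * real m * ln 2" using chebyshev_psi_double[of m] 3 by simp
      also have "chebyshev_psi m \<le> 4 * ln 2 * real m" using less[of m] 3 by simp
      finally have "chebyshev_psi n \<le> ln 2 * (6 * real m)" by (simp add: algebra_simps)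
      also have "\<dots> \<le> ln 2 * (4 * real n)" using 3 by (intro mult_left_mono) auto
      finally show ?thesis by simp
    next
      case 4
      have "chebyshev_psi n \<le> chebyshev_psi (2 * (m + 1))" using 4 by (intro chebyshev_psi_mono) simp
      also have "\<dots> \<le> chebyshev_psi (m + 1) + 2 * real (m + 1) * ln 2" using chebyshev_psi_double[of "m + 1"] by simp
      also have "chebyshev_psi (m + 1) \<le> 4 * ln 2 * real (m + 1)" using less[of "m + 1"] 4 by simp
      also have "4 * ln 2 * real (m + 1) + 2 * real (m + 1) * ln 2 = ln 2 * (6 * real m + 6)" by (simp add: algebra_simps)
      also have "\<dots> \<le> ln 2 * (4 * real n)" using 4 by (intro mult_left_mono) auto
      finally show ?thesis by simp
    qed (auto simp: chebyshev_psi_def)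
  qed
  also have "\<dots> \<le> 3 * real n"
    using ln2_le_25_over_36 by (intro mult_right_mono) auto
  finally show ?thesis .
qed

text \<open>Prepares the input of \<open>newman_dirichlet\<close>. Partial summation turns the
  series of \<open>mangoldt\<close> into one in \<open>psi\<close>, the series of zeta is subtracted
  so that the poles at 1 cancel, and \<open>U\<close> is where \<open>zeta_pole_free\<close> has no
  zeros, so it contains the closed half plane.\<close>

lemma chebyshev_psi_series:
  obtains U G where "open U" "{s. Re s \<ge> 1} \<subseteq> U" "G holomorphic_on U"
    "\<And>s. Re s > 1 \<Longrightarrow> (\<lambda>n. of_real ((chebyshev_psi n - real n) / real n) * of_nat n powr (- s)) sums G s"
proof -
  define w where "w n = complex_of_real (chebyshev_psi n)" for n
  have w: "norm (w n) \<le> 3 * real n powr 1" for n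
    using chebyshev_psi_le[of n] chebyshev_psi_nonneg[of n] by (simp add: w_def)
  obtain Q where Q: "Q holomorphic_on {z. Re z > 1 - 1}"
    "\<And>z. Re z > 1 - 1 \<Longrightarrow> (\<lambda>n. w n * zeta_term n z) sums Q z"
    by (rule weighted_zeta_term_series[of w 3 1, OF w]) auto
  define Z where "Z = zeta_pole_free"
  define D where "D s = (if s = 1 then deriv Z 1 else (Z s - Z 1) / (s - 1))" for s
  define H where "H = {s. Re s > 0}"
  have H: "open H" unfolding H_def by (rule open_halfspace_Re_gt)
  have Z: "Z holomorphic_on H" unfolding Z_def H_def by (rule zeta_pole_free_holomorphic)
  have "D holomorphic_on H"
    unfolding D_def using H by (intro pole_lemma Z) (auto simp: interior_open H_def)
  define U where "U = {s \<in> H. Z s \<noteq> 0}"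
  have "open U"
  proof -
    have "openin (top_of_set H) (H \<inter> Z -` (- {0}))"
      by (rule continuous_openin_preimage_gen) (use holomorphic_on_imp_continuous_on[OF Z] in auto)
    moreover have "H \<inter> Z -` (- {0}) = U" by (auto simp: U_def)
    ultimately show ?thesis using H openin_open_eq by auto
  qed
  have sub: "U \<subseteq> H" by (auto simp: U_def)
  \<comment> \<open>The pole cancels by hand: \<open>1 / ((s - 1) * s) = 1 / (s - 1) - 1 / s\<close>
    on the \<open>mangoldt\<close> side, and \<open>Z s / (s - 1) = 1 / (s - 1) + D s\<close> on the
    zeta side, since \<open>Z 1 = 1\<close>.\<close>
  define G where "G s = (Q s - deriv Z s / Z s - 1) / s - D s" for s
  have "G holomorphic_on U" unfolding G_def
  proof (intro holomorphic_on_diff holomorphic_on_divide holomorphic_on_const holomorphic_on_ident)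
    show "Q holomorphic_on U" using holomorphic_on_subset[OF Q(1)] sub by (auto simp: H_def)
    show "deriv Z holomorphic_on U" by (rule holomorphic_on_subset[OF holomorphic_deriv[OF Z H] sub])
    show "Z holomorphic_on U" by (rule holomorphic_on_subset[OF Z sub])
    show "D holomorphic_on U" by (rule holomorphic_on_subset[OF \<open>D holomorphic_on H\<close> sub])
  qed (auto simp: U_def H_def)
  moreover have "{s. Re s \<ge> 1} \<subseteq> U"
    using zeta_pole_free_nonzero by (auto simp: U_def H_def Z_def)
  moreover have "(\<lambda>n. of_real ((chebyshev_psi n - real n) / real n) * of_nat n powr (- s)) sums G s" if s: "Re s > 1" for s
  proof -
    have s0: "s \<noteq> 0" "s \<noteq> 1" using s by auto
    define \<phi> where "\<phi> n = (of_nat n :: complex) powr (- s)" for n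
    have part: "(\<Sum>n<N. w n * (\<phi> n - \<phi> (Suc n))) = (\<Sum>n<Suc N. mangoldt n * \<phi> n) - w N * \<phi> N" for N
    proof (induction N)
      case (Suc N)
      have "w (Suc N) = w N + mangoldt (Suc N)" by (simp add: w_def chebyshev_psi_Suc)
      then show ?case using Suc by (simp add: algebra_simps)
    qed (simp add: w_def)
    have wphi: "(\<lambda>N. w N * \<phi> N) \<longlonglongrightarrow> 0"
    proof (rule tendsto_norm_zero_cancel,
        rule tendsto_sandwich[where f = "\<lambda>_. 0" and h = "\<lambda>N. 3 * real N powr (- (Re s - 1))"])
      have "(\<lambda>N. real N powr (- (Re s - 1))) \<longlonglongrightarrow> 0"
        using s by (intro tendsto_neg_powr filterlim_real_sequentially) auto
      then show "(\<lambda>N. 3 * real N powr (- (Re s - 1))) \<longlonglongrightarrow> 0" by (intro tendsto_mult_right_zero)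
      show "\<forall>\<^sub>F N in sequentially. norm (w N * \<phi> N) \<le> 3 * real N powr (- (Re s - 1))"
      proof (rule eventually_sequentiallyI[of 1])
        fix N :: nat assume "N \<ge> 1"
        have "norm (w N * \<phi> N) \<le> (3 * real N powr 1) * real N powr (- Re s)"
          unfolding norm_mult \<phi>_def using w[of N] by (intro mult_mono) (auto simp: norm_powr_real_powr)
        also have "\<dots> = 3 * real N powr (1 + - Re s)" by (simp only: powr_add mult.assoc)
        finally show "norm (w N * \<phi> N) \<le> 3 * real N powr (- (Re s - 1))" by (simp add: algebra_simps)
      qed
    qed (auto intro: always_eventually)
    have "(\<lambda>N. \<Sum>n<Suc N. mangoldt n * \<phi> n) \<longlonglongrightarrow> mangoldt_series s"
      using mangoldt_series_sums[OF s] unfolding \<phi>_def sums_def by (rule LIMSEQ_Suc)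
    from tendsto_diff[OF this wphi] have S1: "(\<lambda>n. w n * (\<phi> n - \<phi> (Suc n))) sums mangoldt_series s"
      unfolding sums_def part by simp
    have S2: "(\<lambda>n. w n * zeta_term n s) sums Q s" using Q(2)[of s] s by simp
    \<comment> \<open>\<open>zeta_term n s\<close> is exactly the error in replacing
      \<open>s * n powr (- s - 1)\<close> by the difference of consecutive powers that partial
      summation produces.\<close>
    have "w n * (\<phi> n - \<phi> (Suc n)) + w n * zeta_term n s = s * (w n * of_nat n powr (- s - 1))" for n
      by (simp add: zeta_term_def \<phi>_def algebra_simps)
    with sums_add[OF S1 S2] have "(\<lambda>n. s * (w n * of_nat n powr (- s - 1))) sums (mangoldt_series s + Q s)"
      by simp
    from sums_divide[OF this, of s] have S3: "(\<lambda>n. w n * of_nat n powr (- s - 1)) sums ((mangoldt_series s + Q s) / s)"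
      using s0 by simp
    have S4: "(\<lambda>n. of_nat n powr (- s)) sums (Z s / (s - 1))" unfolding Z_def by (rule zeta_series_sums[OF s])
    have eq: "w n * of_nat n powr (- s - 1) - of_nat n powr (- s)
      = of_real ((chebyshev_psi n - real n) / real n) * of_nat n powr (- s)" for n
    proof (cases "n = 0")
      case False
      have "(of_nat n :: complex) powr (- s - 1) = of_nat n powr (- s) / of_nat n"
        using False by (simp add: powr_diff)
      then show ?thesis using False by (simp add: w_def field_simps)
    qed (simp add: w_def)
    have "(mangoldt_series s + Q s) / s - Z s / (s - 1) = G s"
    proof -
      have "Z s \<noteq> 0" unfolding Z_def using s by (intro zeta_pole_free_nonzero) auto
      moreover have m: "mangoldt_series s = 1 / (s - 1) - deriv Z s / Z s"
        unfolding Z_def by (rule mangoldt_series_eq[OF s])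
      moreover have "Z 1 = 1" by (simp add: Z_def zeta_pole_free_1)
      moreover have "s - 1 \<noteq> 0" using s0 by simp
      moreover have "1 / (s - 1) / s = 1 / (s - 1) - 1 / s" using s0 \<open>s - 1 \<noteq> 0\<close> by (simp add: divide_simps)
      ultimately show ?thesis using s0 unfolding G_def D_def m
        by (simp add: add_divide_distrib diff_divide_distrib)
    qed
    then show ?thesis using sums_diff[OF S3 S4] unfolding eq by simp
  qed
  ultimately show ?thesis using that \<open>open U\<close> by blast
qed

lemma chebyshev_psi_newman_convergent:
  "convergent (\<lambda>N. \<Sum>n=1..N. (chebyshev_psi n - real n) / (real n)\<^sup>2)"
proof -
  obtain U G where UG: "open U" "{s. Re s \<ge> 1} \<subseteq> U" "G holomorphic_on U"
    "\<And>s. Re s > 1 \<Longrightarrow> (\<lambda>n. of_real ((chebyshev_psi n - real n) / real n) * of_nat n powr (- s)) sums G s"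
    by (rule chebyshev_psi_series) (rule that)
  have "norm (complex_of_real ((chebyshev_psi n - real n) / real n)) \<le> 3" for n
  proof (cases "n = 0")
    case False
    have "\<bar>chebyshev_psi n - real n\<bar> \<le> 3 * real n"
      using chebyshev_psi_le[of n] chebyshev_psi_nonneg[of n] by linarith
    then show ?thesis using False unfolding norm_of_real abs_divide by (simp add: divide_le_eq)
  qed simp
  from newman_dirichlet[OF this UG(1-3) UG(4)]
  have "(\<lambda>N. \<Sum>n=1..N. complex_of_real ((chebyshev_psi n - real n) / real n) / of_nat n) \<longlonglongrightarrow> G 1" .
  from tendsto_Re[OF this]
  have "(\<lambda>N. \<Sum>n=1..N. (chebyshev_psi n - real n) / real n / real n) \<longlonglongrightarrow> Re (G 1)"
    by (simp add: Re_divide_of_nat)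
  then show ?thesis unfolding convergent_def power2_eq_square by (auto simp: divide_divide_eq_left)
qed

text \<open>If \<open>f N >= \<rho> * N\<close> with \<open>\<rho> > 1\<close>, monotonicity keeps
  \<open>f k - k\<close> large for all \<open>k\<close> from \<open>N\<close> to
  \<open>\<mu> * N\<close>, where \<open>1 < \<mu> < \<rho>\<close>. Such a block adds at least a
  fixed \<open>c\<close> to the series, against the Cauchy criterion. The lower estimate uses blocks
  from \<open>\<mu> * N\<close> to \<open>N\<close> instead.\<close>

lemma tauberian_monotone:
  fixes f :: "nat \<Rightarrow> real"
  assumes mono: "\<And>m n. m \<le> n \<Longrightarrow> f m \<le> f n"
    and conv: "convergent (\<lambda>N. \<Sum>n=1..N. (f n - real n) / (real n)\<^sup>2)"
  shows "(\<lambda>n. f n / real n) \<longlonglongrightarrow> 1"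
proof -
  define S where "S N = (\<Sum>n=1..N. (f n - real n) / (real n)\<^sup>2)" for N
  define B where "B m n = (\<Sum>k=m..n. (f k - real k) / (real k)\<^sup>2)" for m n
  have "Cauchy S" using conv unfolding S_def by (rule convergent_Cauchy)
  have block: "\<exists>N0\<ge>1. \<forall>m\<ge>N0. \<forall>n\<ge>m. \<bar>B m n\<bar> < c" if "c > 0" for c
  proof -
    obtain M where M: "\<And>m n. m \<ge> M \<Longrightarrow> n \<ge> M \<Longrightarrow> dist (S m) (S n) < c"
      using \<open>Cauchy S\<close> \<open>c > 0\<close> unfolding Cauchy_def by metis
    have "\<bar>B m n\<bar> < c" if "m \<ge> M + 1" "n \<ge> m" for m n
    proof -
      have "{1..n} = {1..m-1} \<union> {m..n}" using that by auto
      then have "S n = S (m - 1) + B m n"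
        unfolding S_def B_def by (simp only:) (subst sum.union_disjoint, use that in auto)
      moreover have "dist (S n) (S (m - 1)) < c" using that by (intro M) auto
      ultimately show ?thesis by (simp add: dist_real_def)
    qed
    then show ?thesis by (intro exI[of _ "M + 1"]) auto
  qed
  have upper: "\<forall>\<^sub>F n in sequentially. f n / real n < \<rho>" if \<rho>: "\<rho> > 1" for \<rho>
  proof -
    define \<mu> where "\<mu> = (1 + \<rho>) / 2"
    have \<mu>: "1 < \<mu>" "\<mu> < \<rho>" using \<rho> by (auto simp: \<mu>_def field_simps)
    \<comment> \<open>At least \<open>(\<mu> - 1) * N\<close> terms, each at least
      \<open>(\<rho> - \<mu>) * N / (\<mu> * N)^2\<close>.\<close>
    define c where "c = (\<rho> - \<mu>) * (\<mu> - 1) / \<mu>\<^sup>2"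
    have "c > 0" unfolding c_def using \<mu> by simp
    then obtain N0 where N0: "N0 \<ge> 1" "\<And>m n. m \<ge> N0 \<Longrightarrow> n \<ge> m \<Longrightarrow> \<bar>B m n\<bar> < c"
      using block by blast
    show ?thesis
    proof (rule eventually_sequentiallyI[of N0], rule ccontr)
      fix N assume N: "N \<ge> N0" "\<not> f N / real N < \<rho>"
      have Npos: "real N > 0" using N N0(1) by simp
      have fN: "f N \<ge> \<rho> * real N" using N(2) Npos by (simp add: not_less field_simps)
      define M where "M = nat \<lfloor>\<mu> * real N\<rfloor>"
      have MN: "real M \<le> \<mu> * real N" "real M > \<mu> * real N - 1" unfolding M_def using \<mu> Npos by simp_all
      have "M \<ge> N" using MN(2) \<mu> Npos mult_right_mono[of 1 \<mu> "real N"] by (simp add: M_def le_nat_iff le_floor_iff)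
      have "(\<Sum>k=N..M. (\<rho> - \<mu>) * real N / (\<mu> * real N)\<^sup>2) \<le> B N M"
        unfolding B_def
      proof (rule sum_mono)
        fix k assume k: "k \<in> {N..M}"
        then have k': "real k \<ge> real N" "real k \<le> \<mu> * real N" using MN by auto
        have "(\<rho> - \<mu>) * real N \<le> f k - real k"
          using mono[of N k] k fN k' by (simp add: algebra_simps)
        moreover have "0 \<le> (\<rho> - \<mu>) * real N" using \<mu> by simp
        ultimately show "(\<rho> - \<mu>) * real N / (\<mu> * real N)\<^sup>2 \<le> (f k - real k) / (real k)\<^sup>2"
          using k' Npos \<mu> by (intro frac_le power_mono order_trans[of 0 "(\<rho> - \<mu>) * real N" "f k - real k"]) auto
      qed
      also have "(\<Sum>k=N..M. (\<rho> - \<mu>) * real N / (\<mu> * real N)\<^sup>2) = (real M + 1 - real N) * ((\<rho> - \<mu>) * real N / (\<mu> * real N)\<^sup>2)"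
        using \<open>M \<ge> N\<close> by (simp add: of_nat_diff)
      finally have "(real M + 1 - real N) * ((\<rho> - \<mu>) * real N / (\<mu> * real N)\<^sup>2) < c"
        using N0(2)[of N M] N \<open>M \<ge> N\<close> by linarith
      moreover have "((\<mu> - 1) * real N) * ((\<rho> - \<mu>) * real N / (\<mu> * real N)\<^sup>2)
        \<le> (real M + 1 - real N) * ((\<rho> - \<mu>) * real N / (\<mu> * real N)\<^sup>2)"
        using MN \<mu> Npos by (intro mult_right_mono) (auto simp: algebra_simps)
      moreover have "((\<mu> - 1) * real N) * ((\<rho> - \<mu>) * real N / (\<mu> * real N)\<^sup>2) = c"
        unfolding c_def using Npos \<mu> by (simp add: field_simps power2_eq_square)
      ultimately show False by linarith
    qed
  qed
  have lower: "\<forall>\<^sub>F n in sequentially. f n / real n > \<rho>" if \<rho>: "0 < \<rho>" "\<rho> < 1" for \<rho>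
  proof -
    define \<mu> where "\<mu> = (1 + \<rho>) / 2"
    have \<mu>: "\<mu> < 1" "\<rho> < \<mu>" "0 < \<mu>" using \<rho> by (auto simp: \<mu>_def field_simps)
    \<comment> \<open>At least \<open>(1 - \<mu>) * N\<close> terms, each at most
      \<open>- (\<mu> - \<rho>) * N / N^2\<close>.\<close>
    define c where "c = (\<mu> - \<rho>) * (1 - \<mu>)"
    have "c > 0" unfolding c_def using \<mu> by simp
    then obtain N0 where N0: "N0 \<ge> 1" "\<And>m n. m \<ge> N0 \<Longrightarrow> n \<ge> m \<Longrightarrow> \<bar>B m n\<bar> < c"
      using block by blast
    show ?thesis
    proof (rule eventually_sequentiallyI[of "nat \<lceil>real N0 / \<mu>\<rceil>"], rule ccontr)
      fix N assume N: "N \<ge> nat \<lceil>real N0 / \<mu>\<rceil>" "\<not> f N / real N > \<rho>"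
      have "real N \<ge> real N0 / \<mu>" using N(1) by linarith
      then have NN: "\<mu> * real N \<ge> real N0" using \<mu> by (simp add: field_simps)
      then have Npos: "real N > 0" using N0(1) \<mu> by (smt (verit) of_nat_1 of_nat_mono zero_less_mult_pos)
      have fN: "f N \<le> \<rho> * real N" using N(2) Npos by (simp add: not_less field_simps)
      define M where "M = nat \<lceil>\<mu> * real N\<rceil>"
      have pos: "\<mu> * real N > 0" using \<mu> Npos by simp
      then have "real M = of_int \<lceil>\<mu> * real N\<rceil>" unfolding M_def by simp
      then have MN: "real M \<ge> \<mu> * real N" "real M < \<mu> * real N + 1"
        using ceiling_correct[of "\<mu> * real N"] by linarith+
      have "M \<ge> N0" using NN MN(1) by linarith
      have "M \<le> N" using \<mu> Npos unfolding M_def by (simp add: nat_le_iff ceiling_le_iff)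
      have Mpos: "real M > 0" using MN(1) \<mu> Npos by (smt (verit) mult_pos_pos)
      have "B M N \<le> (\<Sum>k=M..N. - ((\<mu> - \<rho>) * real N / (real N)\<^sup>2))"
        unfolding B_def
      proof (rule sum_mono)
        fix k assume k: "k \<in> {M..N}"
        then have k': "real k \<le> real N" "real k \<ge> \<mu> * real N" "real k > 0" using MN Mpos by auto
        have "(\<mu> - \<rho>) * real N \<le> real k - f k"
          using mono[of k N] k fN k' by (simp add: algebra_simps)
        moreover have "0 \<le> (\<mu> - \<rho>) * real N" using \<mu> by simp
        ultimately have "(\<mu> - \<rho>) * real N / (real N)\<^sup>2 \<le> (real k - f k) / (real k)\<^sup>2"
          using k' Npos \<mu> by (intro frac_le power_mono order_trans[of 0 "(\<mu> - \<rho>) * real N" "real k - f k"]) auto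
        then show "(f k - real k) / (real k)\<^sup>2 \<le> - ((\<mu> - \<rho>) * real N / (real N)\<^sup>2)"
          by (simp add: diff_divide_distrib)
      qed
      also have "\<dots> = - ((real N + 1 - real M) * ((\<mu> - \<rho>) * real N / (real N)\<^sup>2))"
        using \<open>M \<le> N\<close> by (simp add: of_nat_diff)
      finally have "(real N + 1 - real M) * ((\<mu> - \<rho>) * real N / (real N)\<^sup>2) < c"
        using N0(2)[of M N] \<open>M \<ge> N0\<close> \<open>M \<le> N\<close> by linarith
      moreover have "((1 - \<mu>) * real N) * ((\<mu> - \<rho>) * real N / (real N)\<^sup>2)
        \<le> (real N + 1 - real M) * ((\<mu> - \<rho>) * real N / (real N)\<^sup>2)"
        using MN \<mu> Npos by (intro mult_right_mono) (auto simp: algebra_simps)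
      moreover have "((1 - \<mu>) * real N) * ((\<mu> - \<rho>) * real N / (real N)\<^sup>2) = c"
        unfolding c_def using Npos \<mu> by (simp add: field_simps power2_eq_square)
      ultimately show False by linarith
    qed
  qed
  show ?thesis
  proof (rule order_tendstoI)
    fix a :: real assume "a < 1"
    then have "\<forall>\<^sub>F n in sequentially. f n / real n > max a (1/2)" by (intro lower) auto
    then show "\<forall>\<^sub>F n in sequentially. a < f n / real n" by eventually_elim auto
  qed (rule upper)
qed

theorem chebyshev_psi_asymptotic: "(\<lambda>n. chebyshev_psi n / real n) \<longlonglongrightarrow> 1"
  by (rule tauberian_monotone[OF chebyshev_psi_mono chebyshev_psi_newman_convergent])

section \<open>From psi to the prime counting function\<close>

definition prime_count :: "real \<Rightarrow> nat" where
  "prime_count x = card {p. prime p \<and> real p \<le> x}"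

lemma finite_primes_le: "finite {p :: nat. prime p \<and> real p \<le> x}"
  by (rule finite_subset[of _ "{..nat \<lfloor>x\<rfloor>}"]) (auto simp: le_nat_floor)

text \<open>A prime \<open>p <= x\<close> has at most \<open>log p x\<close> powers up to
  \<open>x\<close>, each weighted \<open>ln p\<close>, so its total contribution is at most
  \<open>ln x\<close>.\<close>

lemma chebyshev_psi_le_prime_count:
  assumes x: "x \<ge> 1"
  shows "chebyshev_psi (nat \<lfloor>x\<rfloor>) \<le> real (prime_count x) * ln x"
proof -
  let ?n = "nat \<lfloor>x\<rfloor>" and ?P = "{p :: nat. prime p \<and> real p \<le> x}"
  define Q where "Q = {q \<in> {1..?n}. primepow q}"
  have le: "real q \<le> x" if "q \<in> Q" for q using that x unfolding Q_def by (auto simp: le_nat_iff le_floor_iff)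
  have img: "aprimedivisor ` Q \<subseteq> ?P"
  proof
    fix p assume "p \<in> aprimedivisor ` Q"
    then obtain q where q: "q \<in> Q" "p = aprimedivisor q" by blast
    then have "q > 1" using primepow_gt_Suc_0[of q] by (auto simp: Q_def)
    then have "prime p" "p dvd q" using q aprimedivisor_nat[of q] by auto
    then show "p \<in> ?P" using le[OF q(1)] dvd_imp_le[of p q] \<open>q > 1\<close> by auto
  qed
  have "chebyshev_psi ?n = (\<Sum>q\<in>Q. ln (real (aprimedivisor q)))"
    unfolding chebyshev_psi_def Q_def by (subst sum.inter_filter) (auto simp: mangoldt_def intro!: sum.cong)
  also have "\<dots> = (\<Sum>p\<in>?P. \<Sum>q | q \<in> Q \<and> aprimedivisor q = p. ln (real (aprimedivisor q)))"
    by (rule sum.group[symmetric]) (use img finite_primes_le in \<open>auto simp: Q_def\<close>)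
  also have "\<dots> \<le> (\<Sum>p\<in>?P. ln x)"
  proof (rule sum_mono)
    fix p assume p: "p \<in> ?P"
    then have p1: "prime p" "real p > 1" using prime_gt_1_nat by auto
    have "(\<Sum>q | q \<in> Q \<and> aprimedivisor q = p. ln (real (aprimedivisor q))) = real (card {q \<in> Q. aprimedivisor q = p}) * ln (real p)"
      by simp
    also have "card {q \<in> Q. aprimedivisor q = p} \<le> card ((\<lambda>e. p ^ e) ` {1..nat \<lfloor>log p x\<rfloor>})"
    proof (rule card_mono)
      show "{q \<in> Q. aprimedivisor q = p} \<subseteq> (\<lambda>e. p ^ e) ` {1..nat \<lfloor>log p x\<rfloor>}"
      proof
        fix q assume q: "q \<in> {q \<in> Q. aprimedivisor q = p}"
        then have "primepow q" by (simp add: Q_def)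
        then obtain p' e where pe: "prime p'" "e > 0" "q = p' ^ e" unfolding primepow_def by blast
        have "p' = p" using q pe by (auto simp: aprimedivisor_prime_power)
        have "real p ^ e \<le> x" using le[of q] q pe \<open>p' = p\<close> by simp
        then have "real e \<le> log p x" using p1 x by (subst le_log_iff) (auto simp: powr_realpow)
        then have "e \<le> nat \<lfloor>log p x\<rfloor>" by (simp add: le_nat_floor)
        then show "q \<in> (\<lambda>e. p ^ e) ` {1..nat \<lfloor>log p x\<rfloor>}" using pe \<open>p' = p\<close> by auto
      qed
    qed auto
    also have "\<dots> \<le> nat \<lfloor>log p x\<rfloor>" using card_image_le[of "{1..nat \<lfloor>log p x\<rfloor>}" "\<lambda>e. p ^ e"] by simp
    also have "real (nat \<lfloor>log p x\<rfloor>) * ln (real p) \<le> log p x * ln (real p)"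
      using p1 x by (intro mult_right_mono) auto
    also have "\<dots> = ln x" using p1 by (simp add: log_def)
    finally show "(\<Sum>q | q \<in> Q \<and> aprimedivisor q = p. ln (real (aprimedivisor q))) \<le> ln x"
      using p1 by (simp add: mult_right_mono)
  qed
  finally show ?thesis by (simp add: prime_count_def)
qed

text \<open>Discarding the primes up to \<open>x powr \<alpha>\<close> costs at most
  \<open>x powr \<alpha>\<close> of them, and each remaining one weighs at least
  \<open>\<alpha> * ln x\<close>.\<close>

lemma prime_count_le_chebyshev_psi:
  assumes x: "x \<ge> 1" and \<alpha>: "0 < \<alpha>"
  shows "(real (prime_count x) - x powr \<alpha>) * (\<alpha> * ln x) \<le> chebyshev_psi (nat \<lfloor>x\<rfloor>)"
proof -
  let ?P = "{p :: nat. prime p \<and> real p \<le> x}" and ?S = "{p :: nat. prime p \<and> real p \<le> x powr \<alpha>}"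
  have "card ?S \<le> card {1..nat \<lfloor>x powr \<alpha>\<rfloor>}"
    by (intro card_mono) (auto simp: le_nat_floor Suc_le_eq prime_gt_0_nat)
  then have "real (card ?S) \<le> x powr \<alpha>" by (simp add: le_nat_floor le_floor_iff le_nat_iff)
  moreover have "card (?P - ?S) \<ge> card ?P - card ?S" using finite_primes_le by (intro diff_card_le_card_Diff) auto
  ultimately have "real (prime_count x) - x powr \<alpha> \<le> real (card (?P - ?S))" unfolding prime_count_def by linarith
  then have "(real (prime_count x) - x powr \<alpha>) * (\<alpha> * ln x) \<le> real (card (?P - ?S)) * (\<alpha> * ln x)"
    using x \<alpha> by (intro mult_right_mono) auto
  also have "\<dots> = (\<Sum>p\<in>?P - ?S. \<alpha> * ln x)" by simp
  also have "\<dots> \<le> (\<Sum>p\<in>?P - ?S. mangoldt p)"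
  proof (rule sum_mono)
    fix p assume p: "p \<in> ?P - ?S"
    then have "ln (x powr \<alpha>) \<le> ln (real p)" using x by (intro ln_mono) auto
    then show "\<alpha> * ln x \<le> mangoldt p" using p x by (simp add: ln_powr)
  qed
  also have "\<dots> \<le> chebyshev_psi (nat \<lfloor>x\<rfloor>)"
    unfolding chebyshev_psi_def by (intro sum_mono2) (auto simp: le_nat_floor mangoldt_nonneg Suc_le_eq prime_gt_0_nat)
  finally show ?thesis .
qed

theorem prime_number_theorem: "((\<lambda>x. real (prime_count x) / (x / ln x)) \<longlongrightarrow> 1) at_top"
proof -
  define \<psi> where "\<psi> x = chebyshev_psi (nat \<lfloor>x\<rfloor>)" for x :: real
  have fl: "filterlim (\<lambda>x::real. nat \<lfloor>x\<rfloor>) sequentially at_top"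
    by (rule filterlim_compose[OF filterlim_nat_sequentially filterlim_floor_sequentially])
  have "((\<lambda>x::real. \<psi> x / real (nat \<lfloor>x\<rfloor>)) \<longlongrightarrow> 1) at_top"
    unfolding \<psi>_def by (rule filterlim_compose[OF chebyshev_psi_asymptotic fl])
  moreover have "((\<lambda>x::real. real (nat \<lfloor>x\<rfloor>) / x) \<longlongrightarrow> 1) at_top" by real_asymp
  ultimately have "((\<lambda>x::real. \<psi> x / real (nat \<lfloor>x\<rfloor>) * (real (nat \<lfloor>x\<rfloor>) / x)) \<longlongrightarrow> 1 * 1) at_top"
    by (rule tendsto_mult)
  moreover have "\<forall>\<^sub>F x::real in at_top. \<psi> x / real (nat \<lfloor>x\<rfloor>) * (real (nat \<lfloor>x\<rfloor>) / x) = \<psi> x / x"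
    using eventually_ge_at_top[of 1] by eventually_elim (auto simp: le_nat_floor \<psi>_def)
  ultimately have lim: "((\<lambda>x::real. \<psi> x / x) \<longlongrightarrow> 1) at_top"
    using Lim_transform_eventually by fastforce
  show ?thesis
  proof (rule order_tendstoI)
    fix a :: real assume "a < 1"
    then have "\<forall>\<^sub>F x in at_top. a < \<psi> x / x" using lim order_tendstoD(1) by blast
    then show "\<forall>\<^sub>F x in at_top. a < real (prime_count x) / (x / ln x)"
      using eventually_ge_at_top[of 2]
    proof eventually_elim
      fix x :: real assume x: "2 \<le> x" "a < \<psi> x / x"
      have "\<psi> x / x \<le> real (prime_count x) * ln x / x"
        using x chebyshev_psi_le_prime_count[of x] unfolding \<psi>_def by (intro divide_right_mono) auto
      then show "a < real (prime_count x) / (x / ln x)" using x by simp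
    qed
  next
    fix a :: real assume a: "1 < a"
    \<comment> \<open>Chosen so that \<open>1 / \<alpha>\<close> is the midpoint of 1 and
      \<open>a\<close>.\<close>
    define \<alpha> where "\<alpha> = 2 / (1 + a)"
    have \<alpha>: "0 < \<alpha>" "\<alpha> < 1" "1 / \<alpha> < a" using a by (auto simp: \<alpha>_def field_simps)
    have "((\<lambda>x::real. x powr \<alpha> * ln x / x) \<longlongrightarrow> 0) at_top" using \<alpha> by real_asymp
    then have "((\<lambda>x::real. \<psi> x / x * (1 / \<alpha>) + x powr \<alpha> * ln x / x) \<longlongrightarrow> 1 * (1 / \<alpha>) + 0) at_top"
      by (intro tendsto_add tendsto_mult lim tendsto_const)
    then have "\<forall>\<^sub>F x in at_top. \<psi> x / x * (1 / \<alpha>) + x powr \<alpha> * ln x / x < a"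
      using \<alpha> by (intro order_tendstoD(2)) auto
    then show "\<forall>\<^sub>F x in at_top. real (prime_count x) / (x / ln x) < a"
      using eventually_ge_at_top[of 2]
    proof eventually_elim
      fix x :: real
      assume x: "2 \<le> x" "\<psi> x / x * (1 / \<alpha>) + x powr \<alpha> * ln x / x < a"
      have "(real (prime_count x) - x powr \<alpha>) * ln x \<le> \<psi> x * (1 / \<alpha>)"
        using prime_count_le_chebyshev_psi[of x \<alpha>] x \<alpha> by (simp add: \<psi>_def field_simps)
      then have "real (prime_count x) * ln x \<le> \<psi> x * (1 / \<alpha>) + x powr \<alpha> * ln x"
        by (simp add: algebra_simps)
      then have "real (prime_count x) * ln x / x \<le> (\<psi> x * (1 / \<alpha>) + x powr \<alpha> * ln x) / x"
        using x by (intro divide_right_mono) auto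
      then show "real (prime_count x) / (x / ln x) < a"
        using x by (simp add: add_divide_distrib mult.commute[of \<alpha>])
    qed
  qed
qed

section \<open>Sporadic solutions\<close>

lemma divisor_sigma_mult_coprime:
  assumes "coprime m n" "m > 0" "n > 0"
  shows "divisor_sigma (m * n) = divisor_sigma m * divisor_sigma n"
proof -
  have "bij_betw (\<lambda>(d, e). d * e) ({d. d dvd m} \<times> {e. e dvd n}) {d. d dvd m * n}"
  proof (rule bij_betwI')
    fix x y assume xy: "x \<in> {d. d dvd m} \<times> {e. e dvd n}" "y \<in> {d. d dvd m} \<times> {e. e dvd n}"
    obtain d e d' e' where de: "x = (d, e)" "y = (d', e')" by (cases x, cases y) auto
    have cop: "coprime d e'" "coprime d' e" using xy de assms(1) by (auto intro: coprime_divisors)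
    show "((case x of (d, e) \<Rightarrow> d * e) = (case y of (d, e) \<Rightarrow> d * e)) = (x = y)"
    proof
      assume "(case x of (d, e) \<Rightarrow> d * e) = (case y of (d, e) \<Rightarrow> d * e)"
      then have eq: "d * e = d' * e'" using de by simp
      have "d dvd d'" using cop(1) eq by (metis coprime_dvd_mult_left_iff dvd_triv_left)
      moreover have "d' dvd d" using cop(2) eq by (metis coprime_dvd_mult_left_iff dvd_triv_left)
      ultimately have "d = d'" by (rule dvd_antisym)
      moreover have "d > 0" using xy de assms(2) by (auto intro: Nat.gr0I)
      ultimately show "x = y" using eq de by simp
    qed (simp add: de)
  next
    fix x assume "x \<in> {d. d dvd m} \<times> {e. e dvd n}"
    then show "(case x of (d, e) \<Rightarrow> d * e) \<in> {d. d dvd m * n}" by (auto intro: mult_dvd_mono)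
  next
    fix y assume "y \<in> {d. d dvd m * n}"
    then obtain d e where "y = d * e" "d dvd m" "e dvd n" by (auto elim: dvd_productE)
    then show "\<exists>x\<in>{d. d dvd m} \<times> {e. e dvd n}. y = (case x of (d, e) \<Rightarrow> d * e)" by auto
  qed
  then have "(\<Sum>(d, e)\<in>{d. d dvd m} \<times> {e. e dvd n}. d * e) = divisor_sigma (m * n)"
    unfolding divisor_sigma_def using sum.reindex_bij_betw[of "\<lambda>(d, e). d * e" _ _ "\<lambda>d. d"] by (simp add: case_prod_beta)
  then show ?thesis
    unfolding divisor_sigma_def sum_product by (simp add: sum.cartesian_product)
qed

lemma divisor_sigma_ge: "n > 0 \<Longrightarrow> n \<le> divisor_sigma n"
  unfolding divisor_sigma_def by (rule member_le_sum) auto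

lemma divisor_sigma_prime_power:
  assumes "prime p"
  shows "divisor_sigma (p ^ e) = (\<Sum>i\<le>e. p ^ i)"
proof -
  have "{d. d dvd p ^ e} = (\<lambda>i. p ^ i) ` {..e}"
    using divides_primepow_nat[OF assms] by auto
  moreover have "inj_on (\<lambda>i. p ^ i) {..e}"
    using prime_gt_1_nat[OF assms] by (auto intro!: inj_onI dest: power_inject_exp[THEN iffD1, rotated])
  ultimately show ?thesis unfolding divisor_sigma_def by (simp add: sum.reindex)
qed

lemma divisor_sigma_prime: "prime p \<Longrightarrow> divisor_sigma p = p + 1"
  using divisor_sigma_prime_power[of p 1] by simp

text \<open>The divisor sum is 1 modulo \<open>p\<close>. Hence \<open>q / sigma q\<close> is in
  lowest terms for a prime power \<open>q\<close> and determines \<open>q\<close>, which is the key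
  to \<open>abundancy_solution_determined\<close>.\<close>

lemma coprime_divisor_sigma_prime_power:
  assumes "prime p"
  shows "coprime (p ^ e) (divisor_sigma (p ^ e))"
proof -
  have "(\<Sum>i\<le>e. p ^ i) = 1 + p * (\<Sum>i<e. p ^ i)"
    by (simp add: sum.atMost_shift sum_distrib_left)
  moreover have "coprime p (1 + p * t)" for t
    by (rule coprimeI) (metis dvd_add_left_iff dvd_mult2)
  ultimately have "coprime p (divisor_sigma (p ^ e))"
    using divisor_sigma_prime_power[OF assms] by metis
  then show ?thesis by simp
qed

section \<open>Unitary divisors of intermediate size\<close>

definition unitary_divisor :: "nat \<Rightarrow> nat \<Rightarrow> bool" where
  "unitary_divisor d n \<longleftrightarrow> (\<exists>k. n = d * k \<and> coprime d k)"

lemma unitary_divisor_mult: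
  assumes "unitary_divisor d m" "coprime q m"
  shows "unitary_divisor d (q * m)"
proof -
  obtain k where k: "m = d * k" "coprime d k" using assms(1) unfolding unitary_divisor_def by blast
  then have "coprime d (q * k)" using assms(2) by (simp add: coprime_commute)
  then show ?thesis unfolding unitary_divisor_def using k by (intro exI[of _ "q * k"]) auto
qed

lemma exact_prime_power_split:
  assumes "n > (1 :: nat)"
  obtains p e m where "prime p" "e \<ge> 1" "n = p ^ e * m" "coprime (p ^ e) m" "0 < m" "m < n"
proof -
  obtain p where p: "prime p" "p dvd n" using prime_factor_nat[of n] assms by auto
  obtain m where m: "n = p ^ multiplicity p n * m" "\<not> p dvd m"
    using multiplicity_decompose'[of n p] p assms by (metis not_prime_unit not_one_less_zero)
  have e: "multiplicity p n \<ge> 1" using p assms by (simp add: Suc_le_eq prime_multiplicity_gt_zero_iff)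
  have "m > 0" using m assms by (intro Nat.gr0I) auto
  moreover have "p ^ multiplicity p n > 1" using e prime_gt_1_nat[OF p(1)] by (intro one_less_power) auto
  then have "m < n" using m(1) \<open>m > 0\<close> by (metis mult.left_neutral mult_less_cancel2)
  moreover have "coprime (p ^ multiplicity p n) m" using m(2) p(1) by (simp add: prime_imp_coprime)
  ultimately show ?thesis using that p(1) e m(1) by blast
qed

text \<open>Exact prime powers are stripped one at a time. While the number exceeds
  \<open>z^2\<close> and the stripped power is at most \<open>z\<close>, the cofactor still exceeds
  \<open>z\<close>, so the interval from \<open>z\<close> to \<open>z^2\<close> cannot be jumped
  over.\<close>

lemma unitary_divisor_between:
  fixes z :: real
  assumes z: "z \<ge> 1" and n: "real n > z"
  shows "(\<exists>d. unitary_divisor d n \<and> z < real d \<and> real d \<le> z\<^sup>2) \<or>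
    (\<exists>p e. prime p \<and> e \<ge> 1 \<and> unitary_divisor (p ^ e) n \<and> z\<^sup>2 < real (p ^ e))"
  using n
proof (induction n rule: less_induct)
  case (less n)
  have "n > 1" using less.prems z by (cases n) auto
  then obtain p e m where pem: "prime p" "e \<ge> 1" "n = p ^ e * m" "coprime (p ^ e) m" "0 < m" "m < n"
    by (rule exact_prime_power_split)
  have u: "unitary_divisor (p ^ e) n" unfolding unitary_divisor_def using pem by blast
  consider "real n \<le> z\<^sup>2" | "z\<^sup>2 < real (p ^ e)" | "z < real (p ^ e)" "real (p ^ e) \<le> z\<^sup>2"
    | "z\<^sup>2 < real n" "real (p ^ e) \<le> z" by linarith
  then show ?case
  proof cases
    case 1
    have "unitary_divisor n n" unfolding unitary_divisor_def by (intro exI[of _ 1]) auto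
    then show ?thesis using 1 less.prems by blast
  next
    case 2
    then show ?thesis using u pem by blast
  next
    case 3
    then show ?thesis using u by blast
  next
    case 4
    have "z * z < real (p ^ e) * real m" using 4(1) pem(3) by (simp add: power2_eq_square)
    also have "\<dots> \<le> z * real m" using 4(2) by (intro mult_right_mono) auto
    finally have "z < real m" using z by simp
    then show ?thesis using less.IH[OF pem(6)] unitary_divisor_mult[OF _ pem(4)] pem(3) by metis
  qed
qed

lemma real_card_UN_le:
  assumes "finite I" "\<And>i. i \<in> I \<Longrightarrow> real (card (A i)) \<le> B i"
  shows "real (card (\<Union>i\<in>I. A i)) \<le> sum B I"
proof -
  have "real (card (\<Union>i\<in>I. A i)) \<le> real (\<Sum>i\<in>I. card (A i))" by (intro of_nat_mono card_UN_le assms)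
  also have "\<dots> \<le> sum B I" unfolding of_nat_sum by (intro sum_mono assms)
  finally show ?thesis .
qed

section \<open>Counting small nonzero defects\<close>

definition sigma_defect :: "nat \<Rightarrow> nat \<Rightarrow> nat \<Rightarrow> int" where
  "sigma_defect a b n = int (b * divisor_sigma n) - int (a * n)"

definition small_defect :: "nat \<Rightarrow> nat \<Rightarrow> real \<Rightarrow> real \<Rightarrow> nat \<Rightarrow> bool" where
  "small_defect a b x J n \<longleftrightarrow> n > 0 \<and> real n \<le> x \<and> sigma_defect a b n \<noteq> 0 \<and>
    \<bar>real_of_int (sigma_defect a b n)\<bar> < J"

text \<open>Within one residue class modulo \<open>D\<close> a number is determined by its quotient
  by \<open>D\<close>.\<close>

lemma card_congruent_le:
  fixes K :: "nat set" and Y :: real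
  assumes D: "D > 0" and K: "\<And>k. k \<in> K \<Longrightarrow> real k \<le> Y" and Y: "Y \<ge> 0"
    and cong: "\<And>k l. k \<in> K \<Longrightarrow> l \<in> K \<Longrightarrow> int D dvd int k - int l"
  shows "finite K" "real (card K) \<le> 1 + Y / real D"
proof -
  have le: "k \<le> nat \<lfloor>Y\<rfloor>" if "k \<in> K" for k using K[OF that] by (simp add: le_nat_floor)
  then have "K \<subseteq> {..nat \<lfloor>Y\<rfloor>}" by auto
  then show fin: "finite K" by (rule finite_subset) auto
  have "inj_on (\<lambda>k. k div D) K"
  proof (rule inj_onI)
    fix k l assume kl: "k \<in> K" "l \<in> K" "k div D = l div D"
    have "int k mod int D = int l mod int D" using cong[OF kl(1,2)] by (simp add: mod_eq_dvd_iff)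
    then have "k mod D = l mod D" by (metis of_nat_eq_iff zmod_int)
    then show "k = l" using kl(3) by (metis div_mult_mod_eq)
  qed
  moreover have "(\<lambda>k. k div D) ` K \<subseteq> {..nat \<lfloor>Y\<rfloor> div D}" using le by (auto intro: div_le_mono)
  ultimately have "card K \<le> card {..nat \<lfloor>Y\<rfloor> div D}" by (meson card_inj_on_le finite_atMost)
  then have "real (card K) \<le> 1 + real (nat \<lfloor>Y\<rfloor> div D)" by simp
  also have "real (nat \<lfloor>Y\<rfloor> div D) \<le> real (nat \<lfloor>Y\<rfloor>) / real D" by (rule of_nat_div_le_of_nat)
  also have "\<dots> \<le> Y / real D" using Y by (intro divide_right_mono) auto
  finally show "real (card K) \<le> 1 + Y / real D" by simp
qed

text \<open>Leaving out 0 removes the additive 1, so the count carries the full factor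
  \<open>1 / g\<close>; \<open>card_unitary_multiples_le\<close> needs all of it to offset a loss of
  \<open>g\<close> in its modulus.\<close>

lemma card_nonzero_multiples_le:
  fixes J :: real
  assumes g: "g > (0 :: nat)" and J: "J > 0"
  defines "S \<equiv> {j :: int. j \<noteq> 0 \<and> \<bar>real_of_int j\<bar> < J \<and> int g dvd j}"
  shows "finite S" "real (card S) \<le> 2 * J / real g"
proof -
  define n where "n = nat \<lfloor>J / real g\<rfloor>"
  have sub: "S \<subseteq> (\<lambda>i. int g * int i) ` {1..n} \<union> (\<lambda>i. - (int g * int i)) ` {1..n}"
  proof
    fix j assume j: "j \<in> S"
    then obtain i where i: "j = int g * i" unfolding S_def by auto
    have "i \<noteq> 0" using j i by (auto simp: S_def)
    have "real g * \<bar>real_of_int i\<bar> < J" using j i by (simp add: S_def abs_mult)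
    then have "real (nat \<bar>i\<bar>) \<le> J / real g" using g by (simp add: field_simps)
    then have "nat \<bar>i\<bar> \<in> {1..n}" using \<open>i \<noteq> 0\<close> by (auto simp: n_def le_nat_floor)
    moreover have "j = int g * int (nat \<bar>i\<bar>) \<or> j = - (int g * int (nat \<bar>i\<bar>))" using i by (cases "i \<ge> 0") auto
    ultimately show "j \<in> (\<lambda>i. int g * int i) ` {1..n} \<union> (\<lambda>i. - (int g * int i)) ` {1..n}" by blast
  qed
  then show "finite S" by (rule finite_subset) auto
  have "card S \<le> card ((\<lambda>i. int g * int i) ` {1..n} \<union> (\<lambda>i. - (int g * int i)) ` {1..n})"
    by (intro card_mono sub) auto
  also have "\<dots> \<le> card ((\<lambda>i. int g * int i) ` {1..n}) + card ((\<lambda>i. - (int g * int i)) ` {1..n})" by (rule card_Un_le)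
  also have "\<dots> \<le> n + n" by (intro add_mono order_trans[OF card_image_le]) auto
  finally have "real (card S) \<le> 2 * real n" by simp
  also have "real n \<le> J / real g" unfolding n_def using J by simp
  finally show "real (card S) \<le> 2 * J / real g" by simp
qed

text \<open>The greatest common divisor of m and its divisor sum divides the defect of every multiple with
  unitary divisor m; summing over the defects instead of fixing one makes its average size harmless.\<close>

lemma card_unitary_multiples_le:
  fixes a b m :: nat and x J :: real
  assumes m: "m > 0" and a: "a > 0" and x: "x \<ge> 0" and J: "J > 0"
  defines "T \<equiv> {n. unitary_divisor m n \<and> small_defect a b x J n}"
  shows "finite T" "real (card T) \<le> 2 * J * (1 + real a * x / (real m)\<^sup>2)"
proof -
  define s where "s = divisor_sigma m"
  define g where "g = gcd m s"
  define h where "h = gcd (a * m) s"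
  have s: "s \<ge> m" "s > 0" using divisor_sigma_ge[OF m] m by (auto simp: s_def)
  have gpos: "g > 0" using m by (simp add: g_def)
  have hpos: "h > 0" using s by (simp add: h_def)
  \<comment> \<open>So \<open>h <= a * g\<close>, and the modulus \<open>D = s / h\<close> is at
    least \<open>m / (a * g)\<close> because \<open>s >= m\<close>. The lost factor \<open>g\<close>
    returns from the number of admissible defects, all multiples of \<open>g\<close>.\<close>
  have "h dvd gcd (a * m) (a * s)" unfolding h_def by (auto intro: dvd_trans[OF gcd_dvd2])
  then have "h dvd a * g" by (simp add: g_def gcd_mult_distrib_nat)
  then have hle: "h \<le> a * g" using a gpos by (intro dvd_imp_le) auto
  define D where "D = s div h"
  have sD: "s = D * h" unfolding D_def h_def by simp
  have Dpos: "D > 0" using s sD by (cases D) auto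
  define Js where "Js = {j :: int. j \<noteq> 0 \<and> \<bar>real_of_int j\<bar> < J \<and> int g dvd j}"
  note Jscard = card_nonzero_multiples_le[OF gpos J, folded Js_def]
  define K where "K j = {k. real k \<le> x / real m \<and> int s dvd int (a * m) * int k + j}" for j
  have Kcard: "finite (K j)" "real (card (K j)) \<le> 1 + (x / real m) / real D" for j
  proof -
    have "int D dvd int k - int l" if kl: "k \<in> K j" "l \<in> K j" for k l
    proof -
      have "int s dvd (int (a * m) * int k + j) - (int (a * m) * int l + j)"
        using kl unfolding K_def by (intro dvd_diff) auto
      then have "int s dvd int (a * m) * (int k - int l)" by (simp add: algebra_simps)
      moreover obtain u where u: "a * m = u * h" "coprime u D"
      proof -
        have "a * m = ((a * m) div h) * h" unfolding h_def by simp
        moreover have "coprime ((a * m) div h) (s div h)" unfolding h_def using s by (intro div_gcd_coprime) auto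
        ultimately show ?thesis using that unfolding D_def by blast
      qed
      ultimately have "int h * int D dvd int h * (int u * (int k - int l))"
        unfolding sD by (simp add: algebra_simps)
      then have "int D dvd int u * (int k - int l)" using hpos by simp
      moreover have "coprime (int D) (int u)" using u(2) by (simp add: coprime_commute)
      ultimately show ?thesis by (simp add: coprime_dvd_mult_right_iff)
    qed
    then show "finite (K j)" "real (card (K j)) \<le> 1 + (x / real m) / real D"
      using card_congruent_le[OF Dpos, of "K j" "x / real m"] x by (auto simp: K_def)
  qed
  have sub: "T \<subseteq> (\<Union>j\<in>Js. (\<lambda>k. m * k) ` K j)"
  proof
    fix n assume n: "n \<in> T"
    then obtain k where k: "n = m * k" "coprime m k" unfolding T_def unitary_divisor_def by blast
    have kpos: "k > 0" using n k by (auto simp: T_def small_defect_def intro: Nat.gr0I)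
    have sn: "divisor_sigma n = s * divisor_sigma k"
      unfolding k(1) s_def by (rule divisor_sigma_mult_coprime[OF k(2) m kpos])
    define j where "j = sigma_defect a b n"
    have j: "j = int s * int (b * divisor_sigma k) - int (a * m) * int k"
      unfolding j_def sigma_defect_def sn by (simp add: k(1) algebra_simps)
    have "int g dvd int s" "int g dvd int (a * m)" by (auto simp: g_def)
    then have "int g dvd j" unfolding j by (intro dvd_diff dvd_mult2)
    then have "j \<in> Js" using n by (auto simp: T_def small_defect_def Js_def j_def)
    moreover have "k \<in> K j"
      using n m unfolding K_def T_def small_defect_def j k(1) by (auto simp: field_simps)
    ultimately show "n \<in> (\<Union>j\<in>Js. (\<lambda>k. m * k) ` K j)" using k(1) by blast
  qed
  have fin: "finite (\<Union>j\<in>Js. (\<lambda>k. m * k) ` K j)" using Jscard(1) Kcard(1) by auto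
  show "finite T" using sub fin by (rule finite_subset)
  have "real (card T) \<le> real (card (\<Union>j\<in>Js. (\<lambda>k. m * k) ` K j))" using fin sub by (intro of_nat_mono card_mono)
  also have "\<dots> \<le> (\<Sum>j\<in>Js. 1 + (x / real m) / real D)"
  proof (rule real_card_UN_le[OF Jscard(1)])
    fix j
    have "real (card ((\<lambda>k. m * k) ` K j)) \<le> real (card (K j))" by (intro of_nat_mono card_image_le Kcard)
    then show "real (card ((\<lambda>k. m * k) ` K j)) \<le> 1 + (x / real m) / real D" using Kcard(2)[of j] by linarith
  qed
  also have "\<dots> = real (card Js) * (1 + (x / real m) / real D)" by simp
  also have "\<dots> \<le> (2 * J / real g) * (1 + (x / real m) / real D)"
    using Jscard(2) x by (intro mult_right_mono) auto
  also have "\<dots> = 2 * J * (1 / real g + (x / real m) * (1 / (real g * real D)))"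
    using gpos by (simp add: field_simps)
  also have "\<dots> \<le> 2 * J * (1 + (x / real m) * (real a / real m))"
  proof (intro mult_left_mono add_mono)
    show "1 / real g \<le> 1" using gpos by simp
    have "real m \<le> real D * real h" using s(1) sD by (metis of_nat_le_iff of_nat_mult)
    also have "\<dots> \<le> real D * (real a * real g)" using hle by (intro mult_left_mono) (auto simp flip: of_nat_mult)
    finally show "1 / (real g * real D) \<le> real a / real m"
      using m gpos Dpos by (simp add: field_simps)
  qed (use x J in auto)
  also have "\<dots> = 2 * J * (1 + real a * x / (real m)\<^sup>2)" by (simp add: power2_eq_square)
  finally show "real (card T) \<le> 2 * J * (1 + real a * x / (real m)\<^sup>2)" .
qed

text \<open>For such \<open>n\<close> the defect is \<open>b * divisor_sigma m\<close>, whatever the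
  prime \<open>p\<close>: a single \<open>m\<close> yields a whole family indexed by primes, which
  fixing the defect cannot thin out.\<close>

definition regular_multiple :: "nat \<Rightarrow> nat \<Rightarrow> real \<Rightarrow> nat \<Rightarrow> bool" where
  "regular_multiple a b y n \<longleftrightarrow> (\<exists>p m. prime p \<and> y < real p \<and> \<not> p dvd m \<and> m > 0 \<and> n = p * m \<and>
    b * divisor_sigma m = a * m)"

lemma sum_inverse_squares_le:
  assumes "k \<ge> 1"
  shows "(\<Sum>m=Suc k..n. 1 / (real m)\<^sup>2) \<le> 1 / real k"
proof (cases "k \<le> n")
  case True
  then have "(\<Sum>m=Suc k..n. 1 / (real m)\<^sup>2) \<le> 1 / real k - 1 / real n"
  proof (induction n rule: dec_induct)
    case (step n)
    have "n > 0" using step assms by simp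
    have "1 / (real (Suc n))\<^sup>2 \<le> 1 / (real n * real (Suc n))"
      using \<open>n > 0\<close> unfolding power2_eq_square by (intro divide_left_mono mult_right_mono) auto
    also have "\<dots> = 1 / real n - 1 / real (Suc n)" using \<open>n > 0\<close> by (simp add: field_simps)
    finally show ?case using step by simp
  qed simp
  then show ?thesis by (smt (verit) divide_nonneg_nonneg of_nat_0_le_iff)
qed simp

text \<open>The base is at most \<open>sqrt x\<close> and the exponent at most
  \<open>log 2 x\<close>. The logarithm is absorbed into \<open>x powr (1/6)\<close>; the constant
  is 9 = 6 / (2/3), from \<open>ln x <= 6 * x powr (1/6)\<close> and
  \<open>ln 2 >= 2/3\<close>.\<close>

lemma card_proper_prime_powers_le:
  fixes x :: real
  assumes x: "x \<ge> 1"
  defines "Q \<equiv> {q. \<exists>p e. prime p \<and> e \<ge> (2 :: nat) \<and> q = p ^ e \<and> real q \<le> x}"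
  shows "finite Q" "real (card Q) \<le> 9 * x powr (2 / 3)"
proof -
  define A where "A = {1..nat \<lfloor>sqrt x\<rfloor>} \<times> {1..nat \<lfloor>log 2 x\<rfloor>}"
  have sub: "Q \<subseteq> (\<lambda>(p, e). p ^ e) ` A"
  proof
    fix q assume "q \<in> Q"
    then obtain p e where pe: "prime p" "e \<ge> 2" "q = p ^ e" "real q \<le> x" unfolding Q_def by blast
    have p2: "p \<ge> 2" using pe(1) by (rule prime_ge_2_nat)
    have "p ^ 2 \<le> q" unfolding pe(3) using pe(2) p2 by (intro power_increasing) auto
    then have "(real p)\<^sup>2 \<le> x" using pe(4) by (metis of_nat_le_iff of_nat_power order_trans)
    then have "real p \<le> sqrt x" by (rule real_le_rsqrt)
    moreover have "2 ^ e \<le> q" unfolding pe(3) using p2 by (intro power_mono) auto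
    then have "(2::real) ^ e \<le> x" using pe(4) by (metis of_nat_le_iff of_nat_numeral of_nat_power order_trans)
    then have "real e \<le> log 2 x" using x by (subst le_log_iff) (auto simp: powr_realpow)
    ultimately have "(p, e) \<in> A" using p2 pe(2) unfolding A_def by (auto simp: le_nat_floor)
    then show "q \<in> (\<lambda>(p, e). p ^ e) ` A" using pe(3) by force
  qed
  have finA: "finite A" unfolding A_def by auto
  show "finite Q" using finite_subset[OF sub] finA by blast
  have "card Q \<le> card ((\<lambda>(p, e). p ^ e) ` A)" using sub finA by (intro card_mono) auto
  also have "\<dots> \<le> card A" by (rule card_image_le[OF finA])
  finally have "real (card Q) \<le> real (nat \<lfloor>sqrt x\<rfloor>) * real (nat \<lfloor>log 2 x\<rfloor>)" by (simp add: A_def flip: of_nat_mult)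
  also have "\<dots> \<le> sqrt x * log 2 x" using x by (intro mult_mono) auto
  also have "\<dots> \<le> x powr (1 / 2) * (9 * x powr (1 / 6))"
  proof (intro mult_mono)
    have l2: "ln 2 \<ge> (2 / 3 :: real)" using ln2_ge_two_thirds by simp
    have "ln x \<le> 6 * x powr (1 / 6)" using ln_powr_bound[of x "1/6"] x by simp
    also have "\<dots> \<le> (9 * x powr (1 / 6)) * ln 2" using mult_left_mono[OF l2, of "9 * x powr (1/6)"] by simp
    finally show "log 2 x \<le> 9 * x powr (1 / 6)" by (simp add: log_def divide_le_eq)
  qed (use x in \<open>auto simp: powr_half_sqrt\<close>)
  also have "\<dots> = 9 * x powr (1 / 2 + 1 / 6)" by (simp only: powr_add mult_ac)
  also have "(1 / 2 + 1 / 6 :: real) = 2 / 3" by simp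
  finally show "real (card Q) \<le> 9 * x powr (2 / 3)" .
qed

text \<open>For fixed \<open>m\<close> the defect of \<open>p * m\<close> is affine in
  \<open>p\<close> with slope \<open>b * divisor_sigma m - a * m\<close>, here nonzero. The cofactor
  and the defect thus identify \<open>n\<close>, and the cofactor is at most
  \<open>x powr (1/3)\<close>.\<close>

lemma card_prime_cofactor_le:
  fixes a b :: nat and x J :: real
  assumes x: "x \<ge> 1" and b: "b > 0" and J: "J > 0"
  defines "E \<equiv> {n. small_defect a b x J n \<and> (\<exists>p m. prime p \<and> x powr (2/3) < real p \<and> \<not> p dvd m \<and> m > 0 \<and> n = p * m \<and> b * divisor_sigma m \<noteq> a * m)}"
  shows "finite E" "real (card E) \<le> 2 * J * x powr (1 / 3)"
proof -
  \<comment> \<open>The vacuous condition \<open>int 1 dvd j\<close> brings the set into the shape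
    of \<open>card_nonzero_multiples_le\<close> with \<open>g = 1\<close>.\<close>
  define Js where "Js = {j :: int. j \<noteq> 0 \<and> \<bar>real_of_int j\<bar> < J \<and> int 1 dvd j}"
  have Js: "finite Js" "real (card Js) \<le> 2 * J"
    using card_nonzero_multiples_le[of 1 J] J by (auto simp: Js_def)
  define M where "M = {1..nat \<lfloor>x powr (1/3)\<rfloor>}"
  have cM: "real (card M) \<le> x powr (1/3)" unfolding M_def by simp
  have sigma: "sigma_defect a b (p * m) = int p * (int (b * divisor_sigma m) - int (a * m)) + int (b * divisor_sigma m)"
    if "prime p" "\<not> p dvd m" "m > 0" for p m
  proof -
    have "coprime p m" using that by (simp add: prime_imp_coprime)
    then have "divisor_sigma (p * m) = (p + 1) * divisor_sigma m"
      using divisor_sigma_mult_coprime[of p m] that divisor_sigma_prime[of p] prime_gt_0_nat[of p] by simp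
    then show ?thesis unfolding sigma_defect_def by (simp add: algebra_simps)
  qed
  define g where "g n m p \<longleftrightarrow> prime p \<and> x powr (2/3) < real p \<and> \<not> p dvd m \<and> m > 0 \<and> n = p * m \<and> b * divisor_sigma m \<noteq> a * m" for n m p
  \<comment> \<open>Choosing some admissible cofactor avoids having to show that it is
    unique.\<close>
  define f where "f n = (SOME m. \<exists>p. g n m p)" for n
  have f: "\<exists>p. g n (f n) p" if "n \<in> E" for n
  proof -
    have "\<exists>m p. g n m p" using that unfolding E_def g_def by blast
    then show ?thesis unfolding f_def by (rule someI_ex)
  qed
  have inj: "inj_on (\<lambda>n. (f n, sigma_defect a b n)) E"
  proof (rule inj_onI)
    fix n n' assume n: "n \<in> E" "n' \<in> E" "(f n, sigma_defect a b n) = (f n', sigma_defect a b n')"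
    obtain p where p: "prime p" "\<not> p dvd f n" "f n > 0" "n = p * f n" "b * divisor_sigma (f n) \<noteq> a * f n" using f[OF n(1)] unfolding g_def by blast
    have fn: "f n' = f n" using n(3) by simp
    obtain p' where p': "prime p'" "\<not> p' dvd f n" "n' = p' * f n" using f[OF n(2)] unfolding fn g_def by blast
    have "sigma_defect a b (p * f n) = sigma_defect a b (p' * f n)" using n(3) unfolding p(4)[symmetric] p'(3)[symmetric] by simp
    then have "int p * (int (b * divisor_sigma (f n)) - int (a * f n)) = int p' * (int (b * divisor_sigma (f n)) - int (a * f n))"
      unfolding sigma[OF p(1,2,3)] sigma[OF p'(1,2) p(3)] by simp
    moreover have "int (b * divisor_sigma (f n)) - int (a * f n) \<noteq> 0" using p(5) by (simp flip: of_nat_mult)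
    ultimately have "p = p'" by simp
    then show "n = n'" using p(4) p'(3) by metis
  qed
  have im: "(\<lambda>n. (f n, sigma_defect a b n)) ` E \<subseteq> M \<times> Js"
  proof
    fix y assume "y \<in> (\<lambda>n. (f n, sigma_defect a b n)) ` E"
    then obtain n where n: "n \<in> E" "y = (f n, sigma_defect a b n)" by blast
    obtain p where p: "x powr (2/3) < real p" "f n > 0" "n = p * f n" using f[OF n(1)] unfolding g_def by blast
    have "x powr (2/3) * real (f n) \<le> real p * real (f n)" using p(1) by (intro mult_right_mono) auto
    also have "\<dots> = real n" using p(3) by (metis of_nat_mult)
    also have "\<dots> \<le> x" using n(1) by (simp add: E_def small_defect_def)
    also have "x = x powr (2/3) * x powr (1/3)" using x by (simp flip: powr_add)
    finally have "real (f n) \<le> x powr (1/3)" using x by simp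
    then have "f n \<in> M" using p(2) unfolding M_def by (auto simp: le_nat_floor)
    then show "y \<in> M \<times> Js" using n by (auto simp: Js_def E_def small_defect_def)
  qed
  have fin: "finite (M \<times> Js)" using Js by (auto simp: M_def)
  show "finite E" using inj_on_finite[OF inj im fin] .
  have "card E \<le> card (M \<times> Js)" using card_inj_on_le[OF inj im fin] .
  then have "real (card E) \<le> real (card M) * real (card Js)" by (simp add: card_cartesian_product flip: of_nat_mult)
  also have "\<dots> \<le> x powr (1/3) * (2 * J)" using cM Js(2) by (intro mult_mono) auto
  finally show "real (card E) \<le> 2 * J * x powr (1 / 3)" by (simp add: mult_ac)
qed

text \<open>With \<open>z = x powr (1/3)\<close> each class is of order at most \<open>z^2\<close>,
  up to factors \<open>a\<close> and \<open>J\<close>: numbers up to \<open>z\<close>, multiples of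
  a unitary divisor in the middle range, multiples of a large proper prime power, and large primes
  times a cofactor that is not an exact solution.\<close>

lemma card_sporadic_le:
  fixes a b :: nat and x J :: real
  assumes x: "x \<ge> 1" and a: "a > 0" and b: "b > 0" and J: "J \<ge> 1"
  defines "N \<equiv> {n. small_defect a b x J n \<and> \<not> regular_multiple a b (x powr (2/3)) n}"
  shows "finite N" "real (card N) \<le> 45 * real a * J * x powr (2 / 3)"
proof -
  define z where "z = x powr (1 / 3)"
  have z: "z \<ge> 1" using x by (simp add: z_def ge_one_powr_ge_zero)
  have z2: "z\<^sup>2 = x powr (2 / 3)" using x by (simp add: z_def powr_power)
  have z3: "z\<^sup>2 * z = x" unfolding z2 using x by (simp add: z_def flip: powr_add)
  define T where "T m = {n. unitary_divisor m n \<and> small_defect a b x J n}" for m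
  have T: "finite (T m)" "real (card (T m)) \<le> 2 * J * (1 + real a * x / (real m)\<^sup>2)" if "m > 0" for m
    using card_unitary_multiples_le[OF that a, of x J b] x J by (simp_all add: T_def)
  define M1 where "M1 = {Suc (nat \<lfloor>z\<rfloor>)..nat \<lfloor>z\<^sup>2\<rfloor>}"
  define Q where "Q = {q. \<exists>p e. prime p \<and> e \<ge> (2 :: nat) \<and> q = p ^ e \<and> real q \<le> x}"
  note Qc = card_proper_prime_powers_le[OF x, folded Q_def]
  define M2 where "M2 = {q \<in> Q. z\<^sup>2 < real q}"
  define E where "E = {n. small_defect a b x J n \<and> (\<exists>p m. prime p \<and> x powr (2/3) < real p \<and> \<not> p dvd m \<and> m > 0 \<and> n = p * m \<and> b * divisor_sigma m \<noteq> a * m)}"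
  have E: "finite E" "real (card E) \<le> 2 * J * x powr (1 / 3)"
    using card_prime_cofactor_le[OF x b, of J a] J by (simp_all add: E_def)
  have sub: "N \<subseteq> {1..nat \<lfloor>z\<rfloor>} \<union> (\<Union>m\<in>M1. T m) \<union> (\<Union>q\<in>M2. T q) \<union> E"
  proof
    fix n assume n: "n \<in> N"
    show "n \<in> {1..nat \<lfloor>z\<rfloor>} \<union> (\<Union>m\<in>M1. T m) \<union> (\<Union>q\<in>M2. T q) \<union> E"
    proof (cases "real n \<le> z")
      case True
      then show ?thesis using n by (auto simp: N_def small_defect_def le_nat_floor)
    next
      case False
      then consider d where "unitary_divisor d n" "z < real d" "real d \<le> z\<^sup>2"
        | p e where "prime p" "e \<ge> 1" "unitary_divisor (p ^ e) n" "z\<^sup>2 < real (p ^ e)"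
        using unitary_divisor_between[OF z, of n] by (metis not_le)
      then show ?thesis
      proof cases
        case (1 d)
        have "d \<in> M1" using 1 z unfolding M1_def by (auto simp: le_nat_floor nat_less_iff Suc_le_eq floor_less_iff)
        moreover have "n \<in> T d" using n 1 by (simp add: T_def small_defect_def N_def)
        ultimately show ?thesis by blast
      next
        case (2 p e)
        obtain k where k: "n = p ^ e * k" "coprime (p ^ e) k" using 2 unfolding unitary_divisor_def by blast
        have kpos: "k > 0" using n k by (auto simp: N_def small_defect_def intro: Nat.gr0I)
        show ?thesis
        proof (cases "e = 1")
          case True
          have "\<not> p dvd k" using k(2) True 2(1) by (metis coprime_absorb_left not_prime_unit power_one_right)
          have pk: "x powr (2/3) < real p" "n = p * k" using 2(4) k(1) True by (simp_all add: z2)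
          have "b * divisor_sigma k \<noteq> a * k"
          proof
            assume "b * divisor_sigma k = a * k"
            then have "regular_multiple a b (x powr (2/3)) n"
              unfolding regular_multiple_def using 2(1) pk kpos \<open>\<not> p dvd k\<close> by blast
            then show False using n by (simp add: N_def small_defect_def)
          qed
          then have "\<exists>p m. prime p \<and> x powr (2/3) < real p \<and> \<not> p dvd m \<and> m > 0 \<and> n = p * m \<and> b * divisor_sigma m \<noteq> a * m"
            using 2(1) pk kpos \<open>\<not> p dvd k\<close> by blast
          then have "n \<in> E" using n unfolding N_def E_def by blast
          then show ?thesis by blast
        next
          case False
          have "p ^ e \<le> n" using k kpos by simp
          then have "real (p ^ e) \<le> real n" by (rule of_nat_mono)
          moreover have "real n \<le> x" using n by (simp add: N_def small_defect_def)
          ultimately have "real (p ^ e) \<le> x" by (rule order_trans)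
          moreover have "e \<ge> 2" using 2(2) False by simp
          ultimately have "p ^ e \<in> Q" using 2(1) unfolding Q_def by blast
          then have "p ^ e \<in> M2" using 2(4) unfolding M2_def by blast
          moreover have "n \<in> T (p ^ e)" using n 2 by (simp add: T_def small_defect_def N_def)
          ultimately show ?thesis by blast
        qed
      qed
    qed
  qed
  have M1: "m > 0" if "m \<in> M1" for m using that by (auto simp: M1_def)
  have M2: "q > 0" if "q \<in> M2" for q using that z by (auto simp: M2_def intro: Nat.gr0I)
  have fM: "finite M1" "finite M2" using Qc by (auto simp: M1_def M2_def)
  have finU: "finite ({1..nat \<lfloor>z\<rfloor>} \<union> (\<Union>m\<in>M1. T m) \<union> (\<Union>q\<in>M2. T q) \<union> E)"
    using fM T(1) M1 M2 E(1) by auto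
  show "finite N" using sub finU by (rule finite_subset)
  have c0: "real (card {1..nat \<lfloor>z\<rfloor>}) \<le> z" using z by simp
  have "real (card (\<Union>m\<in>M1. T m)) \<le> (\<Sum>m\<in>M1. 2 * J * (1 + real a * x / (real m)\<^sup>2))"
    using M1 by (intro real_card_UN_le fM T) auto
  also have "\<dots> = 2 * J * (real (card M1) + real a * x * (\<Sum>m\<in>M1. 1 / (real m)\<^sup>2))"
    by (simp add: sum_distrib_left[symmetric] sum.distrib) (simp add: sum_distrib_left)
  also have "\<dots> \<le> 2 * J * (z\<^sup>2 + real a * x * (2 / z))"
  proof (intro mult_left_mono add_mono)
    have "card M1 \<le> nat \<lfloor>z\<^sup>2\<rfloor>" unfolding M1_def by simp
    then have "real (card M1) \<le> real (nat \<lfloor>z\<^sup>2\<rfloor>)" by (rule of_nat_mono)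
    then show "real (card M1) \<le> z\<^sup>2" using z by (smt (verit) of_nat_floor zero_le_power2)
    define k where "k = nat \<lfloor>z\<rfloor>"
    have k: "k \<ge> 1" "z < real k + 1" using z unfolding k_def by (auto simp: le_nat_iff)
    have "(\<Sum>m\<in>M1. 1 / (real m)\<^sup>2) \<le> 1 / real k"
      unfolding M1_def k_def[symmetric] by (rule sum_inverse_squares_le[OF k(1)])
    also have "\<dots> \<le> 2 / z"
    proof -
      \<comment> \<open>Replacing \<open>z\<close> by its floor \<open>k\<close> costs at most a
        factor 2, as \<open>z < k + 1 <= 2 * k\<close>.\<close>
      have "real k \<ge> 1" using k(1) by simp
      then have "z \<le> 2 * real k" "0 < real k" using k(2) by linarith+
      then show ?thesis using z by (simp add: divide_simps)
    qed
    finally show "(\<Sum>m\<in>M1. 1 / (real m)\<^sup>2) \<le> 2 / z" .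
  qed (use x J a in auto)
  also have "\<dots> = 2 * J * (z\<^sup>2 + real a * (2 * z\<^sup>2))"
  proof -
    have "x * (2 / z) = 2 * z\<^sup>2" unfolding z3[symmetric] using z by simp
    then show ?thesis by (simp only: mult.assoc)
  qed
  finally have c1: "real (card (\<Union>m\<in>M1. T m)) \<le> 2 * J * (z\<^sup>2 + real a * (2 * z\<^sup>2))" .
  have "real (card (\<Union>m\<in>M2. T m)) \<le> (\<Sum>m\<in>M2. 2 * J * (1 + real a))"
  proof (rule real_card_UN_le[OF fM(2)])
    fix q assume q: "q \<in> M2"
    \<comment> \<open>A prime power above \<open>z^2\<close> has a square above
      \<open>z^4 >= x\<close>, so each of them carries only \<open>O(a * J)\<close> numbers and
      merely their quantity matters.\<close>
    have "x \<le> z\<^sup>2 * z\<^sup>2" using z3 z mult_left_mono[of z "z\<^sup>2" "z\<^sup>2"] by (simp add: power2_eq_square)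
    also have "\<dots> \<le> (real q)\<^sup>2" using q z unfolding power2_eq_square[of "real q"] by (intro mult_mono) (auto simp: M2_def)
    finally have "x / (real q)\<^sup>2 \<le> 1" using M2[OF q] by simp
    then have "real a * (x / (real q)\<^sup>2) \<le> real a * 1" by (intro mult_left_mono) auto
    then have "2 * J * (1 + real a * x / (real q)\<^sup>2) \<le> 2 * J * (1 + real a)" using J by (intro mult_left_mono) auto
    then show "real (card (T q)) \<le> 2 * J * (1 + real a)" using T(2)[OF M2[OF q]] by linarith
  qed
  also have "\<dots> = real (card M2) * (2 * J * (1 + real a))" by simp
  also have "\<dots> \<le> (9 * z\<^sup>2) * (2 * J * (1 + real a))"
  proof (rule mult_right_mono)
    have "card M2 \<le> card Q" unfolding M2_def using Qc(1) by (intro card_mono) auto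
    then show "real (card M2) \<le> 9 * z\<^sup>2" using Qc(2) unfolding z2 by linarith
  qed (use J in auto)
  finally have c2: "real (card (\<Union>m\<in>M2. T m)) \<le> (9 * z\<^sup>2) * (2 * J * (1 + real a))" .
  have "card N \<le> card ({1..nat \<lfloor>z\<rfloor>} \<union> (\<Union>m\<in>M1. T m) \<union> (\<Union>q\<in>M2. T q) \<union> E)"
    using finU sub by (rule card_mono)
  also have "\<dots> \<le> card {1..nat \<lfloor>z\<rfloor>} + card (\<Union>m\<in>M1. T m) + card (\<Union>q\<in>M2. T q) + card E"
    by (intro order_trans[OF card_Un_le] add_mono order_refl)
  finally have "real (card N) \<le> real (card {1..nat \<lfloor>z\<rfloor>}) + real (card (\<Union>m\<in>M1. T m))
    + real (card (\<Union>q\<in>M2. T q)) + real (card E)" by (simp flip: of_nat_add)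
  also have "\<dots> \<le> z + 2 * J * (z\<^sup>2 + real a * (2 * z\<^sup>2)) + (9 * z\<^sup>2) * (2 * J * (1 + real a)) + 2 * J * z"
    using c0 c1 c2 E(2) unfolding z_def[symmetric] by (intro add_mono)
  \<comment> \<open>Each summand is bounded by a multiple of \<open>a * J * z^2\<close>; multiplied
    out, the coefficients are 1 + 2 + 4 + 18 + 18 + 2 = 45.\<close>
  also have "\<dots> \<le> 45 * (real a * J * z\<^sup>2)"
  proof -
    have zz: "z \<le> z\<^sup>2" using z by (simp add: power2_eq_square)
    have a1: "real a \<ge> 1" using a by simp
    have "J * z\<^sup>2 \<le> real a * (J * z\<^sup>2)" using mult_right_mono[OF a1, of "J * z\<^sup>2"] J by simp
    moreover have "J * z \<le> J * z\<^sup>2" using zz J by (intro mult_left_mono) auto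
    moreover have "z \<le> J * z" using J z mult_right_mono[of 1 J z] by simp
    ultimately show ?thesis by (simp add: algebra_simps)
  qed
  finally show "real (card N) \<le> 45 * real a * J * x powr (2 / 3)" unfolding z2 by (simp add: mult_ac)
qed

section \<open>Solutions of the exact equation\<close>

definition abundancy_solutions :: "nat \<Rightarrow> nat \<Rightarrow> nat set" where
  "abundancy_solutions a b = {m. m > 0 \<and> b * divisor_sigma m = a * m}"

text \<open>\<open>K\<close> arises as the number of distinct primes of \<open>n\<close>: each exact
  prime power contributes a factor at most \<open>y\<close> to \<open>n\<close>, and it at least
  doubles the divisors, since \<open>d\<close> and \<open>p ^ e * d\<close> are both
  available.\<close>

lemma prime_powers_small_imp_many_divisors:
  fixes y :: real
  assumes y: "y \<ge> 1" and n: "n > 0"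
    and small: "\<And>p e. prime p \<Longrightarrow> e \<ge> 1 \<Longrightarrow> unitary_divisor (p ^ e) n \<Longrightarrow> real (p ^ e) \<le> y"
  shows "\<exists>K. real n \<le> y ^ K \<and> 2 ^ K \<le> card {d. d dvd n}"
  using n small
proof (induction n rule: less_induct)
  case (less n)
  show ?case
  proof (cases "n > 1")
    case False
    then have "n = 1" using less.prems by simp
    then show ?thesis by (intro exI[of _ 0]) auto
  next
    case True
    then obtain p e m where pem: "prime p" "e \<ge> 1" "n = p ^ e * m" "coprime (p ^ e) m" "0 < m" "m < n"
      by (rule exact_prime_power_split)
    have "unitary_divisor (p ^ e) n" unfolding unitary_divisor_def using pem by blast
    then have qy: "real (p ^ e) \<le> y" using less.prems(2) pem by blast
    have "real (p' ^ e') \<le> y" if "prime p'" "e' \<ge> 1" "unitary_divisor (p' ^ e') m" for p' e'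
      using less.prems(2)[OF that(1,2)] unitary_divisor_mult[OF that(3) pem(4)] pem(3) by simp
    then obtain K where K: "real m \<le> y ^ K" "2 ^ K \<le> card {d. d dvd m}"
      using less.IH[OF pem(6,5)] by blast
    have "real n = real (p ^ e) * real m" using pem(3) by (metis of_nat_mult)
    also have "\<dots> \<le> y * y ^ K" using qy K(1) y by (intro mult_mono) auto
    finally have 1: "real n \<le> y ^ Suc K" by simp
    have fin: "finite {d. d dvd m}" "finite {d. d dvd n}" using pem(5) less.prems(1) by simp_all
    have q0: "p ^ e > 0" using pem(1) prime_gt_0_nat by simp
    have inj: "inj_on (\<lambda>d. p ^ e * d) {d. d dvd m}" using q0 by (auto intro: inj_onI)
    have disj: "{d. d dvd m} \<inter> (\<lambda>d. p ^ e * d) ` {d. d dvd m} = {}"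
    proof (rule ccontr)
      assume "\<not> ?thesis"
      then obtain d where d: "p ^ e * d dvd m" by blast
      then have "p ^ e dvd m" by (rule dvd_mult_left)
      then have "is_unit (p ^ e)" using pem(4) by (metis coprime_absorb_left)
      then show False using pem(1,2) prime_gt_1_nat[OF pem(1)] by (simp add: is_unit_power_iff)
    qed
    have sub: "{d. d dvd m} \<union> (\<lambda>d. p ^ e * d) ` {d. d dvd m} \<subseteq> {d. d dvd n}" using pem(3) by auto
    have "2 * card {d. d dvd m} = card {d. d dvd m} + card ((\<lambda>d. p ^ e * d) ` {d. d dvd m})"
      by (simp add: card_image[OF inj])
    also have "\<dots> = card ({d. d dvd m} \<union> (\<lambda>d. p ^ e * d) ` {d. d dvd m})"
      using fin(1) disj by (intro card_Un_disjoint[symmetric]) auto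
    also have "\<dots> \<le> card {d. d dvd n}" using fin(2) sub by (rule card_mono)
    finally have "2 ^ Suc K \<le> card {d. d dvd n}" using K(2) by simp
    then show ?thesis using 1 by blast
  qed
qed

text \<open>Comparing the two equations eliminates \<open>m\<close> and gives
  \<open>q * sigma q' = q' * sigma q\<close> for the prime powers \<open>q\<close> and
  \<open>q'\<close>. Both fractions \<open>q / sigma q\<close> and \<open>q' / sigma q'\<close> are
  in lowest terms, so each of \<open>q\<close> and \<open>q'\<close> divides the other.\<close>

lemma abundancy_solution_determined:
  assumes "m > 0" "a > 0" "prime p" "prime p'" "coprime (p ^ e) m" "coprime (p' ^ e') m"
    and "p ^ e * m \<in> abundancy_solutions a b" "p' ^ e' * m \<in> abundancy_solutions a b"
  shows "p ^ e = p' ^ e'"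
proof -
  let ?q = "p ^ e" and ?q' = "p' ^ e'"
  have q0: "?q > 0" "?q' > 0" using assms prime_gt_0_nat by auto
  have 1: "b * (divisor_sigma ?q * divisor_sigma m) = a * (?q * m)"
    using assms(7) divisor_sigma_mult_coprime[OF assms(5) q0(1) assms(1)] by (simp add: abundancy_solutions_def)
  have 2: "b * (divisor_sigma ?q' * divisor_sigma m) = a * (?q' * m)"
    using assms(8) divisor_sigma_mult_coprime[OF assms(6) q0(2) assms(1)] by (simp add: abundancy_solutions_def)
  have "(a * m) * (?q * divisor_sigma ?q') = (b * (divisor_sigma ?q * divisor_sigma m)) * divisor_sigma ?q'"
    unfolding 1 by (simp only: mult_ac)
  also have "\<dots> = (b * (divisor_sigma ?q' * divisor_sigma m)) * divisor_sigma ?q" by (simp only: mult_ac)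
  also have "\<dots> = (a * m) * (?q' * divisor_sigma ?q)" unfolding 2 by (simp only: mult_ac)
  finally have eq: "?q * divisor_sigma ?q' = ?q' * divisor_sigma ?q" using assms(1,2) by simp
  have c: "coprime ?q (divisor_sigma ?q)" "coprime ?q' (divisor_sigma ?q')"
    using coprime_divisor_sigma_prime_power assms(3,4) by auto
  have "?q dvd ?q'" using c(1) eq by (metis coprime_dvd_mult_left_iff dvd_triv_left)
  moreover have "?q' dvd ?q" using c(2) eq by (metis coprime_dvd_mult_left_iff dvd_triv_left)
  ultimately show ?thesis by (rule dvd_antisym)
qed

text \<open>Removing one exact prime power above \<open>y\<close> leaves a cofactor at most
  \<open>x / y\<close>, and by \<open>abundancy_solution_determined\<close> this map is
  injective.\<close>

lemma card_abundancy_solutions_large_prime_power: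
  fixes x y :: real and a b :: nat
  assumes a: "a > 0" and x: "x \<ge> 0" and y: "y > 0"
  defines "A \<equiv> {n \<in> abundancy_solutions a b. real n \<le> x \<and>
    (\<exists>p e. prime p \<and> e \<ge> 1 \<and> unitary_divisor (p ^ e) n \<and> y < real (p ^ e))}"
  shows "finite A" "real (card A) \<le> x / y"
proof -
  define R where "R n m \<longleftrightarrow> m > 0 \<and> (\<exists>p e. prime p \<and> y < real (p ^ e) \<and> coprime (p ^ e) m \<and> n = p ^ e * m)" for n m
  define f where "f n = (SOME m. R n m)" for n
  have f: "R n (f n)" if n: "n \<in> A" for n
  proof -
    obtain p e where pe: "prime p" "unitary_divisor (p ^ e) n" "y < real (p ^ e)" using n unfolding A_def by blast
    then obtain k where "n = p ^ e * k" "coprime (p ^ e) k" unfolding unitary_divisor_def by blast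
    moreover have "n > 0" using n by (simp add: A_def abundancy_solutions_def)
    ultimately have "R n k" unfolding R_def using pe by (auto intro: Nat.gr0I)
    then show ?thesis unfolding f_def by (rule someI)
  qed
  have inj: "inj_on f A"
  proof (rule inj_onI)
    fix n n' assume n: "n \<in> A" "n' \<in> A" "f n = f n'"
    obtain p e where p: "f n > 0" "prime p" "coprime (p ^ e) (f n)" "n = p ^ e * f n"
      using f[OF n(1)] unfolding R_def by blast
    obtain p' e' where p': "prime p'" "coprime (p' ^ e') (f n)" "n' = p' ^ e' * f n"
      using f[OF n(2)] unfolding n(3)[symmetric] R_def by blast
    have "p ^ e * f n \<in> abundancy_solutions a b" "p' ^ e' * f n \<in> abundancy_solutions a b"
      using n(1,2) unfolding p(4)[symmetric] p'(3)[symmetric] by (auto simp: A_def)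
    then have "p ^ e = p' ^ e'"
      by (rule abundancy_solution_determined[OF p(1) a p(2) p'(1) p(3) p'(2)])
    then show "n = n'" using p(4) p'(3) by metis
  qed
  have im: "f ` A \<subseteq> {1..nat \<lfloor>x / y\<rfloor>}"
  proof
    fix m assume "m \<in> f ` A"
    then obtain n where n: "n \<in> A" "m = f n" by blast
    obtain p e where p: "f n > 0" "y < real (p ^ e)" "n = p ^ e * f n"
      using f[OF n(1)] unfolding R_def by blast
    have "y * real (f n) \<le> real (p ^ e) * real (f n)" using p(2) by (intro mult_right_mono) auto
    also have "\<dots> = real n" using p(3) by (metis of_nat_mult)
    also have "\<dots> \<le> x" using n(1) by (simp add: A_def)
    finally have "real (f n) \<le> x / y" using y by (simp add: field_simps)
    then show "m \<in> {1..nat \<lfloor>x / y\<rfloor>}" using n(2) p(1) by (auto simp: le_nat_floor)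
  qed
  show "finite A" by (rule inj_on_finite[OF inj im]) simp
  have "card A \<le> card {1..nat \<lfloor>x / y\<rfloor>}" by (rule card_inj_on_le[OF inj im]) simp
  then have "real (card A) \<le> real (nat \<lfloor>x / y\<rfloor>)" by simp
  also have "\<dots> \<le> x / y" using x y by (intro of_nat_floor) auto
  finally show "real (card A) \<le> x / y" .
qed

section \<open>Numbers with many divisors, and the count of exact solutions\<close>

lemma sum_card_divisors_le:
  fixes x :: real
  assumes x: "x \<ge> 1"
  shows "(\<Sum>n=1..nat \<lfloor>x\<rfloor>. real (card {d. d dvd n})) \<le> x * (1 + ln x)"
proof -
  define N where "N = nat \<lfloor>x\<rfloor>"
  have N: "N \<ge> 1" "real N \<le> x" using x unfolding N_def by (auto simp: le_nat_iff)
  have "(\<Sum>n=1..N. real (card {d. d dvd n})) = (\<Sum>n=1..N. \<Sum>d | d \<in> {1..N} \<and> d dvd n. 1)"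
  proof (rule sum.cong[OF refl])
    fix n assume n: "n \<in> {1..N}"
    then have "{d. d dvd n} = {d. d \<in> {1..N} \<and> d dvd n}"
      by (auto dest: dvd_imp_le intro: Suc_leI Nat.gr0I)
    then show "real (card {d. d dvd n}) = (\<Sum>d | d \<in> {1..N} \<and> d dvd n. 1)" by simp
  qed
  also have "\<dots> = (\<Sum>d=1..N. \<Sum>n | n \<in> {1..N} \<and> d dvd n. 1)"
    by (rule sum.swap_restrict) auto
  also have "\<dots> = (\<Sum>d=1..N. real (N div d))"
    using card_multiples by (intro sum.cong) auto
  also have "\<dots> \<le> (\<Sum>d=1..N. real N * (1 / real d))"
    by (intro sum_mono) (use of_nat_div_le_of_nat in force)
  also have "\<dots> = real N * harm N" unfolding harm_def sum_distrib_left by (simp add: inverse_eq_divide)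
  also have "\<dots> \<le> x * (1 + ln x)"
  proof (intro mult_mono)
    have "harm N \<le> 1 + ln (real N)"
      using euler_mascheroni_sequence_decreasing[of 1 N] N by (simp add: harm_def)
    also have "\<dots> \<le> 1 + ln x" using N by simp
    finally show "harm N \<le> 1 + ln x" .
  qed (use N x in \<open>auto intro: harm_nonneg\<close>)
  finally show ?thesis unfolding N_def .
qed

text \<open>Markov's inequality for the number of divisors, whose mean up to \<open>x\<close> is at
  most \<open>1 + ln x\<close>.\<close>

lemma card_many_divisors_le:
  fixes x T :: real
  assumes x: "x \<ge> 1" and T: "T > 0"
  shows "real (card {n. n > 0 \<and> real n \<le> x \<and> T \<le> real (card {d. d dvd n})}) \<le> x * (1 + ln x) / T"
proof -
  define B where "B = {n. n > 0 \<and> real n \<le> x \<and> T \<le> real (card {d. d dvd n})}"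
  have sub: "B \<subseteq> {1..nat \<lfloor>x\<rfloor>}" by (auto simp: B_def le_nat_floor)
  have "real (card B) * T = (\<Sum>n\<in>B. T)" by simp
  also have "\<dots> \<le> (\<Sum>n\<in>B. real (card {d. d dvd n}))" by (intro sum_mono) (auto simp: B_def)
  also have "\<dots> \<le> (\<Sum>n=1..nat \<lfloor>x\<rfloor>. real (card {d. d dvd n}))" using sub by (intro sum_mono2) auto
  also have "\<dots> \<le> x * (1 + ln x)" by (rule sum_card_divisors_le[OF x])
  finally show ?thesis using T unfolding B_def by (simp add: field_simps)
qed

text \<open>With \<open>L = ln x\<close>, either \<open>m\<close> has an exact prime power divisor above \<open>L\<^sup>2\<close>, or \<open>m \<le> x / L\<^sup>2\<close>, or \<open>m\<close> has so
  many prime factors that its number of divisors exceeds \<open>L ^ 4\<close>.\<close>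

lemma abundancy_solutions_count:
  assumes a: "a > 0"
  shows "\<forall>\<^sub>F x in at_top. real (card {m \<in> abundancy_solutions a b. real m \<le> x}) \<le> 4 * x / (ln x)\<^sup>2"
proof -
  \<comment> \<open>With \<open>L = ln x\<close>: if \<open>x / L^2 < n <= (L^2) ^ K\<close>, then
    \<open>K\<close> is at least \<open>(L - 2 * ln L) / (2 * ln L)\<close>. The inequality says
    that this already makes \<open>2 ^ K\<close> at least \<open>L ^ 4\<close>.\<close>
  have "\<forall>\<^sub>F x::real in at_top. 4 * ln (ln x) \<le> ln 2 * ((ln x - 2 * ln (ln x)) / (2 * ln (ln x)))"
    by real_asymp
  moreover have "\<forall>\<^sub>F x::real in at_top. x * (1 + ln x) / (ln x) ^ 4 \<le> x / (ln x)\<^sup>2" by real_asymp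
  moreover have "\<forall>\<^sub>F x::real in at_top. ln x > 2" by real_asymp
  moreover have "\<forall>\<^sub>F x::real in at_top. x \<ge> 1" by (rule eventually_ge_at_top)
  ultimately show ?thesis
  proof eventually_elim
    fix x :: real
    assume h: "4 * ln (ln x) \<le> ln 2 * ((ln x - 2 * ln (ln x)) / (2 * ln (ln x)))"
      "x * (1 + ln x) / (ln x) ^ 4 \<le> x / (ln x)\<^sup>2" "ln x > 2" "x \<ge> 1"
    define L where "L = ln x"
    have L: "L > 2" "x \<ge> 1" "x > 0" using h(3,4) by (auto simp: L_def)
    have lnL: "ln L > 0" using L by simp
    let ?S = "{m \<in> abundancy_solutions a b. real m \<le> x}"
    define A where "A = {n \<in> abundancy_solutions a b. real n \<le> x \<and>
      (\<exists>p e. prime p \<and> e \<ge> 1 \<and> unitary_divisor (p ^ e) n \<and> L\<^sup>2 < real (p ^ e))}"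
    define B where "B = {n. n > 0 \<and> real n \<le> x \<and> L ^ 4 \<le> real (card {d. d dvd n})}"
    have A: "finite A" "real (card A) \<le> x / L\<^sup>2"
      using card_abundancy_solutions_large_prime_power[OF a, of x "L\<^sup>2" b] L by (simp_all add: A_def)
    have B: "finite B" "real (card B) \<le> x / L\<^sup>2"
    proof -
      show "finite B" by (rule finite_subset[of _ "{..nat \<lfloor>x\<rfloor>}"]) (auto simp: B_def le_nat_floor)
      show "real (card B) \<le> x / L\<^sup>2"
      proof -
        have "L ^ 4 > 0" using L by simp
        from card_many_divisors_le[OF L(2) this] show ?thesis
          using h(2) unfolding B_def L_def by (rule order_trans)
      qed
    qed
    have sub: "?S \<subseteq> {1..nat \<lfloor>x / L\<^sup>2\<rfloor>} \<union> A \<union> B"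
    proof
      fix n assume n: "n \<in> ?S"
      then have n0: "n > 0" "real n \<le> x" by (auto simp: abundancy_solutions_def)
      show "n \<in> {1..nat \<lfloor>x / L\<^sup>2\<rfloor>} \<union> A \<union> B"
      proof (cases "real n \<le> x / L\<^sup>2 \<or> n \<in> A")
        case True
        then show ?thesis using n0 by (auto simp: le_nat_floor)
      next
        case False
        have small: "real (p ^ e) \<le> L\<^sup>2" if "prime p" "e \<ge> 1" "unitary_divisor (p ^ e) n" for p e
        proof (rule ccontr)
          assume "\<not> real (p ^ e) \<le> L\<^sup>2"
          then have "n \<in> A" unfolding A_def using n that by (auto simp: not_le)
          then show False using False by blast
        qed
        have "L\<^sup>2 \<ge> 1" using L by (simp add: one_le_power)
        from prime_powers_small_imp_many_divisors[OF this n0(1) small]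
        obtain K where K: "real n \<le> (L\<^sup>2) ^ K" "2 ^ K \<le> card {d. d dvd n}" by blast
        have "x / L\<^sup>2 \<le> (L\<^sup>2) ^ K" using False K(1) by linarith
        then have "ln (x / L\<^sup>2) \<le> ln ((L\<^sup>2) ^ K)" using L by (intro ln_mono) auto
        then have "L - 2 * ln L \<le> real K * (2 * ln L)"
          using L by (simp add: ln_div ln_realpow L_def[symmetric])
        then have "(L - 2 * ln L) / (2 * ln L) \<le> real K" using lnL by (simp add: field_simps)
        then have "ln 2 * ((L - 2 * ln L) / (2 * ln L)) \<le> ln 2 * real K" by (intro mult_left_mono) auto
        then have "4 * ln L \<le> ln 2 * real K" using h(1) unfolding L_def by linarith
        then have "ln (L ^ 4) \<le> ln (2 ^ K)" using L by (simp add: ln_realpow mult.commute)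
        then have "L ^ 4 \<le> 2 ^ K" using L by (subst (asm) ln_le_cancel_iff) auto
        also have "\<dots> \<le> real (card {d. d dvd n})" using K(2) by (metis of_nat_mono of_nat_numeral of_nat_power)
        finally show ?thesis using n0 by (simp add: B_def)
      qed
    qed
    have "card ?S \<le> card ({1..nat \<lfloor>x / L\<^sup>2\<rfloor>} \<union> A \<union> B)"
      using sub A(1) B(1) by (intro card_mono) auto
    also have "\<dots> \<le> card {1..nat \<lfloor>x / L\<^sup>2\<rfloor>} + card A + card B"
      by (intro order_trans[OF card_Un_le] add_mono order_refl)
    finally have "real (card ?S) \<le> real (nat \<lfloor>x / L\<^sup>2\<rfloor>) + real (card A) + real (card B)"
      by (simp flip: of_nat_add)
    also have "real (nat \<lfloor>x / L\<^sup>2\<rfloor>) \<le> x / L\<^sup>2" using L by (intro of_nat_floor) auto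
    finally have "real (card ?S) \<le> 3 * (x / L\<^sup>2)" using A(2) B(2) by linarith
    also have "\<dots> \<le> 4 * x / L\<^sup>2" using L by (simp add: divide_right_mono)
    finally show "real (card ?S) \<le> 4 * x / (ln x)\<^sup>2" unfolding L_def .
  qed
qed

text \<open>The solutions between \<open>2 ^ i\<close> and \<open>2 ^ Suc i\<close> number
  \<open>O(2 ^ i / i^2)\<close> and each has reciprocal at most \<open>2 ^ (- i)\<close>, so the
  dyadic blocks are dominated by a convergent series. With a single logarithm saved, this argument
  would only give the harmonic series.\<close>

lemma abundancy_solutions_summable:
  assumes a: "a > 0"
  shows "(\<lambda>m. 1 / real m) summable_on abundancy_solutions a b"
proof (rule nonneg_bdd_above_summable_on)
  let ?P = "abundancy_solutions a b"
  obtain X :: real where X: "\<And>x. x \<ge> X \<Longrightarrow> real (card {m \<in> ?P. real m \<le> x}) \<le> 4 * x / (ln x)\<^sup>2"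
    using abundancy_solutions_count[OF a, of b] unfolding eventually_at_top_linorder by blast
  define blk where "blk i = {m \<in> ?P. 2 ^ i \<le> m \<and> m < 2 ^ Suc i}" for i :: nat
  define s where "s i = (\<Sum>m\<in>blk i. 1 / real m)" for i
  have finblk: "finite (blk i)" for i unfolding blk_def by (rule finite_subset[of _ "{..2 ^ Suc i}"]) auto
  have s0: "s i \<ge> 0" for i unfolding s_def by (intro sum_nonneg) auto
  have s_le: "s i \<le> real (card (blk i)) / 2 ^ i" for i
  proof -
    have "1 / real m \<le> 1 / 2 ^ i" if "m \<in> blk i" for m
    proof -
      have "real (2 ^ i) \<le> real m" using that unfolding blk_def by (intro of_nat_mono) auto
      then have "2 ^ i \<le> real m" by simp
      then show ?thesis by (intro frac_le) auto
    qed
    then have "s i \<le> (\<Sum>m\<in>blk i. 1 / 2 ^ i)" unfolding s_def by (rule sum_mono)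
    then show ?thesis by simp
  qed
  have ev: "\<forall>\<^sub>F i in sequentially. norm (s i) \<le> (8 / (ln 2)\<^sup>2) * (1 / (real (Suc i))\<^sup>2)"
  proof -
    have "\<forall>\<^sub>F i::nat in sequentially. (2::real) ^ Suc i \<ge> X" by real_asymp
    then show ?thesis
    proof eventually_elim
      fix i :: nat assume i: "(2::real) ^ Suc i \<ge> X"
      have "blk i \<subseteq> {m \<in> ?P. real m \<le> 2 ^ Suc i}"
      proof
        fix m assume m: "m \<in> blk i"
        then have "real m \<le> real (2 ^ Suc i)" unfolding blk_def by (intro of_nat_mono) auto
        then show "m \<in> {m \<in> ?P. real m \<le> 2 ^ Suc i}" using m by (simp add: blk_def)
      qed
      moreover have "finite {m \<in> ?P. real m \<le> 2 ^ Suc i}"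
        by (rule finite_subset[of _ "{..nat \<lfloor>(2::real) ^ Suc i\<rfloor>}"]) (auto simp: le_nat_floor)
      ultimately have "card (blk i) \<le> card {m \<in> ?P. real m \<le> 2 ^ Suc i}" by (intro card_mono)
      then have "real (card (blk i)) \<le> 4 * 2 ^ Suc i / (ln (2 ^ Suc i))\<^sup>2" using X[OF i] by linarith
      then have "real (card (blk i)) / 2 ^ i \<le> (4 * 2 ^ Suc i / (ln (2 ^ Suc i))\<^sup>2) / 2 ^ i" by (intro divide_right_mono) auto
      also have "\<dots> = (8 / (ln 2)\<^sup>2) * (1 / (real (Suc i))\<^sup>2)"
        unfolding ln_realpow by (simp add: field_simps power2_eq_square del: of_nat_Suc)
      finally show "norm (s i) \<le> (8 / (ln 2)\<^sup>2) * (1 / (real (Suc i))\<^sup>2)" using s_le[of i] s0[of i] by simp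
    qed
  qed
  have "summable (\<lambda>i. 1 / (real (Suc i))\<^sup>2)"
    using inverse_power_summable[of 2, where ?'a = real] by (subst summable_Suc_iff) (simp add: inverse_eq_divide)
  then have sm: "summable s"
    by (intro summable_comparison_test_ev[OF ev] summable_mult)
  show "bdd_above (sum (\<lambda>m. 1 / real m) ` {F. F \<subseteq> ?P \<and> finite F})"
  proof (rule bdd_aboveI2)
    fix F assume "F \<in> {F. F \<subseteq> ?P \<and> finite F}"
    then have F: "F \<subseteq> ?P" "finite F" by auto
    obtain k where k: "\<And>m. m \<in> F \<Longrightarrow> m < k" using F(2) unfolding finite_nat_set_iff_bounded by blast
    have cov: "F \<subseteq> (\<Union>i\<in>{..<k}. blk i)"
    proof
      fix m assume m: "m \<in> F"
      then have "m > 0" using F by (auto simp: abundancy_solutions_def)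
      then obtain i where i: "2 ^ i \<le> m" "m < 2 ^ Suc i" using ex_power_ivl1[of 2 m] by auto
      have "i < 2 ^ i" by (rule less_exp)
      then have "i < k" using i(1) k[OF m] by linarith
      then show "m \<in> (\<Union>i\<in>{..<k}. blk i)" using i m F(1) by (auto simp: blk_def)
    qed
    have "sum (\<lambda>m. 1 / real m) F \<le> sum (\<lambda>m. 1 / real m) (\<Union>i\<in>{..<k}. blk i)"
      using cov finblk by (intro sum_mono2) auto
    also have "\<dots> = (\<Sum>i<k. s i)" unfolding s_def
    proof (intro sum.UNION_disjoint ballI impI)
      have disj: "blk i \<inter> blk j = {}" if "i < j" for i j
      proof -
        have "(2::nat) ^ Suc i \<le> 2 ^ j" using that by (intro power_increasing) auto
        then show ?thesis unfolding blk_def by auto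
      qed
      show "blk i \<inter> blk j = {}" if "i \<noteq> j" for i j
        using disj[of i j] disj[of j i] that by (cases "i < j") auto
    qed (use finblk in auto)
    also have "\<dots> \<le> suminf s" using sm s0 by (intro sum_le_suminf) auto
    finally show "sum (\<lambda>m. 1 / real m) F \<le> suminf s" .
  qed
qed auto

section \<open>Counting within-perfect numbers\<close>

lemma abundancy_solution_iff:
  assumes "b > 0"
  shows "m \<in> abundancy_solutions a b \<longleftrightarrow> m \<ge> 1 \<and> real (divisor_sigma m) = real a / real b * real m"
proof -
  have "b * divisor_sigma m = a * m \<longleftrightarrow> real b * real (divisor_sigma m) = real a * real m"
    by (metis of_nat_eq_iff of_nat_mult)
  then show ?thesis using assms by (auto simp: abundancy_solutions_def field_simps)
qed

lemma abundancy_solutions_empty: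
  assumes "b > 0" "real a / real b \<notin> abundancy_values"
  shows "abundancy_solutions a b = {}"
proof (rule ccontr)
  assume "abundancy_solutions a b \<noteq> {}"
  then obtain m where "m \<ge> 1" "real (divisor_sigma m) = real a / real b * real m"
    using abundancy_solution_iff[OF assms(1)] by blast
  then have "real a / real b = real (divisor_sigma m) / real m" by (simp add: field_simps)
  then show False using assms(2) \<open>m \<ge> 1\<close> unfolding abundancy_values_def by blast
qed

lemma finite_within_perfect: "finite (within_perfect l k x)"
  by (rule finite_subset[of _ "{..nat \<lfloor>x\<rfloor>}"]) (auto simp: within_perfect_def le_nat_floor)

lemma within_perfect_defect:
  assumes "b > 0" "0 < c" "admissible_threshold c k" "n \<in> within_perfect (real a / real b) k x"
  shows "n > 0" "real n \<le> x" "\<bar>real_of_int (sigma_defect a b n)\<bar> < real b * x powr c"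
proof -
  show n: "n > 0" "real n \<le> x" using assms(4) by (auto simp: within_perfect_def)
  have "\<bar>real (divisor_sigma n) - real a / real b * real n\<bar> < k (real n)"
    using assms(4) by (simp add: within_perfect_def)
  also have "\<dots> \<le> real n powr c" using assms(3) n unfolding admissible_threshold_def by auto
  also have "\<dots> \<le> x powr c" using n assms(2) by (intro powr_mono2) auto
  finally have "real b * \<bar>real (divisor_sigma n) - real a / real b * real n\<bar> < real b * x powr c"
    using assms(1) by simp
  also have "real b * \<bar>real (divisor_sigma n) - real a / real b * real n\<bar> =
    \<bar>real b * (real (divisor_sigma n) - real a / real b * real n)\<bar>" by (simp add: abs_mult)
  also have "real b * (real (divisor_sigma n) - real a / real b * real n) = real_of_int (sigma_defect a b n)"
    using assms(1) by (simp add: sigma_defect_def field_simps)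
  finally show "\<bar>real_of_int (sigma_defect a b n)\<bar> < real b * x powr c" .
qed

lemma sigma_defect_eq_0_iff:
  assumes "n > 0"
  shows "sigma_defect a b n = 0 \<longleftrightarrow> n \<in> abundancy_solutions a b"
  using assms unfolding sigma_defect_def abundancy_solutions_def
  by (auto simp flip: of_nat_mult)

lemma card_within_perfect_sporadic:
  fixes a b :: nat and c x :: real
  assumes "a > 0" "b > 0" "0 < c" "admissible_threshold c k" "x \<ge> 1"
  shows "real (card {n \<in> within_perfect (real a / real b) k x. n \<notin> abundancy_solutions a b \<and>
      \<not> regular_multiple a b (x powr (2/3)) n})
    \<le> 45 * real a * real b * x powr (2/3 + c)" (is "real (card ?S) \<le> _")
proof -
  define J where "J = real b * x powr c"
  have "x powr c \<ge> 1" using assms by (simp add: ge_one_powr_ge_zero)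
  then have J: "J \<ge> 1" unfolding J_def using assms(2) mult_mono[of 1 "real b" 1 "x powr c"] by simp
  define N where "N = {n. small_defect a b x J n \<and> \<not> regular_multiple a b (x powr (2/3)) n}"
  note N = card_sporadic_le[OF assms(5,1,2) J, folded N_def]
  have "?S \<subseteq> N"
    unfolding N_def J_def small_defect_def using within_perfect_defect[OF assms(2,3,4)] sigma_defect_eq_0_iff by auto
  then have "real (card ?S) \<le> real (card N)"
    using N(1) by (intro of_nat_mono card_mono)
  also have "\<dots> \<le> 45 * real a * J * x powr (2/3)" by (rule N(2))
  also have "\<dots> = 45 * real a * real b * (x powr (2/3) * x powr c)" by (simp add: J_def)
  also have "\<dots> = 45 * real a * real b * x powr (2/3 + c)" by (simp only: powr_add)
  finally show ?thesis .
qed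

text \<open>Without exact solutions there are neither zero defects nor regular multiples, so the
  sporadic bound covers the whole set.\<close>

lemma card_within_perfect_non_abundancy:
  fixes a b :: nat and c x :: real
  assumes "a > 0" "b > 0" "0 < c" "admissible_threshold c k" "x \<ge> 1"
    "real a / real b \<notin> abundancy_values"
  shows "real (card (within_perfect (real a / real b) k x)) \<le> 45 * (real a * real b ^ 3 * x powr (2/3 + c))"
proof -
  have empty: "abundancy_solutions a b = {}" using assms abundancy_solutions_empty by blast
  then have "\<not> regular_multiple a b y n" for y n
    by (auto simp: regular_multiple_def abundancy_solutions_def)
  then have "within_perfect (real a / real b) k x = {n \<in> within_perfect (real a / real b) k x.
      n \<notin> abundancy_solutions a b \<and> \<not> regular_multiple a b (x powr (2/3)) n}"
    using empty by auto
  then have "real (card (within_perfect (real a / real b) k x)) \<le> 45 * real a * real b * x powr (2/3 + c)"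
    using card_within_perfect_sporadic[OF assms(1-5)] by simp
  also have "\<dots> \<le> 45 * (real a * real b ^ 3 * x powr (2/3 + c))"
  proof -
    have "real b ^ 1 \<le> real b ^ 3" using assms(2) by (intro power_increasing) auto
    then have "(45 * real a * x powr (2/3 + c)) * real b \<le> (45 * real a * x powr (2/3 + c)) * real b ^ 3"
      by (intro mult_left_mono) auto
    then show ?thesis by (simp add: mult_ac)
  qed
  finally show ?thesis .
qed

text \<open>From \<open>p * m <= x\<close> and \<open>p > x powr (2/3)\<close> follows
  \<open>m <= x powr (1/3)\<close>. This truncation is what later keeps \<open>ln (x / m)\<close>
  comparable with \<open>ln x\<close>.\<close>

lemma card_regular_multiples_le:
  fixes a b :: nat and x :: real
  assumes x: "x \<ge> 1"
  shows "real (card {n. real n \<le> x \<and> regular_multiple a b (x powr (2/3)) n})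
    \<le> (\<Sum>m | m \<in> abundancy_solutions a b \<and> real m \<le> x powr (1/3). real (prime_count (x / real m)))" (is "real (card ?R) \<le> _")
proof -
  define M where "M = {m. m \<in> abundancy_solutions a b \<and> real m \<le> x powr (1/3)}"
  have finM: "finite M"
    by (rule finite_subset[of _ "{..nat \<lfloor>x powr (1/3)\<rfloor>}"]) (auto simp: M_def le_nat_floor)
  define Q where "Q m = {p. prime p \<and> real p \<le> x / real m}" for m :: nat
  have finQ: "finite (Q m)" for m unfolding Q_def by (rule finite_primes_le)
  have sub: "?R \<subseteq> (\<Union>m\<in>M. (\<lambda>p. p * m) ` Q m)"
  proof
    fix n assume "n \<in> ?R"
    then obtain p m where pm: "real n \<le> x" "prime p" "x powr (2/3) < real p" "m > 0" "n = p * m"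
      "b * divisor_sigma m = a * m" unfolding regular_multiple_def by blast
    have rn: "real p * real m \<le> x" using pm(1,5) by simp
    have "x powr (2/3) * real m \<le> real p * real m" using pm(3) by (intro mult_right_mono) auto
    also note rn
    also have "x = x powr (2/3) * x powr (1/3)" using x by (simp flip: powr_add)
    finally have "real m \<le> x powr (1/3)" using x by simp
    then have "m \<in> M" using pm by (simp add: M_def abundancy_solutions_def)
    moreover have "p \<in> Q m" using pm(2,4) rn by (simp add: Q_def field_simps)
    ultimately show "n \<in> (\<Union>m\<in>M. (\<lambda>p. p * m) ` Q m)" using pm(5) by blast
  qed
  have "real (card ?R) \<le> real (card (\<Union>m\<in>M. (\<lambda>p. p * m) ` Q m))"
    using finM finQ by (intro of_nat_mono card_mono sub) auto
  also have "\<dots> \<le> (\<Sum>m\<in>M. real (prime_count (x / real m)))"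
  proof (rule real_card_UN_le[OF finM])
    fix m
    have "card ((\<lambda>p. p * m) ` Q m) \<le> card (Q m)" by (intro card_image_le finQ)
    then show "real (card ((\<lambda>p. p * m) ` Q m)) \<le> real (prime_count (x / real m))"
      by (simp add: Q_def prime_count_def)
  qed
  finally show ?thesis unfolding M_def .
qed

text \<open>The prime number theorem at \<open>x / m\<close>, where \<open>ln (x / m)\<close> is
  asymptotic to \<open>ln x\<close> for fixed \<open>m\<close>.\<close>

lemma prime_count_scaled:
  assumes "m > (0 :: nat)"
  shows "((\<lambda>x. real (prime_count (x / real m)) / (x / ln x)) \<longlongrightarrow> 1 / real m) at_top"
proof -
  define d where "d = real m"
  have d: "d > 0" using assms by (simp add: d_def)
  have "filterlim (\<lambda>x. x / d) at_top at_top" using d by real_asymp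
  from filterlim_compose[OF prime_number_theorem this]
  have 1: "((\<lambda>x. real (prime_count (x / d)) / ((x / d) / ln (x / d))) \<longlongrightarrow> 1) at_top" .
  have 2: "((\<lambda>x. ((x / d) / ln (x / d)) / (x / ln x)) \<longlongrightarrow> inverse d) at_top" using d by real_asymp
  define h where "h x = real (prime_count (x / d)) / ((x / d) / ln (x / d)) * (((x / d) / ln (x / d)) / (x / ln x))" for x
  have "((\<lambda>x. h x) \<longlongrightarrow> 1 * inverse d) at_top"
    unfolding h_def by (rule tendsto_mult[OF 1 2])
  moreover have "\<forall>\<^sub>F x in at_top. h x
    = real (prime_count (x / d)) / (x / ln x)"
    using eventually_gt_at_top[of d] eventually_gt_at_top[of 1]
  proof eventually_elim
    fix x assume x: "d < x" "1 < x"
    then have "(x / d) / ln (x / d) \<noteq> 0" using d by simp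
    then show "h x
    = real (prime_count (x / d)) / (x / ln x)" by (simp add: h_def)
  qed
  ultimately have "((\<lambda>x. real (prime_count (x / d)) / (x / ln x)) \<longlongrightarrow> 1 * inverse d) at_top"
    by (rule Lim_transform_eventually)
  then show ?thesis by (simp add: d_def inverse_eq_divide)
qed

text \<open>Limit and sum are exchanged by Tannery's theorem with majorant \<open>3 / m\<close>. For
  \<open>m <= x powr (1/3)\<close> one has \<open>ln (x / m) >= 2/3 * ln x\<close>, so the bound
  \<open>2 * y / ln y\<close> for the primes up to \<open>y = x / m\<close> becomes
  \<open>3 / m\<close> times \<open>x / ln x\<close>.\<close>

lemma regular_multiples_density:
  assumes sm: "(\<lambda>m. 1 / real m) summable_on P" and P: "0 \<notin> P"
  shows "((\<lambda>x. (\<Sum>m | m \<in> P \<and> real m \<le> x powr (1/3). real (prime_count (x / real m))) / (x / ln x))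
    \<longlongrightarrow> (\<Sum>\<^sub>\<infinity>m\<in>P. 1 / real m)) at_top"
proof -
  define w where "w m = (if m \<in> P then 1 / real m else 0)" for m
  define A where "A m x = (if m \<in> P \<and> real m \<le> x powr (1/3) then real (prime_count (x / real m)) / (x / ln x) else 0)"
    for m :: nat and x :: real
  have "((\<lambda>m. 1 / real m) has_sum (\<Sum>\<^sub>\<infinity>m\<in>P. 1 / real m)) P" using sm by simp
  then have "(w has_sum (\<Sum>\<^sub>\<infinity>m\<in>P. 1 / real m)) UNIV"
    using has_sum_cong_neutral[of UNIV P w "\<lambda>m. 1 / real m"] by (simp add: w_def)
  then have w: "w sums (\<Sum>\<^sub>\<infinity>m\<in>P. 1 / real m)" by (rule has_sum_imp_sums)
  have lim: "((\<lambda>x. A m x) \<longlongrightarrow> w m) at_top" for m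
  proof (cases "m \<in> P")
    case True
    then have "m > 0" using P by (metis gr0I)
    have "filterlim (\<lambda>x::real. x powr (1/3)) at_top at_top" by real_asymp
    then have "\<forall>\<^sub>F x::real in at_top. real m \<le> x powr (1/3)" by (simp add: filterlim_at_top)
    then have "\<forall>\<^sub>F x in at_top. real (prime_count (x / real m)) / (x / ln x) = A m x"
      by eventually_elim (use True in \<open>simp add: A_def\<close>)
    with prime_count_scaled[OF \<open>m > 0\<close>] show ?thesis
      using True unfolding w_def by (simp add: Lim_transform_eventually)
  next
    case False
    then show ?thesis by (simp add: A_def w_def)
  qed
  obtain Y :: real where Y: "\<And>y. y \<ge> Y \<Longrightarrow> real (prime_count y) / (y / ln y) < 2"
    using order_tendstoD(2)[OF prime_number_theorem, of 2] unfolding eventually_at_top_linorder by auto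
  have dom: "\<forall>\<^sub>F x in at_top. \<forall>m. norm (A m x) \<le> 3 * w m"
  proof -
    have "\<forall>\<^sub>F x::real in at_top. x powr (2/3) \<ge> Y" by real_asymp
    then show ?thesis using eventually_gt_at_top[of 1]
    proof eventually_elim
      fix x :: real assume x: "x powr (2/3) \<ge> Y" "x > 1"
      show "\<forall>m. norm (A m x) \<le> 3 * w m"
      proof
        fix m show "norm (A m x) \<le> 3 * w m"
        proof (cases "m \<in> P \<and> real m \<le> x powr (1/3)")
          case False
          then show ?thesis by (auto simp: A_def w_def)
        next
          case True
          then have m0: "real m > 0" using P by (metis gr0I of_nat_0_less_iff)
          define y where "y = x / real m"
          have "x powr (2/3) * real m \<le> x powr (2/3) * x powr (1/3)" using True by (intro mult_left_mono) auto
          also have "\<dots> = x" using x by (simp flip: powr_add)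
          finally have y: "x powr (2/3) \<le> y" using m0 by (simp add: y_def field_simps)
          have xp: "x powr (2/3) > 1" using x by (simp add: gr_one_powr)
          then have y1: "y > 1" using y by simp
          have lnx: "ln x > 0" using x by simp
          have "ln (x powr (2/3)) \<le> ln y" using y xp y1 by (intro ln_mono) auto
          then have lny: "2/3 * ln x \<le> ln y" using x by (simp add: ln_powr)
          have "real (prime_count y) / (y / ln y) < 2" using Y y x by simp
          then have "real (prime_count y) * ln y \<le> 2 * y" using y1 by (simp add: field_simps)
          moreover have "real (prime_count y) * (2/3 * ln x) \<le> real (prime_count y) * ln y"
            using lny by (intro mult_left_mono) auto
          ultimately have "real (prime_count y) * ln x \<le> 3 * y" by simp
          then have "real (prime_count y) * ln x / x \<le> 3 * y / x" using x by (intro divide_right_mono) auto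
          then show ?thesis using True x m0 lnx by (simp add: A_def w_def y_def)
        qed
      qed
    qed
  qed
  have "((\<lambda>x. suminf (\<lambda>m. A m x)) \<longlongrightarrow> suminf w) at_top"
  proof -
    have "\<forall>\<^sub>F (m, x) in at_top \<times>\<^sub>F at_top. norm (A m x) \<le> 3 * w m"
      unfolding eventually_prod_filter
      using dom by (intro exI[of _ "\<lambda>_. True"] exI[of _ "\<lambda>x. \<forall>m. norm (A m x) \<le> 3 * w m"]) auto
    moreover have "summable (\<lambda>m. 3 * w m)" using w by (intro summable_mult) (auto simp: sums_iff)
    ultimately show ?thesis
      using tannerys_theorem[where a = A and b = w and M = "\<lambda>m. 3 * w m" and F = at_top, OF lim] by simp
  qed
  moreover have "suminf (\<lambda>m. A m x) = (\<Sum>m | m \<in> P \<and> real m \<le> x powr (1/3). real (prime_count (x / real m))) / (x / ln x)" for x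
  proof -
    have fin: "finite {m. m \<in> P \<and> real m \<le> x powr (1/3)}"
      by (rule finite_subset[of _ "{..nat \<lfloor>x powr (1/3)\<rfloor>}"]) (auto simp: le_nat_floor)
    have "suminf (\<lambda>m. A m x) = (\<Sum>m | m \<in> P \<and> real m \<le> x powr (1/3). A m x)"
      by (rule suminf_finite[OF fin]) (auto simp: A_def)
    also have "\<dots> = (\<Sum>m | m \<in> P \<and> real m \<le> x powr (1/3). real (prime_count (x / real m)) / (x / ln x))"
      by (intro sum.cong) (auto simp: A_def)
    finally show ?thesis unfolding sum_divide_distrib .
  qed
  moreover have "suminf w = (\<Sum>\<^sub>\<infinity>m\<in>P. 1 / real m)" using w by (simp add: sums_iff)
  ultimately show ?thesis by simp
qed

lemma within_perfect_upper:
  fixes a b :: nat and c :: real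
  assumes "a > 0" "b > 0" "0 < c" "c < 1/3" "admissible_threshold c k" and l: "S < l"
    and S: "S = (\<Sum>\<^sub>\<infinity>m\<in>abundancy_solutions a b. 1 / real m)"
  shows "\<forall>\<^sub>F x in at_top. real (card (within_perfect (real a / real b) k x)) / (x / ln x) < l"
proof -
  let ?P = "abundancy_solutions a b"
  \<comment> \<open>The three summands bound, in this order, the exact solutions, the sporadic
    elements and the regular multiples, each divided by \<open>x / ln x\<close>.\<close>
  define U where "U x = 4 / ln x + 45 * real a * real b * (x powr (2/3 + c) / (x / ln x))
    + (\<Sum>m | m \<in> ?P \<and> real m \<le> x powr (1/3). real (prime_count (x / real m))) / (x / ln x)" for x
  have "0 \<notin> ?P" by (simp add: abundancy_solutions_def)
  have "((\<lambda>x::real. 4 / ln x) \<longlongrightarrow> 0) at_top" by real_asymp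
  moreover have "((\<lambda>x. x powr (2/3 + c) / (x / ln x)) \<longlongrightarrow> 0) at_top"
  proof -
    \<comment> \<open>The assumption \<open>c < 1/3\<close> enters here: the power saving
      \<open>x powr (- d)\<close> beats the logarithm.\<close>
    define d where "d = 1/3 - c"
    have d: "d > 0" using assms(4) by (simp add: d_def)
    have "((\<lambda>x::real. ln x * x powr (- d)) \<longlongrightarrow> 0) at_top" using d by real_asymp
    moreover have "\<forall>\<^sub>F x::real in at_top. ln x * x powr (- d) = x powr (2/3 + c) / (x / ln x)"
      using eventually_gt_at_top[of 1]
    proof eventually_elim
      fix x :: real assume x: "x > 1"
      have "x powr (2/3 + c) = x powr (- d) * x powr 1"
        unfolding powr_add[symmetric] by (simp add: d_def)
      then show "ln x * x powr (- d) = x powr (2/3 + c) / (x / ln x)" using x by simp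
    qed
    ultimately show ?thesis by (rule Lim_transform_eventually)
  qed
  ultimately have "(U \<longlongrightarrow> 0 + 45 * real a * real b * 0 + S) at_top"
    unfolding U_def S
    using regular_multiples_density[OF abundancy_solutions_summable[OF assms(1)] \<open>0 \<notin> ?P\<close>]
    by (intro tendsto_add tendsto_mult tendsto_const)
  then have "\<forall>\<^sub>F x in at_top. U x < l" using l by (intro order_tendstoD(2)) auto
  then show ?thesis
    using abundancy_solutions_count[OF assms(1), of b] eventually_gt_at_top[of 1]
  proof eventually_elim
    fix x :: real
    assume x: "U x < l" "real (card {m \<in> ?P. real m \<le> x}) \<le> 4 * x / (ln x)\<^sup>2" "1 < x"
    let ?W = "within_perfect (real a / real b) k x" and ?R = "regular_multiple a b (x powr (2/3))"
    have lnx: "ln x > 0" using x(3) by simp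
    let ?A = "{m \<in> ?P. real m \<le> x}" and ?B = "{n \<in> ?W. n \<notin> ?P \<and> \<not> ?R n}" and ?C = "{n. real n \<le> x \<and> ?R n}"
    have fin: "finite ?A" "finite ?B" "finite ?C"
      using finite_within_perfect by (auto intro: finite_subset[of _ "{..nat \<lfloor>x\<rfloor>}"] simp: le_nat_floor)
    have "?W \<subseteq> ?A \<union> ?B \<union> ?C" by (auto simp: within_perfect_def)
    then have "card ?W \<le> card (?A \<union> ?B \<union> ?C)" using fin by (intro card_mono) auto
    also have "\<dots> \<le> card ?A + card ?B + card ?C"
      by (intro order_trans[OF card_Un_le] add_mono order_refl)
    finally have "real (card ?W) \<le> real (card ?A) + real (card ?B) + real (card ?C)"
      by (simp flip: of_nat_add)
    also have "\<dots> \<le> 4 * x / (ln x)\<^sup>2 + 45 * real a * real b * x powr (2/3 + c)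
      + (\<Sum>m | m \<in> ?P \<and> real m \<le> x powr (1/3). real (prime_count (x / real m)))"
      using x card_within_perfect_sporadic[OF assms(1,2,3,5), of x] card_regular_multiples_le[of x a b]
      by (intro add_mono) auto
    finally have "real (card ?W) / (x / ln x) \<le> (4 * x / (ln x)\<^sup>2 + 45 * real a * real b * x powr (2/3 + c)
      + (\<Sum>m | m \<in> ?P \<and> real m \<le> x powr (1/3). real (prime_count (x / real m)))) / (x / ln x)"
      using x(3) by (intro divide_right_mono) auto
    also have "\<dots> = U x"
    proof -
      have "4 * x / (ln x)\<^sup>2 / (x / ln x) = 4 / ln x" using x(3) lnx by (simp add: field_simps power2_eq_square)
      then show ?thesis unfolding U_def add_divide_distrib by simp
    qed
    finally show "real (card ?W) / (x / ln x) < l" using x(1) by linarith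
  qed
qed

text \<open>The excess of \<open>sigma (p * m)\<close> over the target is \<open>sigma m\<close>, a
  constant for fixed \<open>m\<close>, while the threshold at \<open>p * m\<close> is at least
  \<open>p powr \<delta>\<close>.\<close>

lemma prime_multiple_within_perfect:
  fixes a b :: nat and c \<delta> :: real
  assumes "b > 0" and m: "m \<in> abundancy_solutions a b" and p: "prime p" "m < p"
    and big: "real (divisor_sigma m) < real p powr \<delta>" and \<delta>: "\<delta> > 0" and k: "\<And>y. y \<ge> 1 \<Longrightarrow> y powr \<delta> \<le> k y"
    and x: "real p \<le> x / real m"
  shows "p * m \<in> within_perfect (real a / real b) k x"
proof -
  have m0: "m > 0" using m by (simp add: abundancy_solutions_def)
  have p0: "p > 0" using p by simp
  have "\<not> p dvd m" using p(2) m0 by (auto dest: dvd_imp_le)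
  then have "coprime p m" using p(1) by (simp add: prime_imp_coprime)
  then have s: "divisor_sigma (p * m) = (p + 1) * divisor_sigma m"
    using divisor_sigma_mult_coprime[of p m] p0 m0 divisor_sigma_prime[OF p(1)] by simp
  have "real (divisor_sigma m) = real a / real b * real m" using abundancy_solution_iff[OF assms(1)] m by blast
  then have "real (divisor_sigma (p * m)) - real a / real b * real (p * m) = real (divisor_sigma m)"
    unfolding s by (simp add: algebra_simps)
  moreover have "real (divisor_sigma m) < k (real (p * m))"
  proof -
    have "p \<le> p * m" using m0 by simp
    then have "real p \<le> real (p * m)" by (rule of_nat_mono)
    then have "real p powr \<delta> \<le> real (p * m) powr \<delta>" using \<delta> by (intro powr_mono2) auto
    also have "\<dots> \<le> k (real (p * m))"
      using p0 m0 by (intro k) (metis Suc_leI nat_0_less_mult_iff of_nat_1 of_nat_mono One_nat_def)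
    finally show ?thesis using big by linarith
  qed
  moreover have "real (p * m) \<le> x" using x m0 by (simp add: field_simps)
  ultimately show ?thesis using p0 m0 unfolding within_perfect_def by (simp add: Suc_le_eq)
qed

text \<open>A finite set \<open>F\<close> of exact solutions already carries more than
  \<open>l\<close> of the sum. Every prime beyond a bound \<open>p0\<close> depending only on
  \<open>F\<close> and \<open>\<delta>\<close> gives an element for each \<open>m\<close> in
  \<open>F\<close>, and the discarded primes vanish against \<open>x / ln x\<close>.\<close>

lemma within_perfect_lower:
  fixes a b :: nat and c \<delta> :: real
  assumes "a > 0" "b > 0" and \<delta>: "\<delta> > 0" "\<And>y. y \<ge> 1 \<Longrightarrow> y powr \<delta> \<le> k y" and l: "l < S"
    and S: "S = (\<Sum>\<^sub>\<infinity>m\<in>abundancy_solutions a b. 1 / real m)"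
  shows "\<forall>\<^sub>F x in at_top. l < real (card (within_perfect (real a / real b) k x)) / (x / ln x)"
proof -
  let ?P = "abundancy_solutions a b"
  have "((\<lambda>m. 1 / real m) has_sum S) ?P" unfolding S using abundancy_solutions_summable[OF assms(1)] by simp
  then have "\<forall>\<^sub>F F in finite_subsets_at_top ?P. l < (\<Sum>m\<in>F. 1 / real m)"
    unfolding has_sum_def using l by (rule order_tendstoD(1))
  then obtain F where F: "finite F" "F \<subseteq> ?P" "l < (\<Sum>m\<in>F. 1 / real m)"
    unfolding eventually_finite_subsets_at_top by blast
  define D where "D = real (\<Sum>m\<in>F. divisor_sigma m)"
  \<comment> \<open>The first summand makes \<open>p powr \<delta>\<close> exceed every
    \<open>divisor_sigma m\<close> with \<open>m\<close> in \<open>F\<close>, strictly because of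
    the \<open>+ 1\<close>; the second makes \<open>p\<close> exceed every element of
    \<open>F\<close>.\<close>
  define p0 where "p0 = nat \<lceil>(D + 1) powr (1 / \<delta>)\<rceil> + (\<Sum>m\<in>F. m)"
  have big: "m < p \<and> real (divisor_sigma m) < real p powr \<delta>" if "m \<in> F" "p0 < p" for m p
  proof
    have "m \<le> (\<Sum>m\<in>F. m)" using that F(1) by (intro member_le_sum) auto
    then show "m < p" using that by (simp add: p0_def)
    have "divisor_sigma m \<le> (\<Sum>m\<in>F. divisor_sigma m)" using that F(1) by (intro member_le_sum) auto
    then have "real (divisor_sigma m) \<le> D" unfolding D_def by (rule of_nat_mono)
    also have "D < D + 1" by simp
    also have "D + 1 = ((D + 1) powr (1 / \<delta>)) powr \<delta>"
      using \<delta>(1) by (simp add: powr_powr D_def sum_nonneg add_nonneg_pos less_imp_le)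
    also have "\<dots> \<le> real p powr \<delta>"
    proof (rule powr_mono2)
      have "(D + 1) powr (1 / \<delta>) \<le> real (nat \<lceil>(D + 1) powr (1 / \<delta>)\<rceil>)" by (rule real_nat_ceiling_ge)
      also have "\<dots> \<le> real p" using that(2) unfolding p0_def by (intro of_nat_mono) linarith
      finally show "(D + 1) powr (1 / \<delta>) \<le> real p" .
    qed (use \<delta> in auto)
    finally show "real (divisor_sigma m) < real p powr \<delta>" .
  qed
  define V where "V x = (\<Sum>m\<in>F. real (prime_count (x / real m)) / (x / ln x) - real p0 / (x / ln x))" for x :: real
  have lim0: "((\<lambda>x::real. real p0 / (x / ln x)) \<longlongrightarrow> 0) at_top" by real_asymp
  have "(V \<longlongrightarrow> (\<Sum>m\<in>F. 1 / real m - 0)) at_top"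
    unfolding V_def using F(2) lim0
    by (intro tendsto_sum tendsto_diff prime_count_scaled) (auto simp: abundancy_solutions_def)
  then have "\<forall>\<^sub>F x in at_top. l < V x" using F(3) by (intro order_tendstoD(1)) auto
  then show ?thesis using eventually_gt_at_top[of 1]
  proof eventually_elim
    fix x :: real assume x: "l < V x" "1 < x"
    let ?W = "within_perfect (real a / real b) k x"
    define Q where "Q m = {p. prime p \<and> real p \<le> x / real m} - {..p0}" for m :: nat
    have m0: "m > 0" if "m \<in> F" for m using that F(2) by (auto simp: abundancy_solutions_def)
    have finQ: "finite (Q m)" for m unfolding Q_def using finite_primes_le by blast
    have Q: "real (card (Q m)) \<ge> real (prime_count (x / real m)) - real p0" if "m \<in> F" for m
    proof -
      have "card ({p. prime p \<and> real p \<le> x / real m} - {1..p0}) \<ge> prime_count (x / real m) - card {1..p0}"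
        unfolding prime_count_def by (rule diff_card_le_card_Diff) simp
      moreover have "{p. prime p \<and> real p \<le> x / real m} - {1..p0} = Q m"
        unfolding Q_def using prime_gt_0_nat by (auto simp: Suc_le_eq)
      ultimately show ?thesis by simp
    qed
    \<comment> \<open>From \<open>p * m = p' * m'\<close> the prime \<open>p\<close> divides
      \<open>p' * m'\<close>; being larger than \<open>m'\<close> it cannot divide
      \<open>m'\<close>, so it equals \<open>p'\<close>.\<close>
    have disj: "(\<lambda>p. p * m) ` Q m \<inter> (\<lambda>p. p * m') ` Q m' = {}" if mm: "m \<in> F" "m' \<in> F" "m \<noteq> m'" for m m'
    proof (rule ccontr)
      assume "\<not> ?thesis"
      then obtain p p' where p: "p \<in> Q m" "p' \<in> Q m'" "p * m = p' * m'" by auto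
      have pr: "prime p" "prime p'" "p > m'" using p mm big[of m' p] by (auto simp: Q_def)
      have "p dvd p' * m'" using p(3) by (metis dvd_triv_left)
      moreover have "\<not> p dvd m'" using pr(3) m0[OF mm(2)] by (auto dest: dvd_imp_le)
      ultimately have "p dvd p'" using pr(1) by (simp add: prime_dvd_mult_iff)
      then have "p = p'" using pr by (simp add: primes_dvd_imp_eq)
      then show False using p(3) mm(3) pr by simp
    qed
    have sub: "(\<Union>m\<in>F. (\<lambda>p. p * m) ` Q m) \<subseteq> ?W"
    proof
      fix n assume "n \<in> (\<Union>m\<in>F. (\<lambda>p. p * m) ` Q m)"
      then obtain m p where mp: "m \<in> F" "p \<in> Q m" "n = p * m" by blast
      show "n \<in> ?W" unfolding mp(3)
        using mp F(2) big[of m p] \<delta> assms(2) by (intro prime_multiple_within_perfect[where \<delta> = \<delta>]) (auto simp: Q_def)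
    qed
    have "V x = (\<Sum>m\<in>F. real (prime_count (x / real m)) - real p0) / (x / ln x)"
      unfolding V_def sum_divide_distrib diff_divide_distrib ..
    also have "\<dots> \<le> real (card ?W) / (x / ln x)"
    proof (rule divide_right_mono)
      have "(\<Sum>m\<in>F. real (prime_count (x / real m)) - real p0) \<le> (\<Sum>m\<in>F. real (card (Q m)))"
        using Q by (rule sum_mono)
      also have "\<dots> = (\<Sum>m\<in>F. real (card ((\<lambda>p. p * m) ` Q m)))"
      proof (rule sum.cong[OF refl])
        fix m assume "m \<in> F"
        then have "m > 0" by (rule m0)
        then have "inj_on (\<lambda>p. p * m) (Q m)" by (intro inj_onI) simp
        then show "real (card (Q m)) = real (card ((\<lambda>p. p * m) ` Q m))" by (simp add: card_image)
      qed
      also have "\<dots> = real (card (\<Union>m\<in>F. (\<lambda>p. p * m) ` Q m))"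
        using F(1) finQ disj by (subst card_UN_disjoint) auto
      also have "\<dots> \<le> real (card ?W)" using sub finite_within_perfect by (intro of_nat_mono card_mono)
      finally show "(\<Sum>m\<in>F. real (prime_count (x / real m)) - real p0) \<le> real (card ?W)" .
    qed (use x in auto)
    finally show "l < real (card ?W) / (x / ln x)" using x(1) by linarith
  qed
qed

text \<open>\<open>C\<close> and \<open>\<epsilon>\<close> are quantified before \<open>c\<close>,
  \<open>k\<close>, \<open>a\<close> and \<open>b\<close>, which expresses uniformity in these data;
  the proof supplies 45, from \<open>card_sporadic_le\<close>, and the zero function. Summability is
  asserted along with the limit because an infinite sum defaults to 0 when it diverges.\<close>

theorem theorem1p1:
  shows
    "(\<exists>(C :: real) (\<epsilon> :: real \<Rightarrow> real). (\<epsilon> \<longlongrightarrow> 0) at_top \<and>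
       (\<forall>(c :: real) (k :: real \<Rightarrow> real) (a :: nat) (b :: nat) (x :: real).
          0 < c \<longrightarrow> c < 1/3 \<longrightarrow> admissible_threshold c k \<longrightarrow>
          0 < a \<longrightarrow> 0 < b \<longrightarrow> coprime a b \<longrightarrow>
          real a / real b \<notin> abundancy_values \<longrightarrow>
          1 < real a / real b \<longrightarrow> real a / real b \<le> x powr c \<longrightarrow> 1 \<le> x \<longrightarrow>
          real (card (within_perfect (real a / real b) k x))
            \<le> C * (real a * real b ^ 3 * x powr (2/3 + c + \<epsilon> x))))
     \<and>
     (\<forall>(c :: real) (k :: real \<Rightarrow> real) (a :: nat) (b :: nat) (\<delta> :: real).
        0 < c \<longrightarrow> c < 1/3 \<longrightarrow> admissible_threshold c k \<longrightarrow>
        0 < a \<longrightarrow> 0 < b \<longrightarrow> coprime a b \<longrightarrow>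
        real a / real b \<in> abundancy_values \<longrightarrow>
        0 < \<delta> \<longrightarrow> (\<forall>y\<ge>1. y powr \<delta> \<le> k y) \<longrightarrow>
        (\<lambda>m. 1 / real m) summable_on
          {m :: nat. m \<ge> 1 \<and> real (divisor_sigma m) = real a / real b * real m} \<and>
        ((\<lambda>x. real (card (within_perfect (real a / real b) k x)) / (x / ln x)) \<longlongrightarrow>
          (\<Sum>\<^sub>\<infinity>m \<in> {m :: nat. m \<ge> 1 \<and> real (divisor_sigma m) = real a / real b * real m}.
             1 / real m)) at_top)"
proof (intro conjI allI impI exI[of _ 45] exI[of _ "\<lambda>_. 0"])
  fix c :: real and k :: "real \<Rightarrow> real" and a b :: nat and x :: real
  assume "0 < c" "admissible_threshold c k" "0 < a" "0 < b" "real a / real b \<notin> abundancy_values" "1 \<le> x"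
  then show "real (card (within_perfect (real a / real b) k x))
      \<le> 45 * (real a * real b ^ 3 * x powr (2/3 + c + 0))"
    using card_within_perfect_non_abundancy by simp
next
  fix c :: real and k :: "real \<Rightarrow> real" and a b :: nat and \<delta> :: real
  let ?P = "{m :: nat. m \<ge> 1 \<and> real (divisor_sigma m) = real a / real b * real m}"
  assume c: "0 < c" "c < 1/3" "admissible_threshold c k" and ab: "0 < a" "0 < b"
    and \<delta>: "0 < \<delta>" "\<forall>y\<ge>1. y powr \<delta> \<le> k y"
  have P: "?P = abundancy_solutions a b" using abundancy_solution_iff[OF ab(2)] by blast
  show "(\<lambda>m. 1 / real m) summable_on ?P"
    unfolding P by (rule abundancy_solutions_summable[OF ab(1)])
  show "((\<lambda>x. real (card (within_perfect (real a / real b) k x)) / (x / ln x)) \<longlongrightarrow>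
      (\<Sum>\<^sub>\<infinity>m\<in>?P. 1 / real m)) at_top"
    unfolding P
  proof (rule order_tendstoI)
    fix l assume "l < (\<Sum>\<^sub>\<infinity>m\<in>abundancy_solutions a b. 1 / real m)"
    then show "\<forall>\<^sub>F x in at_top. l < real (card (within_perfect (real a / real b) k x)) / (x / ln x)"
      using \<delta> by (intro within_perfect_lower[OF ab \<delta>(1) _ _ refl]) auto
  next
    fix l assume "(\<Sum>\<^sub>\<infinity>m\<in>abundancy_solutions a b. 1 / real m) < l"
    then show "\<forall>\<^sub>F x in at_top. real (card (within_perfect (real a / real b) k x)) / (x / ln x) < l"
      by (rule within_perfect_upper[OF ab c _ refl])
  qed
qed (rule tendsto_const)

end
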